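(* Let $(\boldsymbol{\xi}_1,\ldots,\boldsymbol{\xi}_{d})$ be a family of $d$ linearly independent vectors of $\mathbb{R}^d$, $\boldsymbol{\Xi}=[\boldsymbol{\xi}_1\cdots\boldsymbol{\xi}_d]$, $\boldsymbol{\xi}_{d+1}=\sum_{k=1}^d \boldsymbol{\xi}_k$, and $\boldsymbol{\Xi}_{d+1} = [\boldsymbol{\xi}_1\cdots\boldsymbol{\xi}_{d+1}]$. Then the collection $\{B_{\boldsymbol{\Xi}_{d+1}}(\cdot-\boldsymbol{\Xi} \mathbf{k})\colon \mathbf{k} \in \mathbb{Z}^d\}$ of linear box splines forms a Riesz basis (of its closed linear span in $L_2(\mathbb{R}^d)$) with Riesz bounds $$A = \sqrt{\frac{|\det \boldsymbol{\Xi}|}{d+2}} \quad\text{and}\quad B = \sqrt{|\det \boldsymbol{\Xi}|}.$$ The associated Riesz condition number is $\sqrt{d+2}$.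
   Context: Here $d\ge1$. The linear box spline $B_{\boldsymbol{\Xi}_{d+1}}\colon\mathbb{R}^d\to\mathbb{R}$ is the continuous, compactly supported function defined by its Fourier transform (with $\widehat f(\boldsymbol{\omega})=\int_{\mathbb{R}^d} f(\mathbf{x})e^{-\mathrm{i}\boldsymbol{\omega}^T\mathbf{x}}\,d\mathbf{x}$) $$\widehat{B}_{\boldsymbol{\Xi}_{d+1}}(\boldsymbol{\omega}) = |\det \boldsymbol{\Xi}| \prod_{k=1}^{d+1} \frac{1-e^{-\mathrm{i} \boldsymbol{\xi}_{k}^T\boldsymbol{\omega}}}{\mathrm{i}\boldsymbol{\xi}_{k}^T\boldsymbol{\omega}},$$ each factor being extended by continuity (value $1$) where $\boldsymbol{\xi}_k^T\boldsymbol{\omega}=0$. A countable collection $\{\varphi_{\mathbf{k}}\}$ in a separable complex Hilbert space $\mathcal{H}$ of functions (with $L_2$ norm) is a Riesz basis of $\mathcal{H}$ if the closure of its linear span is $\mathcal{H}$ and there exist $0<A\le B<\infty$ such that $A\|c\|_{\ell_2}\le\|\sum_{\mathbf{k}}c_{\mathbf{k}}\varphi_{\mathbf{k}}\|_{L_2}\le B\|c\|_{\ell_2}$ for every complex square-summable sequence $c$. The Riesz bounds are the tightest such constants $A$ and $B$, and the Riesz condition number is $B/A$. *)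

theory Defs
  imports "HOL-Analysis.Analysis"
begin

section \<open>Square-integrable functions and Riesz bases\<close>

text \<open>
  Elements of \<open>L\<^sub>2\<close> are represented by Borel functions, not identified almost
  everywhere (every class of Lebesgue measurable functions contains a Borel one), so
  \<open>L2_norm\<close> is a seminorm here, and an \<open>L2_closure\<close> is closed under
  almost-everywhere equality.
\<close>

definition L2_space :: "('a::euclidean_space \<Rightarrow> complex) set" where
  "L2_space = {f. f \<in> borel_measurable lborel \<and> integrable lborel (\<lambda>x. (cmod (f x))\<^sup>2)}"

definition L2_norm :: "('a::euclidean_space \<Rightarrow> complex) \<Rightarrow> real" where
  "L2_norm f = sqrt (LINT x|lborel. (cmod (f x))\<^sup>2)"

definition L2_closure ::
  "('a::euclidean_space \<Rightarrow> complex) set \<Rightarrow> ('a \<Rightarrow> complex) set" where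
  "L2_closure S = {f \<in> L2_space. \<forall>\<epsilon>>0. \<exists>g\<in>S. L2_norm (\<lambda>x. f x - g x) < \<epsilon>}"

definition closed_L2_subspace :: "('a::euclidean_space \<Rightarrow> complex) set \<Rightarrow> bool" where
  "closed_L2_subspace H \<longleftrightarrow>
     H \<subseteq> L2_space \<and> (\<lambda>x. 0) \<in> H \<and>
     (\<forall>f\<in>H. \<forall>g\<in>H. (\<lambda>x. f x + g x) \<in> H) \<and>
     (\<forall>a. \<forall>f\<in>H. (\<lambda>x. a * f x) \<in> H) \<and>
     L2_closure H = H"

definition linear_span :: "('k \<Rightarrow> 'a \<Rightarrow> complex) \<Rightarrow> ('a \<Rightarrow> complex) set" where
  "linear_span \<phi> = {\<lambda>x. \<Sum>k\<in>F. c k * \<phi> k x | F c. finite F}"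

definition ell2 :: "('k \<Rightarrow> complex) set" where
  "ell2 = {c. (\<lambda>k. (cmod (c k))\<^sup>2) summable_on UNIV}"

definition ell2_norm :: "('k \<Rightarrow> complex) \<Rightarrow> real" where
  "ell2_norm c = sqrt (\<Sum>\<^sub>\<infinity>k. (cmod (c k))\<^sup>2)"

text \<open>The sum of a series in \<open>L\<^sub>2\<close> is the limit, in norm, of its finite partial
  sums (unordered convergence); it is determined up to almost-everywhere equality.\<close>

definition L2_has_sum ::
  "('k \<Rightarrow> 'a::euclidean_space \<Rightarrow> complex) \<Rightarrow> ('a \<Rightarrow> complex) \<Rightarrow> bool" where
  "L2_has_sum \<psi> f \<longleftrightarrow>
     f \<in> L2_space \<and>
     ((\<lambda>F. L2_norm (\<lambda>x. (\<Sum>k\<in>F. \<psi> k x) - f x)) \<longlongrightarrow> 0) (finite_subsets_at_top UNIV)"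

definition riesz_constants ::
  "('k \<Rightarrow> 'a::euclidean_space \<Rightarrow> complex) \<Rightarrow> real \<Rightarrow> real \<Rightarrow> bool" where
  "riesz_constants \<phi> A B \<longleftrightarrow>
     0 < A \<and> A \<le> B \<and>
     (\<forall>c\<in>ell2.
        (\<exists>f. L2_has_sum (\<lambda>k x. c k * \<phi> k x) f) \<and>
        (\<forall>f. L2_has_sum (\<lambda>k x. c k * \<phi> k x) f \<longrightarrow>
           A * ell2_norm c \<le> L2_norm f \<and> L2_norm f \<le> B * ell2_norm c))"

definition riesz_basis ::
  "('k \<Rightarrow> 'a::euclidean_space \<Rightarrow> complex) \<Rightarrow> ('a \<Rightarrow> complex) set \<Rightarrow> bool" where
  "riesz_basis \<phi> H \<longleftrightarrow>
     countable (UNIV :: 'k set) \<and> closed_L2_subspace H \<and> range \<phi> \<subseteq> H \<and>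
     L2_closure (linear_span \<phi>) = H \<and> (\<exists>A B. riesz_constants \<phi> A B)"

definition lower_riesz_bound :: "('k \<Rightarrow> 'a::euclidean_space \<Rightarrow> complex) \<Rightarrow> real" where
  "lower_riesz_bound \<phi> = (GREATEST A. \<exists>B. riesz_constants \<phi> A B)"

definition upper_riesz_bound :: "('k \<Rightarrow> 'a::euclidean_space \<Rightarrow> complex) \<Rightarrow> real" where
  "upper_riesz_bound \<phi> = (LEAST B. \<exists>A. riesz_constants \<phi> A B)"

definition riesz_condition_number :: "('k \<Rightarrow> 'a::euclidean_space \<Rightarrow> complex) \<Rightarrow> real" where
  "riesz_condition_number \<phi> = upper_riesz_bound \<phi> / lower_riesz_bound \<phi>"


section \<open>Linear box splines\<close>

definition fourier_transform :: "('a::euclidean_space \<Rightarrow> complex) \<Rightarrow> 'a \<Rightarrow> complex" where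
  "fourier_transform f \<omega> = (LINT x|lborel. f x * exp (- \<i> * complex_of_real (\<omega> \<bullet> x)))"

definition column_matrix :: "('n \<Rightarrow> real^'n) \<Rightarrow> real^'n^'n" where
  "column_matrix \<xi> = (\<chi> i j. \<xi> j $ i)"

text \<open>The additional direction \<open>\<xi>\<^sub>d\<^sub>+\<^sub>1\<close> has index \<^const>\<open>None\<close>.\<close>

fun extended_directions :: "('n::finite \<Rightarrow> real^'n) \<Rightarrow> 'n option \<Rightarrow> real^'n" where
  "extended_directions \<xi> (Some k) = \<xi> k"
| "extended_directions \<xi> None = (\<Sum>k\<in>UNIV. \<xi> k)"

definition box_factor :: "real \<Rightarrow> complex" where
  "box_factor t =
     (if t = 0 then 1 else (1 - exp (- \<i> * complex_of_real t)) / (\<i> * complex_of_real t))"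

text \<open>A continuous, compactly supported function is determined by its Fourier transform.\<close>

definition linear_box_spline :: "('n::finite \<Rightarrow> real^'n) \<Rightarrow> real^'n \<Rightarrow> real" where
  "linear_box_spline \<xi> = (THE f.
     continuous_on UNIV f \<and> compact (closure {x. f x \<noteq> 0}) \<and>
     (\<forall>\<omega>. fourier_transform (\<lambda>x. complex_of_real (f x)) \<omega> =
        complex_of_real \<bar>det (column_matrix \<xi>)\<bar> *
          (\<Prod>k\<in>UNIV. box_factor (extended_directions \<xi> k \<bullet> \<omega>))))"

definition box_spline_translate ::
  "('n::finite \<Rightarrow> real^'n) \<Rightarrow> int^'n \<Rightarrow> real^'n \<Rightarrow> complex" where
  "box_spline_translate \<xi> k x =
     complex_of_real
       (linear_box_spline \<xi> (x - column_matrix \<xi> *v (\<chi> i. real_of_int (k $ i))))"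

end

theory Submission
  imports Defs
begin

text \<open>
  In the coordinates \<open>y\<close> with \<open>x = \<Xi> y\<close>, where \<open>\<Xi>\<close> has the columns \<open>\<xi> k\<close>, the linear box spline is the hat
  function \<open>M\<close> of the Kuhn triangulation of \<open>real^'n\<close>: both are continuous with compact support and
  have the same Fourier transform (\<open>linear_box_spline_eq_kuhn_hat\<close>). The change of variables
  multiplies squared norms by \<open>\<bar>det \<Xi>\<bar>\<close>. With \<open>d = CARD('n)\<close>, it remains to see that the integer
  translates of \<open>M\<close> have the Riesz bounds \<open>1 / sqrt (d + 2)\<close> and \<open>1\<close>.

  The function \<open>f = \<Sum>k. c k * M (y - k)\<close> is linear on each Kuhn simplex, with the coefficients as
  vertex values. Integrating \<open>\<bar>f\<bar>\<^sup>2\<close> over every simplex gives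
  \<open>(d + 2) * \<parallel>f\<parallel>\<^sup>2 = \<Sum>k. \<bar>c k\<bar>\<^sup>2 + a multiple of the sum of all squared vertex sums\<close>, made precise in
  \<open>kuhn_energy_decomposition\<close>. Everything can be read off from this identity. The last term is
  nonnegative, which gives the lower bound, and by the Cauchy--Schwarz inequality it is at most
  \<open>(d + 1) * (\<Sum>k. \<bar>c k\<bar>\<^sup>2)\<close>, which gives the upper bound (\<open>kuhn_energy_bounds\<close>). Equality holds in the limit
  of growing cubes of support: for the upper bound with constant coefficients, for the lower bound
  with \<open>c k = \<zeta> powi (\<Sum>i. k $ i)\<close>, where \<open>\<zeta>\<close> is a primitive root of unity of order \<open>d + 1\<close>. The coordinate
  sums of the \<open>d + 1\<close> vertices of a Kuhn simplex are consecutive integers, so all vertex sums vanish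
  except near the boundary (\<open>kuhn_energy_plane_wave_limits\<close>).

  The identity itself is proved without integrating over simplices. Both sides are Hermitian forms
  in \<open>c\<close> whose coefficients depend only on \<open>k - l\<close>. On the left they are autocorrelations of \<open>M\<close>; writing
  \<open>M\<close> as the average of unit cubes moved along the diagonal makes these one-dimensional Beta
  integrals. On the right they count pairs of vertices with a given difference, a count of
  bijections (\<open>kuhn_autocorrelation_eq_chain_pairs\<close>).

  The statement for square-summable coefficients reduces to finite sums, because the translates are
  locally finite (\<open>riesz_constants_iff_finite\<close>).
\<close>

section \<open>Lebesgue measure in coordinates and under linear maps\<close>

lemma Basis_cart: "(Basis :: (real^'n) set) = range (\<lambda>i. axis i 1)"
  by (auto simp: Basis_vec_def)

lemma prod_Basis_cart:
  fixes g :: "real^'n \<Rightarrow> 'b::comm_monoid_mult"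
  shows "(\<Prod>b\<in>Basis. g b) = (\<Prod>i\<in>UNIV. g (axis i 1))"
  unfolding Basis_cart by (subst prod.reindex) (auto simp: inj_on_def axis_eq_axis)

lemma borel_measurable_vec_nth [measurable]:
  "(\<lambda>x::real^'n. x $ i) \<in> borel_measurable borel"
  by (intro borel_measurable_continuous_onI continuous_intros)

lemma borel_measurable_vec_lambda [measurable (raw)]:
  fixes f :: "'a \<Rightarrow> 'n::finite \<Rightarrow> real"
  assumes "\<And>i. (\<lambda>x. f x i) \<in> borel_measurable M"
  shows "(\<lambda>x. \<chi> i. f x i) \<in> borel_measurable M"
proof -
  have "(\<chi> i. f x i) = (\<Sum>i\<in>UNIV. f x i *\<^sub>R axis i 1)" for x
    by (simp add: vec_eq_iff axis_def if_distrib cong: if_cong)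
  then show ?thesis using assms by simp
qed

text \<open>
  Product integrals over \<open>real^'n\<close> come from this description of Lebesgue measure; it suffices
  to compare the two sides on boxes.
\<close>

lemma lborel_cart_eq_distr:
  "(lborel :: (real^'n) measure) =
     distr (\<Pi>\<^sub>M i\<in>UNIV. lborel) borel (\<lambda>f. \<chi> i. f i)"
proof (rule lborel_eqI)
  fix l u :: "real^'n"
  assume le: "\<And>b. b \<in> Basis \<Longrightarrow> l \<bullet> b \<le> u \<bullet> b"
  have le': "l $ i \<le> u $ i" for i
    using le[of "axis i 1"] by (simp add: inner_axis Basis_cart)
  interpret product_sigma_finite "\<lambda>_::'n. lborel :: real measure" ..
  have "emeasure (distr (\<Pi>\<^sub>M i\<in>UNIV. lborel) borel (\<lambda>f::'n\<Rightarrow>real. \<chi> i. f i)) (box l u)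
      = emeasure (\<Pi>\<^sub>M i\<in>(UNIV::'n set). lborel) (Pi\<^sub>E UNIV (\<lambda>i. box (l $ i) (u $ i)))"
    by (subst emeasure_distr)
       (auto simp: mem_box_cart space_PiM PiE_iff intro!: arg_cong2[where f=emeasure])
  also have "\<dots> = (\<Prod>i\<in>UNIV. ennreal (u $ i - l $ i))"
    using le' by (subst emeasure_PiM) auto
  also have "\<dots> = ennreal (\<Prod>i\<in>UNIV. u $ i - l $ i)"
    using le' by (subst prod_ennreal) auto
  finally show "emeasure (distr (\<Pi>\<^sub>M i\<in>UNIV. lborel) borel (\<lambda>f::'n\<Rightarrow>real. \<chi> i. f i)) (box l u)
      = (\<Prod>b\<in>Basis. (u - l) \<bullet> b)"
    by (simp add: prod_Basis_cart inner_axis)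
qed simp

lemma integral_prod_cart:
  fixes f :: "'n::finite \<Rightarrow> real \<Rightarrow> 'b::{real_normed_field,banach,second_countable_topology}"
  assumes "\<And>i. integrable lborel (f i)"
  shows "(LINT x|lborel. (\<Prod>i\<in>UNIV. f i (x $ i))) = (\<Prod>i\<in>UNIV. (LINT y|lborel. f i y))"
proof -
  interpret product_sigma_finite "\<lambda>_::'n. lborel :: real measure" ..
  have [measurable]: "f i \<in> borel_measurable borel" for i
    using borel_measurable_integrable[OF assms] by simp
  have "(LINT x|lborel. (\<Prod>i\<in>UNIV. f i (x $ i))) =
      (LINT x|(\<Pi>\<^sub>M i\<in>UNIV. lborel). (\<Prod>i\<in>UNIV. f i (x i)))"
    by (subst lborel_cart_eq_distr, subst integral_distr) auto
  also have "\<dots> = (\<Prod>i\<in>UNIV. (LINT y|lborel. f i y))"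
    using assms by (intro product_integral_prod) auto
  finally show ?thesis .
qed

text \<open>
  Integrating the coordinate \<open>m\<close> first makes translations in that coordinate, and hence shears,
  visibly measure preserving.
\<close>

lemma nn_integral_cart_coordinate:
  fixes h :: "real^'n \<Rightarrow> ennreal"
  assumes [measurable]: "h \<in> borel_measurable borel"
  shows "(\<integral>\<^sup>+x. h x \<partial>lborel) =
    (\<integral>\<^sup>+x. (\<integral>\<^sup>+y. h (\<chi> i. (x(m := y)) i) \<partial>lborel) \<partial>(\<Pi>\<^sub>M i\<in>UNIV-{m}. lborel))"
proof -
  interpret product_sigma_finite "\<lambda>_::'n. lborel :: real measure" ..
  have "(\<integral>\<^sup>+x. h x \<partial>lborel) = (\<integral>\<^sup>+x. h (\<chi> i. x i) \<partial>(\<Pi>\<^sub>M i\<in>insert m (UNIV-{m}). lborel))"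
    by (subst lborel_cart_eq_distr, subst nn_integral_distr) (auto simp: insert_absorb)
  also have "\<dots> = (\<integral>\<^sup>+x. (\<integral>\<^sup>+y. h (\<chi> i. (x(m := y)) i) \<partial>lborel) \<partial>(\<Pi>\<^sub>M i\<in>UNIV-{m}. lborel))"
    by (subst product_nn_integral_insert) (auto simp: insert_absorb)
  finally show ?thesis .
qed

text \<open>
  Every linear map is a product of diagonal maps, swaps of two coordinates, shears and maps that
  miss a coordinate, and the formula is multiplicative. The hypothesis on the determinant sits
  inside the induction, where singular factors hold vacuously. A shear translates one coordinate
  while the others are fixed.
\<close>

lemma nn_integral_linear_cart:
  fixes T :: "real^'n \<Rightarrow> real^'n"
  assumes "linear T"
  shows "\<forall>h\<in>borel_measurable borel. det (matrix T) \<noteq> 0 \<longrightarrow>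
     (\<integral>\<^sup>+x. h x \<partial>lborel) = ennreal \<bar>det (matrix T)\<bar> * (\<integral>\<^sup>+x. h (T x) \<partial>lborel)"
    (is "?P T")
  using assms
proof (rule induct_linear_elementary)
  fix f g :: "real^'n \<Rightarrow> real^'n"
  assume lin: "linear f" "linear g" and f: "?P f" and g: "?P g"
  have [measurable]: "f \<in> borel_measurable borel" "g \<in> borel_measurable borel"
    using lin by (simp_all add: borel_measurable_continuous_onI linear_continuous_on
        linear_conv_bounded_linear)
  show "?P (f \<circ> g)"
  proof (intro ballI impI)
    fix h :: "real^'n \<Rightarrow> ennreal"
    assume [measurable]: "h \<in> borel_measurable borel" and "det (matrix (f \<circ> g)) \<noteq> 0"
    then have nz: "det (matrix f) \<noteq> 0" "det (matrix g) \<noteq> 0"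
      by (auto simp: matrix_compose[OF lin(2,1)] det_mul)
    have "(\<integral>\<^sup>+x. h x \<partial>lborel) = ennreal \<bar>det (matrix f)\<bar> * (\<integral>\<^sup>+x. h (f x) \<partial>lborel)"
      by (rule f[rule_format, OF _ nz(1)]) measurable
    also have "(\<integral>\<^sup>+x. h (f x) \<partial>lborel) = ennreal \<bar>det (matrix g)\<bar> * (\<integral>\<^sup>+x. h (f (g x)) \<partial>lborel)"
      by (rule g[rule_format, OF _ nz(2)]) measurable
    finally show "(\<integral>\<^sup>+x. h x \<partial>lborel) =
        ennreal \<bar>det (matrix (f \<circ> g))\<bar> * (\<integral>\<^sup>+x. h ((f \<circ> g) x) \<partial>lborel)"
      by (simp add: matrix_compose[OF lin(2,1)] det_mul abs_mult ennreal_mult mult.assoc)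
  qed
next
  fix f :: "real^'n \<Rightarrow> real^'n" and i
  assume "linear f" "\<And>x. f x $ i = 0"
  then have "\<not> inj f"
    by (metis (full_types) linear_injective_imp_surjective one_neq_zero surjE vec_component)
  then show "?P f"
    using det_nz_iff_inj[OF \<open>linear f\<close>] by blast
next
  fix c :: "'n \<Rightarrow> real"
  let ?T = "\<lambda>x::real^'n. \<chi> i. c i * x $ i"
  have det: "det (matrix ?T) = prod c UNIV"
    by (simp add: axis_def matrix_def det_diagonal)
  show "?P ?T"
  proof (intro ballI impI)
    fix h :: "real^'n \<Rightarrow> ennreal"
    assume [measurable]: "h \<in> borel_measurable borel" and "det (matrix ?T) \<noteq> 0"
    then have nz: "c i \<noteq> 0" for i by (simp add: det)
    define c' where "c' b = (\<Sum>i\<in>UNIV. c i * b $ i)" for b :: "real^'n"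
    have c': "c' (axis i 1) = c i" for i
      by (simp add: c'_def axis_def if_distrib cong: if_cong)
    have eq: "0 + (\<Sum>j\<in>Basis. (c' j * (x \<bullet> j)) *\<^sub>R j) = ?T x" for x
    proof -
      have "(\<Sum>j\<in>Basis. (c' j * (x \<bullet> j)) *\<^sub>R j) = (\<Sum>i\<in>UNIV. (c i * x $ i) *\<^sub>R axis i 1)"
        unfolding Basis_cart
        by (subst sum.reindex) (auto simp: inj_on_def axis_eq_axis c' inner_axis)
      also have "\<dots> = ?T x"
        by (simp add: vec_eq_iff axis_def if_distrib cong: if_cong)
      finally show ?thesis by simp
    qed
    have "c' j \<noteq> 0" if "j \<in> Basis" for j
      using that nz by (auto simp: Basis_cart c')
    from lborel_affine_euclidean[of c' "0::real^'n", OF this]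
    have "lborel = density (distr lborel borel ?T) (\<lambda>_. ennreal \<bar>prod c UNIV\<bar>)"
      unfolding eq prod_Basis_cart c' by (simp add: abs_prod)
    from arg_cong[OF this, of "\<lambda>M. \<integral>\<^sup>+x. h x \<partial>M"]
    have "(\<integral>\<^sup>+x. h x \<partial>lborel) =
        (\<integral>\<^sup>+x. h x \<partial>density (distr lborel borel ?T) (\<lambda>_. ennreal \<bar>prod c UNIV\<bar>))" .
    also have "\<dots> = ennreal \<bar>prod c UNIV\<bar> * (\<integral>\<^sup>+x. h (?T x) \<partial>lborel)"
      by (simp add: nn_integral_density nn_integral_distr nn_integral_cmult)
    finally show "(\<integral>\<^sup>+x. h x \<partial>lborel) = ennreal \<bar>det (matrix ?T)\<bar> * (\<integral>\<^sup>+x. h (?T x) \<partial>lborel)"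
      by (simp add: det)
  qed
next
  fix m n :: 'n
  assume "m \<noteq> n"
  let ?s = "Transposition.transpose m n"
  let ?T = "\<lambda>x::real^'n. \<chi> i. x $ ?s i"
  have "(\<chi> i j. if ?s i = j then 1 else 0) = (\<chi> i j. if j = ?s i then 1 else (0::real))"
    by (auto intro!: Cart_lambda_cong)
  then have "matrix ?T = transpose(\<chi> i j. mat 1 $ i $ ?s j)"
    by (auto simp: matrix_eq transpose_def axis_def mat_def matrix_def)
  then have det: "\<bar>det (matrix ?T)\<bar> = 1"
    by (simp add: det_permute_columns permutes_swap_id sign_swap_id abs_mult)
  have "lborel = distr lborel borel ?T"
  proof (rule lborel_eqI)
    fix l u :: "real^'n"
    assume le: "\<And>b. b \<in> Basis \<Longrightarrow> l \<bullet> b \<le> u \<bullet> b"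
    have le': "l $ i \<le> u $ i" for i
      using le[of "axis i 1"] by (simp add: inner_axis Basis_cart)
    have "?T -` box l u = box (?T l) (?T u)"
    proof (intro set_eqI iffI)
      fix x assume "x \<in> ?T -` box l u"
      then have "l $ ?s i < x $ ?s (?s i) \<and> x $ ?s (?s i) < u $ ?s i" for i
        by (auto simp: mem_box_cart simp del: transpose_involutory)
      then show "x \<in> box (?T l) (?T u)" by (auto simp: mem_box_cart)
    next
      fix x assume "x \<in> box (?T l) (?T u)"
      then have "l $ ?s (?s i) < x $ ?s i \<and> x $ ?s i < u $ ?s (?s i)" for i
        by (auto simp: mem_box_cart simp del: transpose_involutory)
      then show "x \<in> ?T -` box l u" by (auto simp: mem_box_cart)
    qed
    then have "emeasure (distr lborel borel ?T) (box l u) = emeasure lborel (box (?T l) (?T u))"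
      by (subst emeasure_distr) auto
    also have "\<dots> = ennreal (\<Prod>i\<in>UNIV. u $ ?s i - l $ ?s i)"
    proof -
      have "?T l \<bullet> b \<le> ?T u \<bullet> b" if "b \<in> Basis" for b
        using that by (auto simp: Basis_cart inner_axis intro: le')
      then have "emeasure lborel (box (?T l) (?T u)) = ennreal (\<Prod>b\<in>Basis. (?T u - ?T l) \<bullet> b)"
        by (rule emeasure_lborel_box)
      then show ?thesis
        unfolding prod_Basis_cart inner_axis by simp
    qed
    also have "(\<Prod>i\<in>UNIV. u $ ?s i - l $ ?s i) = (\<Prod>i\<in>UNIV. u $ i - l $ i)"
      using prod.permute[OF permutes_swap_id, where S=UNIV and g="\<lambda>i. u $ i - l $ i"]
      by (simp add: o_def)
    finally show "emeasure (distr lborel borel ?T) (box l u) = ennreal (\<Prod>b\<in>Basis. (u - l) \<bullet> b)"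
      by (simp add: prod_Basis_cart inner_axis)
  qed simp
  note swap = this
  show "?P ?T"
  proof (intro ballI impI)
    fix h :: "real^'n \<Rightarrow> ennreal"
    assume [measurable]: "h \<in> borel_measurable borel"
    have "(\<integral>\<^sup>+x. h x \<partial>lborel) = (\<integral>\<^sup>+x. h x \<partial>distr lborel borel ?T)"
      using arg_cong[OF swap, of "\<lambda>M. \<integral>\<^sup>+x. h x \<partial>M"] .
    also have "\<dots> = (\<integral>\<^sup>+x. h (?T x) \<partial>lborel)"
      by (rule nn_integral_distr) measurable
    finally show "(\<integral>\<^sup>+x. h x \<partial>lborel) = ennreal \<bar>det (matrix ?T)\<bar> * (\<integral>\<^sup>+x. h (?T x) \<partial>lborel)"
      by (simp add: det)
  qed
next
  fix m n :: 'n
  assume "m \<noteq> n"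
  let ?T = "\<lambda>x::real^'n. \<chi> i. if i = m then x $ m + x $ n else x $ i"
  show "?P ?T"
  proof (intro ballI impI)
    fix h :: "real^'n \<Rightarrow> ennreal"
    assume [measurable]: "h \<in> borel_measurable borel"
    let ?A = "(\<chi> i. if i = m then row m (mat 1) + 1 *\<^sub>R row n (mat 1) else row i (mat 1)) :: real^'n^'n"
    have "matrix ?T = ?A"
      using \<open>m \<noteq> n\<close> by (auto simp: matrix_def row_def mat_def axis_def vec_eq_iff)
    then have det: "det (matrix ?T) = 1"
      using det_row_operation[OF \<open>m \<noteq> n\<close>, of "mat 1 :: real^'n^'n" 1, unfolded scalar_mult_eq_scaleR] by simp
    have "(\<integral>\<^sup>+x. h x \<partial>lborel) =
      (\<integral>\<^sup>+x. (\<integral>\<^sup>+y. h (\<chi> i. (x(m := y)) i) \<partial>lborel) \<partial>(\<Pi>\<^sub>M i\<in>UNIV-{m}. lborel))"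
      by (rule nn_integral_cart_coordinate) simp
    also have "\<dots> = (\<integral>\<^sup>+x. (\<integral>\<^sup>+y. h (\<chi> i. (x(m := x n + 1 * y)) i) \<partial>lborel) \<partial>(\<Pi>\<^sub>M i\<in>UNIV-{m}. lborel))"
    proof (rule nn_integral_cong)
      fix x :: "'n \<Rightarrow> real"
      have [measurable]: "(\<lambda>y. (x(m := y)) i) \<in> borel_measurable borel" for i
        by (cases "i = m") simp_all
      show "(\<integral>\<^sup>+y. h (\<chi> i. (x(m := y)) i) \<partial>lborel) =
          (\<integral>\<^sup>+y. h (\<chi> i. (x(m := x n + 1 * y)) i) \<partial>lborel)"
        using nn_integral_real_affine[of "\<lambda>y. h (\<chi> i. (x(m := y)) i)" 1 "x n"] by simp
    qed
    also have "\<dots> = (\<integral>\<^sup>+x. (\<integral>\<^sup>+y. h (?T (\<chi> i. (x(m := y)) i)) \<partial>lborel) \<partial>(\<Pi>\<^sub>M i\<in>UNIV-{m}. lborel))"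
      using \<open>m \<noteq> n\<close> by (intro nn_integral_cong arg_cong[where f=h]) (auto simp: vec_eq_iff)
    also have "\<dots> = (\<integral>\<^sup>+x. h (?T x) \<partial>lborel)"
      by (rule nn_integral_cart_coordinate[symmetric]) measurable
    finally show "(\<integral>\<^sup>+x. h x \<partial>lborel) = ennreal \<bar>det (matrix ?T)\<bar> * (\<integral>\<^sup>+x. h (?T x) \<partial>lborel)"
      by (simp add: det)
  qed
qed

lemma lborel_matrix_image:
  fixes A :: "real^'n^'n"
  assumes "det A \<noteq> 0"
  shows "lborel = density (distr lborel borel ((*v) A)) (\<lambda>_. ennreal \<bar>det A\<bar>)"
proof (rule measure_eqI)
  fix S :: "(real^'n) set"
  assume "S \<in> sets lborel"
  then have [measurable]: "S \<in> sets borel" by simp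
  have [measurable]: "(*v) A \<in> borel_measurable borel"
    by (intro borel_measurable_continuous_onI matrix_vector_mult_linear_continuous_on)
  have "emeasure lborel S = (\<integral>\<^sup>+x. indicator S x \<partial>lborel)" by simp
  also have "\<dots> = ennreal \<bar>det A\<bar> * (\<integral>\<^sup>+x. indicator S (A *v x) \<partial>lborel)"
    using nn_integral_linear_cart[OF matrix_vector_mul_linear[of A], rule_format, of "indicator S"] assms
    unfolding matrix_of_matrix_vector_mul by measurable
  also have "\<dots> = emeasure (density (distr lborel borel ((*v) A)) (\<lambda>_. ennreal \<bar>det A\<bar>)) S"
  proof -
    have "(\<integral>\<^sup>+x. indicator S (A *v x) \<partial>lborel) =
        (\<integral>\<^sup>+x. indicator S x \<partial>distr lborel borel ((*v) A))"
      by (rule nn_integral_distr[symmetric]) measurable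
    then show ?thesis
      by (simp add: emeasure_density nn_integral_cmult)
  qed
  finally show "emeasure lborel S =
      emeasure (density (distr lborel borel ((*v) A)) (\<lambda>_. ennreal \<bar>det A\<bar>)) S" .
qed simp

lemma integral_matrix_image:
  fixes A :: "real^'n^'n" and f :: "real^'n \<Rightarrow> 'b::{banach,second_countable_topology}"
  assumes "det A \<noteq> 0" and [measurable]: "f \<in> borel_measurable borel"
  shows "(LINT x|lborel. f x) = \<bar>det A\<bar> *\<^sub>R (LINT x|lborel. f (A *v x))"
proof -
  have [measurable]: "(*v) A \<in> borel_measurable borel"
    by (intro borel_measurable_continuous_onI matrix_vector_mult_linear_continuous_on)
  show ?thesis
    by (subst lborel_matrix_image[OF assms(1)]) (simp add: integral_density integral_distr)
qed

section \<open>The seminorm of square-integrable functions\<close>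

lemma L2_space_measurable: "f \<in> L2_space \<Longrightarrow> f \<in> borel_measurable borel"
  by (simp add: L2_space_def)

lemma L2_space_integrable: "f \<in> L2_space \<Longrightarrow> integrable lborel (\<lambda>x. (cmod (f x))\<^sup>2)"
  by (simp add: L2_space_def)

lemma L2_norm_nonneg: "0 \<le> L2_norm f"
  by (simp add: L2_norm_def)

lemma L2_norm_power2: "(L2_norm f)\<^sup>2 = (LINT x|lborel. (cmod (f x))\<^sup>2)"
  by (simp add: L2_norm_def)

lemma L2_space_zero: "(\<lambda>x. 0) \<in> L2_space"
  by (simp add: L2_space_def)

lemma L2_norm_zero [simp]: "L2_norm (\<lambda>x. 0) = 0"
  by (simp add: L2_norm_def)

lemma L2_space_scale:
  assumes "f \<in> L2_space"
  shows "(\<lambda>x. a * f x) \<in> L2_space"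
  using assms by (auto simp: L2_space_def norm_mult power_mult_distrib)

lemma L2_norm_scale: "L2_norm (\<lambda>x. a * f x) = cmod a * L2_norm f"
  by (simp add: L2_norm_def norm_mult power_mult_distrib real_sqrt_mult)

lemma L2_space_add:
  assumes f: "f \<in> L2_space" and g: "g \<in> L2_space"
  shows "(\<lambda>x. f x + g x) \<in> L2_space"
proof -
  note [measurable] = L2_space_measurable[OF f] L2_space_measurable[OF g]
  have "integrable lborel (\<lambda>x. (cmod (f x + g x))\<^sup>2)"
  proof (rule Bochner_Integration.integrable_bound)
    show "integrable lborel (\<lambda>x. 2 * (cmod (f x))\<^sup>2 + 2 * (cmod (g x))\<^sup>2)"
      using L2_space_integrable[OF f] L2_space_integrable[OF g] by simp
    have "(cmod (f x + g x))\<^sup>2 \<le> 2 * (cmod (f x))\<^sup>2 + 2 * (cmod (g x))\<^sup>2" for x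
    proof -
      have "(cmod (f x + g x))\<^sup>2 \<le> (cmod (f x) + cmod (g x))\<^sup>2"
        by (simp add: norm_triangle_ineq power_mono)
      also have "\<dots> \<le> 2 * (cmod (f x))\<^sup>2 + 2 * (cmod (g x))\<^sup>2"
        using sum_squares_bound[of "cmod (f x)" "cmod (g x)"] by (simp add: power2_sum)
      finally show ?thesis .
    qed
    then show "AE x in lborel. norm ((cmod (f x + g x))\<^sup>2) \<le> norm (2 * (cmod (f x))\<^sup>2 + 2 * (cmod (g x))\<^sup>2)"
      by (auto intro!: AE_I2 order_trans[OF _ abs_ge_self])
  qed measurable
  then show ?thesis by (simp add: L2_space_def)
qed

lemma L2_space_diff:
  assumes "f \<in> L2_space" "g \<in> L2_space"
  shows "(\<lambda>x. f x - g x) \<in> L2_space"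
  using L2_space_add[OF assms(1) L2_space_scale[OF assms(2), of "-1"]] by simp

lemma L2_space_sum:
  assumes "\<And>k. k \<in> F \<Longrightarrow> \<psi> k \<in> L2_space"
  shows "(\<lambda>x. \<Sum>k\<in>F. \<psi> k x) \<in> L2_space"
  using assms by (induction F rule: infinite_finite_induct) (auto simp: L2_space_zero L2_space_add)

text \<open>
  Convexity of the square gives \<open>(u + v)\<^sup>2 \<le> (a + b) * (u\<^sup>2 / a + v\<^sup>2 / b)\<close> for \<open>a, b > 0\<close>.
  Integrated with \<open>a\<close> and \<open>b\<close> the two norms, the right side is \<open>(a + b)\<^sup>2\<close>; adding \<open>e / 2\<close>
  keeps them positive when a norm vanishes.
\<close>

lemma L2_norm_triangle:
  assumes f: "f \<in> L2_space" and g: "g \<in> L2_space"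
  shows "L2_norm (\<lambda>x. f x + g x) \<le> L2_norm f + L2_norm g"
proof (rule field_le_epsilon)
  fix e :: real assume "e > 0"
  define a where "a = L2_norm f + e / 2"
  define b where "b = L2_norm g + e / 2"
  have ab: "a > 0" "b > 0" and le: "L2_norm f \<le> a" "L2_norm g \<le> b"
    using \<open>e > 0\<close> L2_norm_nonneg[of f] L2_norm_nonneg[of g] by (auto simp: a_def b_def)
  have pointwise: "(cmod (f x + g x))\<^sup>2 \<le>
      (a + b) * ((cmod (f x))\<^sup>2 / a + (cmod (g x))\<^sup>2 / b)" for x
  proof -
    let ?u = "cmod (f x)" and ?v = "cmod (g x)"
    have "(cmod (f x + g x))\<^sup>2 \<le> (?u + ?v)\<^sup>2"
      by (simp add: norm_triangle_ineq power_mono)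
    also have "(?u + ?v)\<^sup>2 \<le> (a + b) * (?u\<^sup>2 / a + ?v\<^sup>2 / b)"
    proof -
      define p q where "p = ?u / a" and "q = ?v / b"
      have uv: "?u = a * p" "?v = b * q" using ab by (auto simp: p_def q_def)
      have "0 \<le> a * b * (p - q)\<^sup>2" using ab by simp
      also have "\<dots> = (a + b) * (a * p\<^sup>2 + b * q\<^sup>2) - (a * p + b * q)\<^sup>2"
        by (simp add: power2_eq_square algebra_simps)
      also have "a * p\<^sup>2 = (a * p)\<^sup>2 / a" using ab by (simp add: power2_eq_square)
      also have "b * q\<^sup>2 = (b * q)\<^sup>2 / b" using ab by (simp add: power2_eq_square)
      finally have "(a * p + b * q)\<^sup>2 \<le> (a + b) * ((a * p)\<^sup>2 / a + (b * q)\<^sup>2 / b)"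
        by (rule iffD1[OF diff_ge_0_iff_ge])
      then show ?thesis by (simp only: uv)
    qed
    finally show ?thesis .
  qed
  have "(L2_norm (\<lambda>x. f x + g x))\<^sup>2 \<le>
      (LINT x|lborel. (a + b) * ((cmod (f x))\<^sup>2 / a + (cmod (g x))\<^sup>2 / b))"
    unfolding L2_norm_power2
    using L2_space_integrable[OF f] L2_space_integrable[OF g]
      L2_space_integrable[OF L2_space_add[OF f g]]
    by (intro integral_mono pointwise Bochner_Integration.integrable_mult_right Bochner_Integration.integrable_add Bochner_Integration.integrable_divide)
  also have "\<dots> = (a + b) * ((L2_norm f)\<^sup>2 / a + (L2_norm g)\<^sup>2 / b)"
    using L2_space_integrable[OF f] L2_space_integrable[OF g] by (simp add: L2_norm_power2)
  also have "\<dots> \<le> (a + b) * (a\<^sup>2 / a + b\<^sup>2 / b)"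
    using ab le L2_norm_nonneg[of f] L2_norm_nonneg[of g]
    by (intro mult_left_mono add_mono divide_right_mono power_mono) auto
  also have "\<dots> = (a + b)\<^sup>2"
    using ab by (simp add: power2_eq_square)
  finally have "L2_norm (\<lambda>x. f x + g x) \<le> a + b"
    by (rule power2_le_imp_le) (use ab in simp)
  then show "L2_norm (\<lambda>x. f x + g x) \<le> L2_norm f + L2_norm g + e"
    by (simp add: a_def b_def)
qed

lemma L2_norm_minus_commute: "L2_norm (\<lambda>x. f x - g x) = L2_norm (\<lambda>x. g x - f x)"
  by (simp add: L2_norm_def norm_minus_commute)

lemma L2_norm_diff_triangle:
  assumes "f \<in> L2_space" "g \<in> L2_space" "h \<in> L2_space"
  shows "L2_norm (\<lambda>x. f x - h x) \<le> L2_norm (\<lambda>x. f x - g x) + L2_norm (\<lambda>x. g x - h x)"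
  using L2_norm_triangle[OF L2_space_diff[OF assms(1,2)] L2_space_diff[OF assms(2,3)]] by simp

lemma L2_norm_abs_diff:
  assumes "f \<in> L2_space" "g \<in> L2_space"
  shows "\<bar>L2_norm f - L2_norm g\<bar> \<le> L2_norm (\<lambda>x. f x - g x)"
  using L2_norm_triangle[OF L2_space_diff[OF assms] assms(2)]
    L2_norm_triangle[OF L2_space_diff[OF assms(2,1)] assms(1)]
    L2_norm_minus_commute[of f g] by simp

lemma L2_closureD: "f \<in> L2_closure S \<Longrightarrow> e > 0 \<Longrightarrow> \<exists>g\<in>S. L2_norm (\<lambda>x. f x - g x) < e"
  by (simp add: L2_closure_def)

lemma L2_closure_in_L2_space: "f \<in> L2_closure S \<Longrightarrow> f \<in> L2_space"
  by (simp add: L2_closure_def)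

lemma subset_L2_closure:
  assumes "S \<subseteq> L2_space"
  shows "S \<subseteq> L2_closure S"
proof
  fix f assume "f \<in> S"
  moreover have "L2_norm (\<lambda>x. f x - f x) < e" if "e > 0" for e
    using that by simp
  ultimately show "f \<in> L2_closure S"
    using assms unfolding L2_closure_def by blast
qed

lemma L2_closure_closure:
  assumes "S \<subseteq> L2_space"
  shows "L2_closure (L2_closure S) = L2_closure S"
proof
  show "L2_closure (L2_closure S) \<subseteq> L2_closure S"
  proof
    fix f assume f: "f \<in> L2_closure (L2_closure S)"
    then have "f \<in> L2_space" by (simp add: L2_closure_def)
    moreover have "\<exists>h\<in>S. L2_norm (\<lambda>x. f x - h x) < e" if "e > 0" for e
    proof -
      obtain g where g: "g \<in> L2_closure S" "L2_norm (\<lambda>x. f x - g x) < e / 2"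
        using L2_closureD[OF f, of "e / 2"] \<open>e > 0\<close> by auto
      obtain h where h: "h \<in> S" "L2_norm (\<lambda>x. g x - h x) < e / 2"
        using L2_closureD[OF g(1), of "e / 2"] \<open>e > 0\<close> by auto
      have "L2_norm (\<lambda>x. f x - h x) \<le> L2_norm (\<lambda>x. f x - g x) + L2_norm (\<lambda>x. g x - h x)"
        using \<open>f \<in> L2_space\<close> g h assms
        by (intro L2_norm_diff_triangle) (auto simp: L2_closure_def)
      then show ?thesis using g h by (intro bexI[of _ h]) auto
    qed
    ultimately show "f \<in> L2_closure S" by (simp add: L2_closure_def)
  qed
  show "L2_closure S \<subseteq> L2_closure (L2_closure S)"
    by (rule subset_L2_closure) (auto simp: L2_closure_def)
qed

lemma L2_closure_add:
  assumes S: "S \<subseteq> L2_space" "\<And>f g. f \<in> S \<Longrightarrow> g \<in> S \<Longrightarrow> (\<lambda>x. f x + g x) \<in> S"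
    and f: "f \<in> L2_closure S" and g: "g \<in> L2_closure S"
  shows "(\<lambda>x. f x + g x) \<in> L2_closure S"
proof -
  have L2: "f \<in> L2_space" "g \<in> L2_space" using f g by (auto simp: L2_closure_def)
  have "\<exists>h\<in>S. L2_norm (\<lambda>x. (f x + g x) - h x) < e" if "e > 0" for e
  proof -
    obtain f' where f': "f' \<in> S" "L2_norm (\<lambda>x. f x - f' x) < e / 2"
      using L2_closureD[OF f, of "e / 2"] \<open>e > 0\<close> by auto
    obtain g' where g': "g' \<in> S" "L2_norm (\<lambda>x. g x - g' x) < e / 2"
      using L2_closureD[OF g, of "e / 2"] \<open>e > 0\<close> by auto
    have "L2_norm (\<lambda>x. (f x + g x) - (f' x + g' x)) =
        L2_norm (\<lambda>x. (f x - f' x) + (g x - g' x))"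
      by (simp add: algebra_simps)
    also have "\<dots> \<le> L2_norm (\<lambda>x. f x - f' x) + L2_norm (\<lambda>x. g x - g' x)"
      using L2 f' g' S(1) by (intro L2_norm_triangle L2_space_diff) auto
    finally show ?thesis using f' g' by (intro bexI[OF _ S(2)[OF f'(1) g'(1)]]) auto
  qed
  then show ?thesis using L2_space_add[OF L2] by (simp add: L2_closure_def)
qed

lemma L2_closure_scale:
  assumes S: "S \<subseteq> L2_space" "\<And>f. f \<in> S \<Longrightarrow> (\<lambda>x. a * f x) \<in> S"
    and f: "f \<in> L2_closure S"
  shows "(\<lambda>x. a * f x) \<in> L2_closure S"
proof -
  have L2: "f \<in> L2_space" using f by (auto simp: L2_closure_def)
  have "\<exists>h\<in>S. L2_norm (\<lambda>x. a * f x - h x) < e" if "e > 0" for e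
  proof -
    have pos: "cmod a + 1 > 0" by (simp add: add_nonneg_pos)
    then have "e / (cmod a + 1) > 0" using \<open>e > 0\<close> by simp
    then obtain f' where f': "f' \<in> S" "L2_norm (\<lambda>x. f x - f' x) < e / (cmod a + 1)"
      using L2_closureD[OF f] by blast
    have "L2_norm (\<lambda>x. a * f x - a * f' x) = cmod a * L2_norm (\<lambda>x. f x - f' x)"
      by (subst L2_norm_scale[symmetric]) (simp add: right_diff_distrib)
    also have "\<dots> \<le> (cmod a + 1) * L2_norm (\<lambda>x. f x - f' x)"
      by (simp add: distrib_right L2_norm_nonneg)
    also have "\<dots> < e" using f'(2) by (simp only: pos_less_divide_eq[OF pos] mult.commute)
    finally show ?thesis by (intro bexI[OF _ S(2)[OF f'(1)]])
  qed
  then show ?thesis using L2_space_scale[OF L2] by (simp add: L2_closure_def)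
qed

lemma linear_span_subset_L2_space:
  assumes "\<And>k. \<phi> k \<in> L2_space"
  shows "linear_span \<phi> \<subseteq> L2_space"
  using assms by (auto simp: linear_span_def intro!: L2_space_sum L2_space_scale)

lemma linear_span_add:
  assumes "f \<in> linear_span \<phi>" "g \<in> linear_span \<phi>"
  shows "(\<lambda>x. f x + g x) \<in> linear_span \<phi>"
proof -
  obtain F c where f: "finite F" "f = (\<lambda>x. \<Sum>k\<in>F. c k * \<phi> k x)"
    using assms(1) by (auto simp: linear_span_def)
  obtain G d where g: "finite G" "g = (\<lambda>x. \<Sum>k\<in>G. d k * \<phi> k x)"
    using assms(2) by (auto simp: linear_span_def)
  let ?e = "\<lambda>k. (if k \<in> F then c k else 0) + (if k \<in> G then d k else 0)"
  have "f x + g x = (\<Sum>k\<in>F \<union> G. ?e k * \<phi> k x)" for x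
  proof -
    have "f x = (\<Sum>k\<in>F \<union> G. (if k \<in> F then c k else 0) * \<phi> k x)"
      unfolding f using f(1) g(1) by (intro sum.mono_neutral_cong_left) auto
    moreover have "g x = (\<Sum>k\<in>F \<union> G. (if k \<in> G then d k else 0) * \<phi> k x)"
      unfolding g using f(1) g(1) by (intro sum.mono_neutral_cong_left) auto
    ultimately show ?thesis by (simp add: distrib_right sum.distrib)
  qed
  then show ?thesis
    using f(1) g(1) unfolding linear_span_def
    by (intro CollectI exI[of _ "F \<union> G"] exI[of _ ?e]) auto
qed

lemma linear_span_scale:
  assumes "f \<in> linear_span \<phi>"
  shows "(\<lambda>x. a * f x) \<in> linear_span \<phi>"
proof -
  obtain F c where f: "finite F" "f = (\<lambda>x. \<Sum>k\<in>F. c k * \<phi> k x)"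
    using assms by (auto simp: linear_span_def)
  then show ?thesis
    unfolding linear_span_def
    by (intro CollectI exI[of _ F] exI[of _ "\<lambda>k. a * c k"]) (auto simp: sum_distrib_left mult.assoc)
qed

lemma range_subset_linear_span: "range \<phi> \<subseteq> linear_span \<phi>"
proof
  fix f assume "f \<in> range \<phi>"
  then obtain k where "f = \<phi> k" by auto
  then show "f \<in> linear_span \<phi>"
    unfolding linear_span_def
    by (intro CollectI exI[of _ "{k}"] exI[of _ "\<lambda>k. 1"]) auto
qed

lemma closed_L2_subspace_closure_span:
  assumes "\<And>k. \<phi> k \<in> L2_space"
  shows "closed_L2_subspace (L2_closure (linear_span \<phi>))"
proof -
  have S: "linear_span \<phi> \<subseteq> L2_space" by (rule linear_span_subset_L2_space) (rule assms)
  have "(\<lambda>x. 0) \<in> linear_span \<phi>"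
    unfolding linear_span_def by (intro CollectI exI[of _ "{}"]) auto
  then have "(\<lambda>x. 0) \<in> L2_closure (linear_span \<phi>)"
    using subset_L2_closure[OF S] by blast
  moreover have "(\<lambda>x. f x + g x) \<in> L2_closure (linear_span \<phi>)"
    if "f \<in> L2_closure (linear_span \<phi>)" "g \<in> L2_closure (linear_span \<phi>)" for f g
    using that by (intro L2_closure_add S linear_span_add)
  moreover have "(\<lambda>x. a * f x) \<in> L2_closure (linear_span \<phi>)"
    if "f \<in> L2_closure (linear_span \<phi>)" for a f
    using that by (intro L2_closure_scale S linear_span_scale)
  moreover have "L2_closure (linear_span \<phi>) \<subseteq> L2_space"
    by (auto intro: L2_closure_in_L2_space)
  ultimately show ?thesis
    unfolding closed_L2_subspace_def using L2_closure_closure[OF S] by blast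
qed

lemma nn_integral_L2:
  assumes "f \<in> L2_space"
  shows "(\<integral>\<^sup>+x. ennreal ((cmod (f x))\<^sup>2) \<partial>lborel) = ennreal ((L2_norm f)\<^sup>2)"
  using L2_space_integrable[OF assms] by (simp add: L2_norm_power2 nn_integral_eq_integral)

lemma L2_norm_le_of_nn_integral:
  assumes [measurable]: "f \<in> borel_measurable borel" and "0 \<le> r"
    and le: "(\<integral>\<^sup>+x. ennreal ((cmod (f x))\<^sup>2) \<partial>lborel) \<le> ennreal (r\<^sup>2)"
  shows "f \<in> L2_space" and "L2_norm f \<le> r"
proof -
  have "integrable lborel (\<lambda>x. (cmod (f x))\<^sup>2)"
    using le by (intro integrableI_bounded) (auto intro: le_less_trans)
  then show L2: "f \<in> L2_space" by (simp add: L2_space_def)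
  have "ennreal ((L2_norm f)\<^sup>2) \<le> ennreal (r\<^sup>2)" using le nn_integral_L2[OF L2] by simp
  then have "(L2_norm f)\<^sup>2 \<le> r\<^sup>2" by (subst (asm) ennreal_le_iff) auto
  then show "L2_norm f \<le> r" using \<open>0 \<le> r\<close> by (rule power2_le_imp_le)
qed

text \<open>
  Membership in \<open>L\<^sub>2\<close> and norm bounds pass to pointwise limits by Fatou's lemma. This applies to
  a series of locally finite functions, whose candidate limit in norm is the pointwise sum.
\<close>

lemma L2_Fatou:
  assumes L2: "\<And>n. f n \<in> L2_space" and lim: "\<And>x. (\<lambda>n. f n x) \<longlonglongrightarrow> g x"
    and le: "\<And>n. n \<ge> N \<Longrightarrow> L2_norm (f n) \<le> r"
  shows "g \<in> L2_space" and "L2_norm g \<le> r"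
proof -
  have "0 \<le> r" using le[of N] L2_norm_nonneg[of "f N"] by simp
  note [measurable] = L2_space_measurable[OF L2]
  have g [measurable]: "g \<in> borel_measurable borel"
    by (rule borel_measurable_LIMSEQ_metric[OF _ lim]) measurable
  have lim': "(\<lambda>n. ennreal ((cmod (f n x))\<^sup>2)) \<longlonglongrightarrow> ennreal ((cmod (g x))\<^sup>2)" for x
    by (intro tendsto_intros lim)
  have "(\<integral>\<^sup>+x. ennreal ((cmod (g x))\<^sup>2) \<partial>lborel) =
      (\<integral>\<^sup>+x. liminf (\<lambda>n. ennreal ((cmod (f n x))\<^sup>2)) \<partial>lborel)"
    using lim_imp_Liminf[OF sequentially_bot lim'] by simp
  also have "\<dots> \<le> liminf (\<lambda>n. \<integral>\<^sup>+x. ennreal ((cmod (f n x))\<^sup>2) \<partial>lborel)"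
    by (rule nn_integral_liminf) measurable
  also have "\<dots> \<le> liminf (\<lambda>n. ennreal (r\<^sup>2))"
  proof (intro Liminf_mono eventually_sequentiallyI[of N])
    fix n assume "N \<le> n"
    then show "(\<integral>\<^sup>+x. ennreal ((cmod (f n x))\<^sup>2) \<partial>lborel) \<le> ennreal (r\<^sup>2)"
      using le[of n] by (simp add: nn_integral_L2 L2 L2_norm_nonneg power_mono ennreal_leI)
  qed
  also have "\<dots> = ennreal (r\<^sup>2)" by (simp add: Liminf_const)
  finally show "g \<in> L2_space" "L2_norm g \<le> r"
    using L2_norm_le_of_nn_integral[OF g \<open>0 \<le> r\<close>] by auto
qed

section \<open>Riesz constants from finite sums\<close>

lemma ell2_norm_tendsto:
  assumes "c \<in> ell2"
  shows "((\<lambda>F. sqrt (\<Sum>k\<in>F. (cmod (c k))\<^sup>2)) \<longlongrightarrow> ell2_norm c) (finite_subsets_at_top UNIV)"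
  unfolding ell2_norm_def using assms
  by (intro tendsto_real_sqrt infsum_tendsto) (simp add: ell2_def)

lemma L2_has_sum_norm_tendsto:
  assumes "\<And>k. \<psi> k \<in> L2_space" and f: "L2_has_sum \<psi> f"
  shows "((\<lambda>F. L2_norm (\<lambda>x. \<Sum>k\<in>F. \<psi> k x)) \<longlongrightarrow> L2_norm f) (finite_subsets_at_top UNIV)"
proof (rule Lim_transform2)
  show "((\<lambda>F. L2_norm f) \<longlongrightarrow> L2_norm f) (finite_subsets_at_top UNIV)" by simp
  have "((\<lambda>F. L2_norm (\<lambda>x. (\<Sum>k\<in>F. \<psi> k x) - f x)) \<longlongrightarrow> 0) (finite_subsets_at_top UNIV)"
    using f by (simp add: L2_has_sum_def)
  moreover have "\<forall>\<^sub>F F in finite_subsets_at_top UNIV.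
      norm (L2_norm f - L2_norm (\<lambda>x. \<Sum>k\<in>F. \<psi> k x)) \<le> L2_norm (\<lambda>x. (\<Sum>k\<in>F. \<psi> k x) - f x)"
  proof (rule always_eventually, rule allI)
    fix F
    have "f \<in> L2_space" "(\<lambda>x. \<Sum>k\<in>F. \<psi> k x) \<in> L2_space"
      using f assms(1) by (auto simp: L2_has_sum_def intro: L2_space_sum)
    from L2_norm_abs_diff[OF this] show "norm (L2_norm f - L2_norm (\<lambda>x. \<Sum>k\<in>F. \<psi> k x)) \<le>
        L2_norm (\<lambda>x. (\<Sum>k\<in>F. \<psi> k x) - f x)"
      by (simp add: L2_norm_minus_commute[of f])
  qed
  ultimately show "((\<lambda>F. L2_norm f - L2_norm (\<lambda>x. \<Sum>k\<in>F. \<psi> k x)) \<longlongrightarrow> 0)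
      (finite_subsets_at_top UNIV)"
    by (rule Lim_null_comparison[rotated])
qed

text \<open>
  At each point only finitely many terms are nonzero, so the series has a pointwise sum. By
  Fatou's lemma the upper bound for finite sums bounds its distance to a partial sum by the tail
  of the \<open>\<ell>\<^sub>2\<close> norm of the coefficients.
\<close>

lemma L2_has_sum_of_locally_finite:
  fixes \<phi> :: "'k \<Rightarrow> 'a::euclidean_space \<Rightarrow> complex"
  assumes count: "countable (UNIV :: 'k set)"
    and L2: "\<And>k. \<phi> k \<in> L2_space" and loc: "\<And>x. finite {k. \<phi> k x \<noteq> 0}"
    and le: "\<And>F c. finite F \<Longrightarrow>
      L2_norm (\<lambda>x. \<Sum>k\<in>F. c k * \<phi> k x) \<le> B * sqrt (\<Sum>k\<in>F. (cmod (c k))\<^sup>2)"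
    and "B \<ge> 0" and c: "c \<in> ell2"
  shows "\<exists>f. L2_has_sum (\<lambda>k x. c k * \<phi> k x) f"
proof -
  define E where "E n = from_nat_into (UNIV :: 'k set) ` {..n}" for n :: nat
  have fin: "finite (E n)" for n by (simp add: E_def)
  have mono: "E m \<subseteq> E n" if "m \<le> n" for m n using that by (auto simp: E_def)
  have exhaust: "\<exists>N. \<forall>n\<ge>N. F \<subseteq> E n" if "finite F" for F
    using that
  proof (induction F)
    case (insert k F)
    then obtain N where N: "\<forall>n\<ge>N. F \<subseteq> E n" by blast
    have "k \<in> E n" if "n \<ge> to_nat_on (UNIV :: 'k set) k" for n
      using that count unfolding E_def
      by (intro image_eqI[where x="to_nat_on (UNIV :: 'k set) k"]) auto
    with N show ?case by (intro exI[of _ "max N (to_nat_on UNIV k)"]) auto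
  qed auto
  define f where "f x = (\<Sum>k | \<phi> k x \<noteq> 0. c k * \<phi> k x)" for x
  have lim: "(\<lambda>n. \<Sum>k\<in>E n. c k * \<phi> k x) \<longlonglongrightarrow> f x" for x
  proof -
    obtain N where N: "\<forall>n\<ge>N. {k. \<phi> k x \<noteq> 0} \<subseteq> E n" using exhaust[OF loc] by blast
    have "f x = (\<Sum>k\<in>E n. c k * \<phi> k x)" if "n \<ge> N" for n
      unfolding f_def using N that fin by (intro sum.mono_neutral_left) auto
    then show ?thesis by (intro tendsto_eventually eventually_sequentiallyI[of N]) simp
  qed
  define s where "s = (\<Sum>\<^sub>\<infinity>k. (cmod (c k))\<^sup>2)"
  have sumc: "(\<lambda>k. (cmod (c k))\<^sup>2) summable_on UNIV" using c by (simp add: ell2_def)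
  have tail: "(\<lambda>x. f x - (\<Sum>k\<in>F. c k * \<phi> k x)) \<in> L2_space"
    "L2_norm (\<lambda>x. f x - (\<Sum>k\<in>F. c k * \<phi> k x)) \<le> B * sqrt (s - (\<Sum>k\<in>F. (cmod (c k))\<^sup>2))"
    if F: "finite F" for F
  proof -
    obtain N where N: "\<forall>n\<ge>N. F \<subseteq> E n" using exhaust[OF F] by blast
    have 1: "L2_norm (\<lambda>x. (\<Sum>k\<in>E n. c k * \<phi> k x) - (\<Sum>k\<in>F. c k * \<phi> k x)) \<le>
        B * sqrt (s - (\<Sum>k\<in>F. (cmod (c k))\<^sup>2))" if "n \<ge> N" for n
    proof -
      have sub: "F \<subseteq> E n" using N that by blast
      have "(\<Sum>k\<in>E n. c k * \<phi> k x) - (\<Sum>k\<in>F. c k * \<phi> k x) = (\<Sum>k\<in>E n - F. c k * \<phi> k x)" for x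
        using sum_diff[OF fin sub] by metis
      then have "L2_norm (\<lambda>x. (\<Sum>k\<in>E n. c k * \<phi> k x) - (\<Sum>k\<in>F. c k * \<phi> k x)) \<le>
          B * sqrt (\<Sum>k\<in>E n - F. (cmod (c k))\<^sup>2)"
        using le[of "E n - F" c] fin by simp
      also have "\<dots> \<le> B * sqrt (s - (\<Sum>k\<in>F. (cmod (c k))\<^sup>2))"
      proof -
        have "(\<Sum>k\<in>E n. (cmod (c k))\<^sup>2) \<le> s"
          unfolding s_def using fin by (intro finite_sum_le_infsum[OF sumc]) auto
        then have "(\<Sum>k\<in>E n - F. (cmod (c k))\<^sup>2) \<le> s - (\<Sum>k\<in>F. (cmod (c k))\<^sup>2)"
          using sum_diff[OF fin sub, of "\<lambda>k. (cmod (c k))\<^sup>2"] by simp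
        then show ?thesis using \<open>B \<ge> 0\<close> by (intro mult_left_mono real_sqrt_le_mono)
      qed
      finally show ?thesis .
    qed
    have 2: "(\<lambda>x. (\<Sum>k\<in>E n. c k * \<phi> k x) - (\<Sum>k\<in>F. c k * \<phi> k x)) \<in> L2_space" for n
      by (intro L2_space_diff L2_space_sum L2_space_scale L2)
    have 3: "(\<lambda>n. (\<Sum>k\<in>E n. c k * \<phi> k x) - (\<Sum>k\<in>F. c k * \<phi> k x)) \<longlonglongrightarrow>
        f x - (\<Sum>k\<in>F. c k * \<phi> k x)" for x
      by (intro tendsto_intros lim)
    show "(\<lambda>x. f x - (\<Sum>k\<in>F. c k * \<phi> k x)) \<in> L2_space"
      "L2_norm (\<lambda>x. f x - (\<Sum>k\<in>F. c k * \<phi> k x)) \<le> B * sqrt (s - (\<Sum>k\<in>F. (cmod (c k))\<^sup>2))"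
      using L2_Fatou[OF 2 3 1] by auto
  qed
  have "((\<lambda>F. B * sqrt (s - (\<Sum>k\<in>F. (cmod (c k))\<^sup>2))) \<longlongrightarrow> B * sqrt (s - s)) (finite_subsets_at_top UNIV)"
    unfolding s_def by (intro tendsto_intros infsum_tendsto sumc)
  then have "((\<lambda>F. L2_norm (\<lambda>x. (\<Sum>k\<in>F. c k * \<phi> k x) - f x)) \<longlongrightarrow> 0) (finite_subsets_at_top UNIV)"
    by (rule Lim_null_comparison[rotated, OF tendsto_eq_rhs])
       (auto intro!: eventually_finite_subsets_at_top_weakI simp: L2_norm_nonneg tail
         L2_norm_minus_commute[of _ f])
  moreover have "f \<in> L2_space" using tail(1)[of "{}"] by simp
  ultimately show ?thesis unfolding L2_has_sum_def by blast
qed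

text \<open>
  Norms of sums and of coefficient sequences are limits over finite index sets, so Riesz
  constants are decided by finitely supported coefficients alone. This is used both to establish
  the bounds and to show that they are sharp.
\<close>

lemma riesz_constants_iff_finite:
  fixes \<phi> :: "'k \<Rightarrow> 'a::euclidean_space \<Rightarrow> complex"
  assumes count: "countable (UNIV :: 'k set)"
    and L2: "\<And>k. \<phi> k \<in> L2_space" and loc: "\<And>x. finite {k. \<phi> k x \<noteq> 0}"
  shows "riesz_constants \<phi> A B \<longleftrightarrow> 0 < A \<and> A \<le> B \<and>
    (\<forall>F c. finite F \<longrightarrow>
       A * sqrt (\<Sum>k\<in>F. (cmod (c k))\<^sup>2) \<le> L2_norm (\<lambda>x. \<Sum>k\<in>F. c k * \<phi> k x) \<and>
       L2_norm (\<lambda>x. \<Sum>k\<in>F. c k * \<phi> k x) \<le> B * sqrt (\<Sum>k\<in>F. (cmod (c k))\<^sup>2))"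
    (is "?R \<longleftrightarrow> ?F")
proof
  assume R: ?R
  have "A * sqrt (\<Sum>k\<in>F. (cmod (c k))\<^sup>2) \<le> L2_norm (\<lambda>x. \<Sum>k\<in>F. c k * \<phi> k x) \<and>
       L2_norm (\<lambda>x. \<Sum>k\<in>F. c k * \<phi> k x) \<le> B * sqrt (\<Sum>k\<in>F. (cmod (c k))\<^sup>2)"
    if "finite F" for F and c :: "'k \<Rightarrow> complex"
  proof -
    define d where "d k = (if k \<in> F then c k else 0)" for k
    have "((\<lambda>k. (cmod (d k))\<^sup>2) has_sum (\<Sum>k\<in>F. (cmod (c k))\<^sup>2)) UNIV"
      using that by (intro has_sum_finite_neutralI) (auto simp: d_def)
    then have d: "d \<in> ell2" "ell2_norm d = sqrt (\<Sum>k\<in>F. (cmod (c k))\<^sup>2)"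
      by (auto simp: ell2_def ell2_norm_def infsumI summable_on_def)
    have "(\<Sum>k\<in>G. d k * \<phi> k x) = (\<Sum>k\<in>F. c k * \<phi> k x)" if "finite G" "F \<subseteq> G" for G x
      using that by (intro sum.mono_neutral_cong_right) (auto simp: d_def)
    then have "\<forall>\<^sub>F G in finite_subsets_at_top UNIV.
        L2_norm (\<lambda>x. (\<Sum>k\<in>G. d k * \<phi> k x) - (\<Sum>k\<in>F. c k * \<phi> k x)) = 0"
      unfolding eventually_finite_subsets_at_top using that by (intro exI[of _ F]) auto
    then have "L2_has_sum (\<lambda>k x. d k * \<phi> k x) (\<lambda>x. \<Sum>k\<in>F. c k * \<phi> k x)"
      unfolding L2_has_sum_def
    proof (intro conjI)
      show "(\<lambda>x. \<Sum>k\<in>F. c k * \<phi> k x) \<in> L2_space"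
        by (rule L2_space_sum) (rule L2_space_scale[OF L2])
    qed (rule tendsto_eventually)
    with R d(1) have "A * ell2_norm d \<le> L2_norm (\<lambda>x. \<Sum>k\<in>F. c k * \<phi> k x) \<and>
        L2_norm (\<lambda>x. \<Sum>k\<in>F. c k * \<phi> k x) \<le> B * ell2_norm d"
      unfolding riesz_constants_def by blast
    then show ?thesis by (simp only: d(2))
  qed
  then show ?F using R by (auto simp: riesz_constants_def)
next
  assume F: ?F
  show ?R
    unfolding riesz_constants_def
  proof (intro conjI ballI allI impI)
    fix c :: "'k \<Rightarrow> complex" assume c: "c \<in> ell2"
    show "\<exists>f. L2_has_sum (\<lambda>k x. c k * \<phi> k x) f"
      using F c by (intro L2_has_sum_of_locally_finite[where B=B] count L2 loc) auto
    fix f assume "L2_has_sum (\<lambda>k x. c k * \<phi> k x) f"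
    then have lim: "((\<lambda>F. L2_norm (\<lambda>x. \<Sum>k\<in>F. c k * \<phi> k x)) \<longlongrightarrow> L2_norm f)
        (finite_subsets_at_top UNIV)"
      by (intro L2_has_sum_norm_tendsto L2_space_scale L2)
    show "A * ell2_norm c \<le> L2_norm f"
      using F by (intro tendsto_le[OF _ lim tendsto_mult_left[OF ell2_norm_tendsto[OF c]]]
          eventually_finite_subsets_at_top_weakI) auto
    show "L2_norm f \<le> B * ell2_norm c"
      using F by (intro tendsto_le[OF _ tendsto_mult_left[OF ell2_norm_tendsto[OF c]] lim]
          eventually_finite_subsets_at_top_weakI) auto
  qed (use F in auto)
qed

lemma riesz_bounds_eqI:
  assumes R: "riesz_constants \<phi> A B"
    and A: "\<And>A' B'. riesz_constants \<phi> A' B' \<Longrightarrow> A' \<le> A"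
    and B: "\<And>A' B'. riesz_constants \<phi> A' B' \<Longrightarrow> B \<le> B'"
  shows "lower_riesz_bound \<phi> = A" "upper_riesz_bound \<phi> = B"
  unfolding lower_riesz_bound_def upper_riesz_bound_def
  using assms by (blast intro: Greatest_equality Least_equality)+

section \<open>The hat function of the Kuhn triangulation\<close>

lemma integrable_bounded_support:
  fixes f :: "'a::euclidean_space \<Rightarrow> 'b::{banach,second_countable_topology}"
  assumes [measurable]: "f \<in> borel_measurable borel"
    and bound: "\<And>x. norm (f x) \<le> C" and support: "\<And>x. f x \<noteq> 0 \<Longrightarrow> x \<in> cbox a b"
  shows "integrable lborel f"
proof (rule Bochner_Integration.integrable_bound)
  show "integrable lborel (\<lambda>x. C * indicat_real (cbox a b) x)"
    using emeasure_bounded_finite[OF bounded_cbox[of a b]]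
    by (intro integrable_mult_right integrable_real_indicator) auto
  have "norm (f x) \<le> C * indicat_real (cbox a b) x" for x
    using bound[of x] support[of x] by (cases "x \<in> cbox a b") auto
  then show "AE x in lborel. norm (f x) \<le> norm (C * indicat_real (cbox a b) x)"
    by (auto intro!: AE_I2 order_trans[OF _ abs_ge_self])
qed simp

abbreviation unit_ind :: "real \<Rightarrow> real" where
  "unit_ind \<equiv> indicat_real {0..1}"

text \<open>
  The value is the length of the interval of those \<open>t \<in> {0..1}\<close> for which \<open>x - t(1,\<dots>,1)\<close> lies in the
  unit cube; this is the box spline of the unit vectors and their sum. It is the piecewise linear
  hat function of the Kuhn triangulation, with value 1 at \<open>(1,\<dots>,1)\<close> and 0 at all other integer
  points. The \<open>Min\<close>--\<open>Max\<close> form makes continuity and the support evident.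
\<close>

definition kuhn_hat :: "real^'n \<Rightarrow> real" where
  "kuhn_hat x = max 0 (Min (insert 1 (range (\<lambda>i. x $ i))) - Max (insert 0 (range (\<lambda>i. x $ i - 1))))"

lemma kuhn_hat_eq_integral:
  "kuhn_hat x = (LINT t|lborel. unit_ind t * (\<Prod>i\<in>UNIV. unit_ind (x $ i - t)))"
proof -
  let ?b = "Min (insert 1 (range (\<lambda>i. x $ i)))" and ?a = "Max (insert 0 (range (\<lambda>i. x $ i - 1)))"
  have "unit_ind t * (\<Prod>i\<in>UNIV. unit_ind (x $ i - t)) = indicat_real {?a..?b} t" for t
  proof (cases "t \<in> {?a..?b}")
    case True
    then have "0 \<le> t \<and> t \<le> 1 \<and> (\<forall>i. x $ i - 1 \<le> t \<and> t \<le> x $ i)"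
      by auto
    with True show ?thesis by (auto simp: indicator_def algebra_simps)
  next
    case False
    then consider "t < 0" | "t > 1" | i where "t < x $ i - 1" | i where "t > x $ i"
      by (auto simp: not_le)
    then show ?thesis
    proof cases
      case 3
      then have "unit_ind (x $ i - t) = 0" by auto
      then show ?thesis using False by (auto intro: prod_zero)
    next
      case 4
      then have "unit_ind (x $ i - t) = 0" by auto
      then show ?thesis using False by (auto intro: prod_zero)
    qed (use False in auto)
  qed
  then have "(LINT t|lborel. unit_ind t * (\<Prod>i\<in>UNIV. unit_ind (x $ i - t))) =
      measure lborel {?a..?b}"
    by (simp only: Bochner_Integration.integral_indicator space_lborel space_borel Int_UNIV_right)
  also have "\<dots> = kuhn_hat x"
  proof (cases "?a \<le> ?b")
    case True
    then show ?thesis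
      unfolding kuhn_hat_def by (simp only: measure_lborel_Icc max_absorb2 diff_ge_0_iff_ge)
  next
    case False
    then have "{?a..?b} = {}" by (simp only: atLeastatMost_empty_iff not_False_eq_True)
    moreover have "max 0 (?b - ?a) = 0" using False by linarith
    ultimately show ?thesis unfolding kuhn_hat_def by (simp only: measure_empty)
  qed
  finally show ?thesis by (rule sym)
qed

lemma kuhn_hat_bounds: "0 \<le> kuhn_hat x" "kuhn_hat x \<le> 1"
proof -
  have "Min (insert 1 (range (\<lambda>i. x $ i))) \<le> 1" by simp
  moreover have "0 \<le> Max (insert 0 (range (\<lambda>i. x $ i - 1)))" by simp
  ultimately have "Min (insert 1 (range (\<lambda>i. x $ i))) - Max (insert 0 (range (\<lambda>i. x $ i - 1))) \<le> 1"
    by linarith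
  then show "0 \<le> kuhn_hat x" "kuhn_hat x \<le> 1" by (auto simp: kuhn_hat_def)
qed

lemma kuhn_hat_support:
  assumes "kuhn_hat x \<noteq> 0"
  shows "0 < x $ i" "x $ i < 2"
proof -
  have lt: "Max (insert 0 (range (\<lambda>i. x $ i - 1))) < Min (insert 1 (range (\<lambda>i. x $ i)))"
    using assms unfolding kuhn_hat_def by linarith
  have "0 \<le> Max (insert 0 (range (\<lambda>i. x $ i - 1)))" "x $ i - 1 \<le> Max (insert 0 (range (\<lambda>i. x $ i - 1)))"
    by (rule Max_ge; simp)+
  moreover have "Min (insert 1 (range (\<lambda>i. x $ i))) \<le> 1" "Min (insert 1 (range (\<lambda>i. x $ i))) \<le> x $ i"
    by (rule Min_le; simp)+
  ultimately show "0 < x $ i" "x $ i < 2" using lt by linarith+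
qed

lemma continuous_on_Min_image:
  fixes f :: "'i \<Rightarrow> 'a::topological_space \<Rightarrow> real"
  assumes "finite I" "I \<noteq> {}" "\<And>i. i \<in> I \<Longrightarrow> continuous_on S (f i)"
  shows "continuous_on S (\<lambda>x. Min ((\<lambda>i. f i x) ` I))"
  using assms by (induction rule: finite_ne_induct) (auto intro!: continuous_intros)

lemma continuous_on_Max_image:
  fixes f :: "'i \<Rightarrow> 'a::topological_space \<Rightarrow> real"
  assumes "finite I" "I \<noteq> {}" "\<And>i. i \<in> I \<Longrightarrow> continuous_on S (f i)"
  shows "continuous_on S (\<lambda>x. Max ((\<lambda>i. f i x) ` I))"
  using assms by (induction rule: finite_ne_induct) (auto intro!: continuous_intros)

lemma continuous_on_kuhn_hat:
  fixes S :: "(real^'n) set"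
  shows "continuous_on S kuhn_hat"
proof -
  have "continuous_on S (\<lambda>x::real^'n. max 0 (min 1 (Min (range (\<lambda>i. x $ i))) - max 0 (Max (range (\<lambda>i. x $ i - 1)))))"
    by (intro continuous_intros continuous_on_Min_image continuous_on_Max_image) auto
  then show ?thesis
    by (simp add: kuhn_hat_def[abs_def])
qed

lemma borel_measurable_kuhn_hat [measurable]: "kuhn_hat \<in> borel_measurable borel"
  by (intro borel_measurable_continuous_onI continuous_on_kuhn_hat)

lemma borel_measurable_kuhn_hat_shift [measurable]:
  "(\<lambda>x. kuhn_hat (x - v)) \<in> borel_measurable borel"
  by (rule measurable_compose[OF _ borel_measurable_kuhn_hat]) measurable

lemma prod_unit_ind_bounds:
  "0 \<le> (\<Prod>i\<in>I. unit_ind (f i))" "(\<Prod>i\<in>I. unit_ind (f i)) \<le> 1"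
  by (auto intro!: prod_nonneg prod_le_1)

lemma prod_unit_ind_nonzeroD:
  assumes "(\<Prod>i\<in>(UNIV::'n::finite set). unit_ind (f i)) \<noteq> 0"
  shows "0 \<le> f i \<and> f i \<le> 1"
  using assms by (auto simp: indicator_def)

text \<open>
  Fubini's theorem for the defining integral of the hat function. Every later integral of the hat
  function (its Fourier transform and its autocorrelation) becomes an integral over the unit cube,
  which factors into one-dimensional integrals.
\<close>

lemma integral_kuhn_hat_scaleR:
  fixes h :: "real^'n \<Rightarrow> 'b::{banach,second_countable_topology}"
  assumes [measurable]: "h \<in> borel_measurable borel" and bound: "\<And>x. norm (h x) \<le> C"
  shows "(LINT x|lborel. kuhn_hat x *\<^sub>R h x) =
    (LINT t|lborel. unit_ind t *\<^sub>R (LINT x|lborel. (\<Prod>i\<in>UNIV. unit_ind (x $ i - t)) *\<^sub>R h x))"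
proof -
  define g where "g t x = (unit_ind t * (\<Prod>i\<in>UNIV. unit_ind (x $ i - t))) *\<^sub>R h x" for t and x :: "real^'n"
  have meas: "case_prod g \<in> borel_measurable borel"
    unfolding g_def[abs_def] borel_prod[symmetric] by measurable
  have "norm (case_prod g z) \<le> C" for z
  proof -
    have "norm (g t x) \<le> 1 * C" for t x
      unfolding g_def norm_scaleR
      using prod_unit_ind_bounds[where f="\<lambda>i. x $ i - t" and I=UNIV]
      by (intro mult_mono bound) (auto simp: abs_mult intro!: mult_le_one)
    then show ?thesis by (cases z) simp
  qed
  moreover have "z \<in> cbox (0, 0) (1, \<chi> i. 2)" if "case_prod g z \<noteq> 0" for z
  proof (cases z)
    case (Pair t x)
    then have "unit_ind t \<noteq> 0" "(\<Prod>i\<in>UNIV. unit_ind (x $ i - t)) \<noteq> 0"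
      using that by (auto simp: g_def)
    then have t: "0 \<le> t \<and> t \<le> 1" and x: "0 \<le> x $ i - t \<and> x $ i - t \<le> 1" for i
      by (auto dest: prod_unit_ind_nonzeroD simp: indicator_def split: if_splits)
    have "0 \<le> x $ i \<and> x $ i \<le> 2" for i using t x[of i] by linarith
    with t show ?thesis by (simp add: Pair cbox_Pair_eq mem_box_cart)
  qed
  ultimately have int: "integrable (lborel \<Otimes>\<^sub>M lborel) (case_prod g)"
    unfolding lborel_prod using meas by (intro integrable_bounded_support)
  have "(LINT x|lborel. kuhn_hat x *\<^sub>R h x) = (LINT x|lborel. (LINT t|lborel. g t x))"
  proof (rule Bochner_Integration.integral_cong[OF refl])
    fix x :: "real^'n"
    have "integrable lborel (\<lambda>t. unit_ind t * (\<Prod>i\<in>UNIV. unit_ind (x $ i - t)))"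
      using prod_unit_ind_bounds[where f="\<lambda>i. x $ i - _" and I=UNIV]
      by (intro integrable_bounded_support[where C=1 and a=0 and b=1])
         (auto simp: abs_mult indicator_def split: if_splits intro!: mult_le_one)
    then show "kuhn_hat x *\<^sub>R h x = (LINT t|lborel. g t x)"
      unfolding g_def kuhn_hat_eq_integral by (subst integral_scaleR_left) auto
  qed
  also have "\<dots> = (LINT t|lborel. (LINT x|lborel. g t x))"
    by (rule lborel_pair.Fubini_integral[OF int])
  also have "\<dots> = (LINT t|lborel. unit_ind t *\<^sub>R (LINT x|lborel. (\<Prod>i\<in>UNIV. unit_ind (x $ i - t)) *\<^sub>R h x))"
    unfolding g_def by (simp add: scaleR_scaleR[symmetric] del: scaleR_scaleR)
  finally show ?thesis .
qed

lemma integral_unit_ind_exp: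
  "(LINT y|lborel. complex_of_real (unit_ind y) * exp (- \<i> * complex_of_real (s * y))) = box_factor s"
proof (cases "s = 0")
  case True
  then show ?thesis by (simp add: box_factor_def)
next
  case False
  define F where "F y = exp (- \<i> * complex_of_real (s * y)) / (- \<i> * complex_of_real s)" for y
  have "(F has_vector_derivative exp (- \<i> * complex_of_real (s * y))) (at y within {0..1})" for y
    unfolding F_def using False
    by (auto intro!: derivative_eq_intros has_vector_derivative_real_field simp: field_simps)
  then have "(LINT y|lborel. unit_ind y *\<^sub>R exp (- \<i> * complex_of_real (s * y))) = F 1 - F 0"
    by (intro integral_FTC_Icc) (auto intro!: continuous_intros)
  also have "\<dots> = box_factor s"
    using False by (simp add: F_def box_factor_def field_simps)
  finally show ?thesis by (simp add: scaleR_conv_of_real)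
qed

lemma integral_unit_ind_shift_exp:
  "(LINT y|lborel. complex_of_real (unit_ind (y - t)) * exp (- \<i> * complex_of_real (s * y))) =
     exp (- \<i> * complex_of_real (s * t)) * box_factor s"
proof -
  have "(LINT y|lborel. complex_of_real (unit_ind (y - t)) * exp (- \<i> * complex_of_real (s * y))) =
      (LINT y|lborel. complex_of_real (unit_ind y) * exp (- \<i> * complex_of_real (s * (t + y))))"
    by (subst lborel_integral_real_affine[where c=1 and t=t]) simp_all
  also have "\<dots> = (LINT y|lborel. exp (- \<i> * complex_of_real (s * t)) *
      (complex_of_real (unit_ind y) * exp (- \<i> * complex_of_real (s * y))))"
    by (intro Bochner_Integration.integral_cong) (auto simp: exp_add[symmetric] algebra_simps)
  also have "\<dots> = exp (- \<i> * complex_of_real (s * t)) * box_factor s"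
    by (simp only: integral_mult_right_zero integral_unit_ind_exp)
  finally show ?thesis .
qed

lemma exp_ii_sum:
  "finite I \<Longrightarrow> exp (- \<i> * complex_of_real (\<Sum>i\<in>I. a i)) = (\<Prod>i\<in>I. exp (- \<i> * complex_of_real (a i)))"
  by (simp only: of_real_sum sum_distrib_left exp_sum)

text \<open>
  The cube contributes one factor for each coordinate; integrating the phase \<open>exp (- \<i> t \<Sum>\<eta>)\<close> left over
  from the translation by \<open>t(1,\<dots>,1)\<close> contributes the last one.
\<close>

lemma integral_kuhn_hat_exp:
  fixes \<eta> :: "real^'n"
  shows "(LINT x|lborel. complex_of_real (kuhn_hat x) * exp (- \<i> * complex_of_real (\<eta> \<bullet> x))) =
    (\<Prod>i\<in>UNIV. box_factor (\<eta> $ i)) * box_factor (\<Sum>i\<in>UNIV. \<eta> $ i)"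
proof -
  let ?e = "\<lambda>x. exp (- \<i> * complex_of_real (\<eta> \<bullet> x))"
  have inner: "(LINT x|lborel. (\<Prod>i\<in>UNIV. unit_ind (x $ i - t)) *\<^sub>R ?e x) =
      exp (- \<i> * complex_of_real ((\<Sum>i\<in>UNIV. \<eta> $ i) * t)) * (\<Prod>i\<in>UNIV. box_factor (\<eta> $ i))" for t
  proof -
    have "(LINT x|lborel. (\<Prod>i\<in>UNIV. unit_ind (x $ i - t)) *\<^sub>R ?e x) =
        (LINT x|lborel. (\<Prod>i\<in>UNIV. complex_of_real (unit_ind (x $ i - t)) *
            exp (- \<i> * complex_of_real (\<eta> $ i * x $ i))))"
      by (simp only: scaleR_conv_of_real inner_vec_def inner_real_def prod.distrib exp_ii_sum of_real_prod finite)
    also have "\<dots> = (\<Prod>i\<in>UNIV. (LINT y|lborel. complex_of_real (unit_ind (y - t)) *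
            exp (- \<i> * complex_of_real (\<eta> $ i * y))))"
      by (intro integral_prod_cart integrable_bounded_support[where C=1 and a=t and b="t+1"])
         (auto simp: norm_mult indicator_def split: if_splits)
    also have "\<dots> = exp (- \<i> * complex_of_real ((\<Sum>i\<in>UNIV. \<eta> $ i) * t)) * (\<Prod>i\<in>UNIV. box_factor (\<eta> $ i))"
      by (simp only: integral_unit_ind_shift_exp prod.distrib exp_ii_sum sum_distrib_right finite)
    finally show ?thesis .
  qed
  have "(LINT x|lborel. kuhn_hat x *\<^sub>R ?e x) =
      (LINT t|lborel. unit_ind t *\<^sub>R (LINT x|lborel. (\<Prod>i\<in>UNIV. unit_ind (x $ i - t)) *\<^sub>R ?e x))"
    by (rule integral_kuhn_hat_scaleR[where C=1]) auto
  also have "\<dots> = (LINT t|lborel. (\<Prod>i\<in>UNIV. box_factor (\<eta> $ i)) *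
      (complex_of_real (unit_ind t) * exp (- \<i> * complex_of_real ((\<Sum>i\<in>UNIV. \<eta> $ i) * t))))"
    by (simp only: inner) (simp only: scaleR_conv_of_real mult_ac)
  also have "\<dots> = (\<Prod>i\<in>UNIV. box_factor (\<eta> $ i)) * box_factor (\<Sum>i\<in>UNIV. \<eta> $ i)"
    by (simp only: integral_mult_right_zero integral_unit_ind_exp)
  finally show ?thesis by (simp add: scaleR_conv_of_real)
qed

section \<open>Injectivity of the Fourier transform\<close>

lemma integrable_mult_compact_support:
  fixes f p :: "'a::euclidean_space \<Rightarrow> real"
  assumes f: "continuous_on UNIV f" "compact (closure {x. f x \<noteq> 0})" and p: "continuous_on UNIV p"
  shows "integrable lborel (\<lambda>x. f x * p x)"
proof -
  let ?K = "closure {x. f x \<noteq> 0}"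
  have "continuous_on ?K (\<lambda>x. f x * p x)"
    using f p by (intro continuous_intros) (auto intro: continuous_on_subset)
  from borel_integrable_compact[OF f(2) this]
  have "integrable lborel (\<lambda>x. indicator ?K x *\<^sub>R (f x * p x))" .
  also have "(\<lambda>x. indicator ?K x *\<^sub>R (f x * p x)) = (\<lambda>x. f x * p x)"
  proof
    fix x show "indicator ?K x *\<^sub>R (f x * p x) = f x * p x"
      using closure_subset[of "{x. f x \<noteq> 0}"] by (cases "f x = 0") auto
  qed
  finally show ?thesis .
qed

text \<open>
  Suppose that \<open>f\<close> is orthogonal to all \<open>cos (\<omega> \<bullet> x)\<close> and \<open>sin (\<omega> \<bullet> x)\<close>. By the product-to-sum formulas
  it is orthogonal to the algebra that they generate. By the Stone--Weierstrass theorem this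
  algebra is uniformly dense on the support of \<open>f\<close>, hence \<open>f\<close> is orthogonal to itself.
\<close>

lemma continuous_compact_support_eq_zero_of_fourier:
  fixes f :: "'a::euclidean_space \<Rightarrow> real"
  assumes f: "continuous_on UNIV f" "compact (closure {x. f x \<noteq> 0})"
    and zero: "\<And>\<omega>. fourier_transform (\<lambda>x. complex_of_real (f x)) \<omega> = 0"
  shows "f x = 0"
proof -
  let ?K = "closure {x. f x \<noteq> 0}"
  note integrable = integrable_mult_compact_support[OF f]
  define J where "J p = (LINT x|lborel. f x * p x)" for p
  have J_add: "J (\<lambda>x. p x + q x) = J p + J q"
    if "continuous_on UNIV p" "continuous_on UNIV q" for p q
    unfolding J_def using integrable[OF that(1)] integrable[OF that(2)]
    by (simp add: distrib_left)
  have J_scale: "J (\<lambda>x. c * p x) = c * J p" for c p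
    unfolding J_def by (subst integral_mult_right_zero[symmetric]) (simp add: mult_ac)
  define ann where "ann h \<longleftrightarrow> (\<forall>\<omega>. J (\<lambda>x. h x * cos (\<omega> \<bullet> x)) = 0 \<and> J (\<lambda>x. h x * sin (\<omega> \<bullet> x)) = 0)" for h
  \<comment> \<open>The multipliers that preserve orthogonality to all frequencies are closed under sums and
      products, so it suffices that they contain each single sine and cosine.\<close>
  define R where "R = {p. continuous_on UNIV p \<and>
      (\<forall>h. continuous_on UNIV h \<longrightarrow> ann h \<longrightarrow> ann (\<lambda>x. h x * p x))}"
  have ann_one: "ann (\<lambda>x. 1)"
    unfolding ann_def
  proof
    fix \<omega> :: 'a
    have eq: "complex_of_real (f x) * exp (- \<i> * complex_of_real (\<omega> \<bullet> x)) =
        Complex (f x * cos (\<omega> \<bullet> x)) (- (f x * sin (\<omega> \<bullet> x)))" for x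
      by (simp add: complex_eq_iff Re_exp Im_exp)
    have int: "integrable lborel (\<lambda>x. f x * cos (\<omega> \<bullet> x))" "integrable lborel (\<lambda>x. - (f x * sin (\<omega> \<bullet> x)))"
      by (auto intro!: integrable continuous_intros)
    have "integrable lborel (\<lambda>x. Complex (f x * cos (\<omega> \<bullet> x)) (- (f x * sin (\<omega> \<bullet> x))))"
      unfolding Complex_eq
      by (intro Bochner_Integration.integrable_add integrable_mult_right
          integrable_of_real[OF int(1)] integrable_of_real[OF int(2)])
    note this[THEN integral_Re] this[THEN integral_Im]
    then show "J (\<lambda>x. 1 * cos (\<omega> \<bullet> x)) = 0 \<and> J (\<lambda>x. 1 * sin (\<omega> \<bullet> x)) = 0"
      using zero[of \<omega>] int unfolding fourier_transform_def eq J_def by simp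
  qed
  have const_R: "(\<lambda>x. c) \<in> R" for c
    unfolding R_def ann_def using J_scale[of c] by (auto simp: mult_ac)
  have add_R: "(\<lambda>x. p x + q x) \<in> R" if "p \<in> R" "q \<in> R" for p q
    using that unfolding R_def ann_def
    by (auto simp: distrib_left distrib_right J_add continuous_intros)
  have mult_R: "(\<lambda>x. p x * q x) \<in> R" if "p \<in> R" "q \<in> R" for p q
  proof -
    have "ann (\<lambda>x. h x * (p x * q x))" if "continuous_on UNIV h" "ann h" for h
    proof -
      have "continuous_on UNIV (\<lambda>x. h x * p x)" "ann (\<lambda>x. h x * p x)"
        using that \<open>p \<in> R\<close> by (auto simp: R_def intro: continuous_intros)
      then have "ann (\<lambda>x. (h x * p x) * q x)" using \<open>q \<in> R\<close> unfolding R_def by blast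
      then show ?thesis by (simp add: mult.assoc)
    qed
    then show ?thesis using that by (auto simp: R_def intro: continuous_intros)
  qed
  have halves: "J (\<lambda>x. (h x * a x + c * (h x * b x)) / 2) = 0"
    if "J (\<lambda>x. h x * a x) = 0" "J (\<lambda>x. h x * b x) = 0" "continuous_on UNIV h"
      "continuous_on UNIV a" "continuous_on UNIV b" for h a b and c :: real
  proof -
    have "J (\<lambda>x. (h x * a x + c * (h x * b x)) / 2) = J (\<lambda>x. 1/2 * (h x * a x) + c/2 * (h x * b x))"
      by (simp add: add_divide_distrib)
    also have "\<dots> = 0"
      using that by (subst J_add) (auto simp only: J_scale mult_zero_right add_0 intro!: continuous_intros)
    finally show ?thesis .
  qed
  have trig_R: "(\<lambda>x. cos (\<eta> \<bullet> x)) \<in> R" "(\<lambda>x. sin (\<eta> \<bullet> x)) \<in> R" for \<eta>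
  proof -
    have "ann (\<lambda>x. h x * cos (\<eta> \<bullet> x)) \<and> ann (\<lambda>x. h x * sin (\<eta> \<bullet> x))"
      if h: "continuous_on UNIV h" and "ann h" for h
    proof -
      have c: "J (\<lambda>x. h x * cos (\<omega> \<bullet> x)) = 0" and s: "J (\<lambda>x. h x * sin (\<omega> \<bullet> x)) = 0" for \<omega>
        using \<open>ann h\<close> by (auto simp: ann_def)
      have "J (\<lambda>x. h x * cos (\<eta> \<bullet> x) * cos (\<omega> \<bullet> x)) = 0" for \<omega>
        using halves[OF c[of "\<eta> - \<omega>"] c[of "\<eta> + \<omega>"] h, of 1]
        by (simp add: mult.assoc cos_times_cos inner_diff_left inner_add_left distrib_left continuous_intros)
      moreover have "J (\<lambda>x. h x * cos (\<eta> \<bullet> x) * sin (\<omega> \<bullet> x)) = 0" for \<omega>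
        using halves[OF s[of "\<eta> + \<omega>"] s[of "\<eta> - \<omega>"] h, of "-1"]
        by (simp add: mult.assoc cos_times_sin inner_diff_left inner_add_left right_diff_distrib continuous_intros)
      moreover have "J (\<lambda>x. h x * sin (\<eta> \<bullet> x) * cos (\<omega> \<bullet> x)) = 0" for \<omega>
        using halves[OF s[of "\<eta> + \<omega>"] s[of "\<eta> - \<omega>"] h, of 1]
        by (simp add: mult.assoc sin_times_cos inner_diff_left inner_add_left distrib_left continuous_intros)
      moreover have "J (\<lambda>x. h x * sin (\<eta> \<bullet> x) * sin (\<omega> \<bullet> x)) = 0" for \<omega>
        using halves[OF c[of "\<eta> - \<omega>"] c[of "\<eta> + \<omega>"] h, of "-1"]
        by (simp add: mult.assoc sin_times_sin inner_diff_left inner_add_left right_diff_distrib continuous_intros)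
      ultimately show ?thesis by (simp add: ann_def)
    qed
    then show "(\<lambda>x. cos (\<eta> \<bullet> x)) \<in> R" "(\<lambda>x. sin (\<eta> \<bullet> x)) \<in> R"
      by (auto simp: R_def intro!: continuous_intros)
  qed
  interpret function_ring_on R ?K
  proof
    fix x y :: 'a assume "x \<noteq> y"
    \<comment> \<open>The phases \<open>\<eta> \<bullet> x\<close> and \<open>\<eta> \<bullet> y\<close> then differ by 1, which is not a multiple of \<open>2 * pi\<close>.\<close>
    define \<eta> where "\<eta> = (x - y) /\<^sub>R (norm (x - y))\<^sup>2"
    have "\<eta> \<bullet> (x - y) = 1"
      using \<open>x \<noteq> y\<close> by (simp add: \<eta>_def dot_square_norm)
    then have "cos (\<eta> \<bullet> x) * cos (\<eta> \<bullet> y) + sin (\<eta> \<bullet> x) * sin (\<eta> \<bullet> y) = cos 1"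
      by (metis cos_diff inner_diff_right)
    moreover have "cos (1::real) < 1"
      using cos_monotone_0_pi[of 0 "1::real"] pi_gt3 by simp
    ultimately have "cos (\<eta> \<bullet> x) \<noteq> cos (\<eta> \<bullet> y) \<or> sin (\<eta> \<bullet> x) \<noteq> sin (\<eta> \<bullet> y)"
      using sin_cos_squared_add[of "\<eta> \<bullet> y"] by (auto simp: power2_eq_square)
    then show "\<exists>g\<in>R. g x \<noteq> g y"
      using bexI[OF _ trig_R(1)[of \<eta>], of "\<lambda>g. g x \<noteq> g y"]
        bexI[OF _ trig_R(2)[of \<eta>], of "\<lambda>g. g x \<noteq> g y"] by auto
  qed (use f(2) const_R add_R mult_R in \<open>auto simp: R_def intro: continuous_on_subset\<close>)
  have orth: "J p = 0" if "p \<in> R" for p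
  proof -
    have "ann (\<lambda>x. 1 * p x)" proof -
      from that have "\<forall>h. continuous_on UNIV h \<longrightarrow> ann h \<longrightarrow> ann (\<lambda>x. h x * p x)"
        unfolding R_def by simp
      from spec[OF this, of "\<lambda>x. 1"] show ?thesis using ann_one by simp
    qed
    then have "J (\<lambda>x. 1 * p x * cos (0 \<bullet> x)) = 0" unfolding ann_def by blast
    then show ?thesis by simp
  qed
  have int_abs: "integrable lborel (\<lambda>x. \<bar>f x\<bar>)"
    using integrable[of "\<lambda>x. 1"] by (intro integrable_abs) simp
  have "J f \<le> 0"
  proof (rule field_le_epsilon)
    fix e :: real assume "e > 0"
    define M where "M = (LINT x|lborel. \<bar>f x\<bar>) + 1"
    have "M > 0" unfolding M_def by (simp add: add_nonneg_pos)
    obtain p where p: "p \<in> R" "\<forall>x\<in>?K. \<bar>f x - p x\<bar> < e / M"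
      using Stone_Weierstrass_basic[of f "e / M"] f \<open>e > 0\<close> \<open>M > 0\<close>
      by (auto intro: continuous_on_subset)
    have cp: "continuous_on UNIV p" using p by (simp add: R_def)
    have "J f = J (\<lambda>x. (f x - p x) + p x)" by simp
    also have "\<dots> = J (\<lambda>x. f x - p x)"
      using f(1) cp orth[OF p(1)] by (subst J_add) (auto intro!: continuous_intros)
    also have "\<dots> \<le> (LINT x|lborel. e / M * \<bar>f x\<bar>)"
      unfolding J_def
    proof (rule integral_mono)
      show "integrable lborel (\<lambda>x. f x * (f x - p x))"
        by (intro integrable continuous_intros f cp)
      fix x :: 'a
      show "f x * (f x - p x) \<le> e / M * \<bar>f x\<bar>"
      proof (cases "f x = 0")
        case False
        then have "\<bar>f x - p x\<bar> \<le> e / M"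
          using p(2) closure_subset[of "{x. f x \<noteq> 0}"] by (auto intro: less_imp_le)
        have "f x * (f x - p x) \<le> \<bar>f x\<bar> * \<bar>f x - p x\<bar>"
          by (metis abs_ge_self abs_mult)
        also have "\<dots> \<le> \<bar>f x\<bar> * (e / M)"
          using \<open>\<bar>f x - p x\<bar> \<le> e / M\<close> by (rule mult_left_mono) simp
        finally show ?thesis by (simp add: mult.commute)
      qed simp
    qed (use int_abs in simp)
    also have "\<dots> = e / M * (LINT x|lborel. \<bar>f x\<bar>)" by simp
    also have "\<dots> \<le> e / M * M"
      using \<open>e > 0\<close> \<open>M > 0\<close> by (intro mult_left_mono) (auto simp: M_def)
    also have "\<dots> = e" using \<open>M > 0\<close> by simp
    finally show "J f \<le> 0 + e" by simp
  qed
  moreover have "J f \<ge> 0" unfolding J_def by simp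
  ultimately have "J f = 0" by (rule antisym)
  then have "AE x in lborel. f x * f x = 0"
    using integral_nonneg_eq_0_iff_AE[OF integrable[OF f(1)]] by (simp add: J_def)
  then have "AE x in lborel. x \<notin> {x. f x \<noteq> 0}" by simp
  moreover have op: "open {x. f x \<noteq> 0}"
    by (rule open_Collect_neq[OF f(1)]) simp
  ultimately have "{x. f x \<noteq> 0} \<in> null_sets lborel"
    by (subst AE_iff_null_sets) auto
  then have "negligible {x. f x \<noteq> 0}"
    by (simp add: negligible_iff_null_sets null_sets_completionI)
  then have "{x. f x \<noteq> 0} = {}" using op open_not_negligible by blast
  then show ?thesis by auto
qed

lemma borel_measurable_fourier_integrand:
  "continuous_on UNIV f \<Longrightarrow> (\<lambda>x. complex_of_real (f x) * exp (- \<i> * complex_of_real (\<omega> \<bullet> x))) \<in> borel_measurable borel"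
  by (intro borel_measurable_continuous_onI continuous_intros)

lemma fourier_transform_diff:
  fixes f g :: "'a::euclidean_space \<Rightarrow> real"
  assumes f: "continuous_on UNIV f" "compact (closure {x. f x \<noteq> 0})"
    and g: "continuous_on UNIV g" "compact (closure {x. g x \<noteq> 0})"
  shows "fourier_transform (\<lambda>x. complex_of_real (f x - g x)) \<omega> =
    fourier_transform (\<lambda>x. complex_of_real (f x)) \<omega> - fourier_transform (\<lambda>x. complex_of_real (g x)) \<omega>"
proof -
  have "integrable lborel (\<lambda>x. complex_of_real (h x) * exp (- \<i> * complex_of_real (\<omega> \<bullet> x)))"
    if h: "continuous_on UNIV h" "compact (closure {x. h x \<noteq> 0})" for h :: "'a \<Rightarrow> real"
  proof (rule Bochner_Integration.integrable_bound)
    show "integrable lborel (\<lambda>x. h x * 1)"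
      by (rule integrable_mult_compact_support[OF h]) simp
    show "(\<lambda>x. complex_of_real (h x) * exp (- \<i> * complex_of_real (\<omega> \<bullet> x))) \<in> borel_measurable lborel"
      using borel_measurable_fourier_integrand[OF h(1)] by simp
  qed (simp add: norm_mult)
  from this[OF f] this[OF g] show ?thesis
    unfolding fourier_transform_def by (simp add: left_diff_distrib)
qed

lemma fourier_transform_inject:
  fixes f g :: "'a::euclidean_space \<Rightarrow> real"
  assumes f: "continuous_on UNIV f" "compact (closure {x. f x \<noteq> 0})"
    and g: "continuous_on UNIV g" "compact (closure {x. g x \<noteq> 0})"
    and eq: "\<And>\<omega>. fourier_transform (\<lambda>x. complex_of_real (f x)) \<omega> = fourier_transform (\<lambda>x. complex_of_real (g x)) \<omega>"
  shows "f = g"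
proof
  fix x
  have "f x - g x = 0"
  proof (rule continuous_compact_support_eq_zero_of_fourier[where f="\<lambda>x. f x - g x"])
    show "continuous_on UNIV (\<lambda>x. f x - g x)" using f g by (intro continuous_intros)
    have "closure {x. f x - g x \<noteq> 0} \<subseteq> closure {x. f x \<noteq> 0} \<union> closure {x. g x \<noteq> 0}"
      unfolding closure_Un[symmetric] by (rule closure_mono) auto
    then show "compact (closure {x. f x - g x \<noteq> 0})"
      using f g by (meson bounded_Un bounded_subset closed_closure compact_eq_bounded_closed)
  qed (use eq fourier_transform_diff[OF f g] in simp)
  then show "f x = g x" by simp
qed

section \<open>The linear box spline as a hat function\<close>

lemma det_column_matrix_nonzero:
  fixes \<xi> :: "'n::finite \<Rightarrow> real^'n"
  assumes "inj \<xi>" "independent (range \<xi>)"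
  shows "det (column_matrix \<xi>) \<noteq> 0"
proof -
  have col: "column i (column_matrix \<xi>) = \<xi> i" for i
    by (simp add: column_def column_matrix_def vec_eq_iff)
  have "c i = 0" if "(\<Sum>i\<in>UNIV. c i *s column i (column_matrix \<xi>)) = 0" for c i
  proof -
    have "(\<Sum>v\<in>range \<xi>. c (inv \<xi> v) *\<^sub>R v) = 0"
      using that assms(1) by (subst sum.reindex) (simp_all add: col scalar_mult_eq_scaleR inv_f_f)
    then have "c (inv \<xi> (\<xi> i)) = 0"
      using assms(2) by (intro independentD[of "range \<xi>" "range \<xi>" "\<lambda>v. c (inv \<xi> v)"]) auto
    then show ?thesis using assms(1) by simp
  qed
  then have "\<exists>B. B ** column_matrix \<xi> = mat 1"
    by (subst matrix_left_invertible_independent_columns) blast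
  then show ?thesis
    by (metis invertible_det_nz invertible_left_inverse)
qed

lemma inner_column_matrix:
  fixes \<xi> :: "'n::finite \<Rightarrow> real^'n"
  shows "\<omega> \<bullet> (column_matrix \<xi> *v y) = (\<chi> k. \<xi> k \<bullet> \<omega>) \<bullet> y"
proof -
  have "\<omega> \<bullet> (column_matrix \<xi> *v y) = (\<Sum>i\<in>UNIV. \<Sum>k\<in>UNIV. \<omega> $ i * (\<xi> k $ i * y $ k))"
    by (simp add: inner_vec_def matrix_vector_mult_def column_matrix_def sum_distrib_left)
  also have "\<dots> = (\<Sum>k\<in>UNIV. \<Sum>i\<in>UNIV. \<omega> $ i * (\<xi> k $ i * y $ k))"
    by (rule sum.swap)
  also have "\<dots> = (\<chi> k. \<xi> k \<bullet> \<omega>) \<bullet> y"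
    by (simp add: inner_vec_def sum_distrib_left sum_distrib_right mult_ac)
  finally show ?thesis .
qed

lemma prod_UNIV_option:
  fixes g :: "'n::finite option \<Rightarrow> 'b::comm_monoid_mult"
  shows "(\<Prod>k\<in>UNIV. g k) = (\<Prod>k\<in>UNIV. g (Some k)) * g None"
proof -
  have "(\<Prod>k\<in>UNIV. g k) = g None * (\<Prod>k\<in>range Some. g k)"
    unfolding UNIV_option_conv by (rule prod.insert) auto
  also have "(\<Prod>k\<in>range Some. g k) = (\<Prod>k\<in>UNIV. g (Some k))"
    by (subst prod.reindex) (auto simp: inj_on_def)
  finally show ?thesis by (simp add: mult.commute)
qed

lemma matrix_inv_mult_vector:
  fixes A :: "real^'n^'n"
  assumes "det A \<noteq> 0"
  shows "matrix_inv A *v (A *v x) = x" "A *v (matrix_inv A *v x) = x"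
proof -
  have "\<exists>B. A ** B = mat 1 \<and> B ** A = mat 1"
    using assms by (simp add: invertible_det_nz[symmetric] invertible_def)
  from someI_ex[OF this] have "A ** matrix_inv A = mat 1 \<and> matrix_inv A ** A = mat 1"
    unfolding matrix_inv_def .
  then show "matrix_inv A *v (A *v x) = x" "A *v (matrix_inv A *v x) = x"
    by (simp_all add: matrix_vector_mul_assoc)
qed

text \<open>
  The composition of the hat function with the inverse of \<open>column_matrix \<xi>\<close> has all the properties
  that define the box spline: substituting \<open>x = column_matrix \<xi> *v y\<close> turns the frequency \<open>\<omega>\<close> into the
  vector of the \<open>\<xi> k \<bullet> \<omega>\<close>. Injectivity of the Fourier transform gives uniqueness.
\<close>

lemma linear_box_spline_eq_kuhn_hat:
  fixes \<xi> :: "'n::finite \<Rightarrow> real^'n"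
  assumes "inj \<xi>" "independent (range \<xi>)"
  shows "linear_box_spline \<xi> = (\<lambda>x. kuhn_hat (matrix_inv (column_matrix \<xi>) *v x))"
proof -
  let ?A = "column_matrix \<xi>"
  let ?f = "\<lambda>x. kuhn_hat (matrix_inv ?A *v x)"
  have det: "det ?A \<noteq> 0" by (rule det_column_matrix_nonzero[OF assms])
  have cont: "continuous_on UNIV ?f"
    by (rule continuous_on_compose2[OF continuous_on_kuhn_hat[of UNIV] matrix_vector_mult_linear_continuous_on]) simp
  have comp: "compact (closure {x. ?f x \<noteq> 0})"
  proof -
    have "{x. ?f x \<noteq> 0} \<subseteq> (*v) ?A ` cbox 0 (\<chi> i. 2)"
    proof
      fix x assume "x \<in> {x. ?f x \<noteq> 0}"
      then have "matrix_inv ?A *v x \<in> cbox 0 (\<chi> i. 2)"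
        using kuhn_hat_support[of "matrix_inv ?A *v x"] by (auto simp: mem_box_cart less_imp_le)
      then show "x \<in> (*v) ?A ` cbox 0 (\<chi> i. 2)"
        using matrix_inv_mult_vector(2)[OF det, of x] by (metis imageI)
    qed
    moreover have "compact ((*v) ?A ` cbox 0 (\<chi> i. 2))"
      by (intro compact_continuous_image matrix_vector_mult_linear_continuous_on compact_cbox)
    ultimately show ?thesis
      by (meson bounded_subset compact_closure compact_imp_bounded)
  qed
  have fourier: "fourier_transform (\<lambda>x. complex_of_real (?f x)) \<omega> =
      complex_of_real \<bar>det ?A\<bar> * (\<Prod>k\<in>UNIV. box_factor (extended_directions \<xi> k \<bullet> \<omega>))" for \<omega>
  proof -
    have "fourier_transform (\<lambda>x. complex_of_real (?f x)) \<omega> =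
        \<bar>det ?A\<bar> *\<^sub>R (LINT y|lborel. complex_of_real (?f (?A *v y)) * exp (- \<i> * complex_of_real (\<omega> \<bullet> (?A *v y))))"
      unfolding fourier_transform_def
      by (rule integral_matrix_image[OF det borel_measurable_fourier_integrand[OF cont]])
    also have "\<dots> = complex_of_real \<bar>det ?A\<bar> *
        ((\<Prod>k\<in>UNIV. box_factor (\<xi> k \<bullet> \<omega>)) * box_factor (\<Sum>k\<in>UNIV. \<xi> k \<bullet> \<omega>))"
      unfolding matrix_inv_mult_vector(1)[OF det] inner_column_matrix integral_kuhn_hat_exp
      by (simp add: scaleR_conv_of_real)
    also have "\<dots> = complex_of_real \<bar>det ?A\<bar> * (\<Prod>k\<in>UNIV. box_factor (extended_directions \<xi> k \<bullet> \<omega>))"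
      by (simp add: prod_UNIV_option inner_sum_left)
    finally show ?thesis .
  qed
  show ?thesis
    unfolding linear_box_spline_def
  proof (rule the_equality)
    fix g assume g: "continuous_on UNIV g \<and> compact (closure {x. g x \<noteq> 0}) \<and>
     (\<forall>\<omega>. fourier_transform (\<lambda>x. complex_of_real (g x)) \<omega> =
        complex_of_real \<bar>det ?A\<bar> * (\<Prod>k\<in>UNIV. box_factor (extended_directions \<xi> k \<bullet> \<omega>)))"
    show "g = ?f"
      by (rule fourier_transform_inject) (use g cont comp fourier in auto)
  qed (use cont comp fourier in auto)
qed

section \<open>Autocorrelation of the hat function\<close>

definition triangle :: "real \<Rightarrow> real" where
  "triangle u = max 0 (1 - \<bar>u\<bar>)"

lemma triangle_minus [simp]: "triangle (- u) = triangle u"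
  by (simp add: triangle_def)

lemma triangle_minus_commute: "triangle (a - b) = triangle (b - a)"
  by (simp add: triangle_def abs_minus_commute)

lemma triangle_bounds: "0 \<le> triangle u" "triangle u \<le> 1"
  by (auto simp: triangle_def)

lemma borel_measurable_triangle [measurable]: "triangle \<in> borel_measurable borel"
  unfolding triangle_def[abs_def] by measurable

lemma triangle_eq_0_iff: "triangle u = 0 \<longleftrightarrow> 1 \<le> \<bar>u\<bar>"
  by (auto simp: triangle_def max_def)

lemma integral_unit_ind_mult_shift:
  "(LINT y|lborel. unit_ind (y - a) * unit_ind (y - b)) = triangle (a - b)"
proof -
  have "unit_ind (y - a) * unit_ind (y - b) = indicat_real {max a b..min a b + 1} y" for y
    by (auto simp: indicator_def)
  then have "(LINT y|lborel. unit_ind (y - a) * unit_ind (y - b)) = measure lborel {max a b..min a b + 1}"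
    by simp
  also have "\<dots> = triangle (a - b)"
    by (cases "a \<le> b"; cases "\<bar>a - b\<bar> \<le> 1") (auto simp: triangle_def max_def min_def)
  finally show ?thesis .
qed

lemma integral_translate:
  fixes f :: "'a::euclidean_space \<Rightarrow> 'b::{banach,second_countable_topology}"
  assumes [measurable]: "f \<in> borel_measurable borel"
  shows "(LINT x|lborel. f x) = (LINT x|lborel. f (c + x))"
  by (subst lborel_distr_plus[symmetric, of c]) (simp add: integral_distr)

lemma integral_kuhn_hat_mult_prod_unit_ind:
  fixes v :: "real^'n"
  shows "(LINT y|lborel. (\<Prod>i\<in>UNIV. unit_ind (y $ i + v $ i - t)) * kuhn_hat y) =
    (LINT s|lborel. unit_ind s * (\<Prod>i\<in>UNIV. triangle (t - s - v $ i)))"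
proof -
  have inner: "(LINT y|lborel. (\<Prod>i\<in>UNIV. unit_ind (y $ i - s)) *\<^sub>R (\<Prod>i\<in>UNIV. unit_ind (y $ i + v $ i - t))) =
      (\<Prod>i\<in>UNIV. triangle (t - s - v $ i))" for s
  proof -
    have "(LINT y|lborel. (\<Prod>i\<in>UNIV. unit_ind (y $ i - s)) *\<^sub>R (\<Prod>i\<in>UNIV. unit_ind (y $ i + v $ i - t))) =
        (LINT y|lborel. (\<Prod>i\<in>UNIV. unit_ind (y $ i - s) * unit_ind (y $ i - (t - v $ i))))"
      by (simp add: prod.distrib algebra_simps)
    also have "\<dots> = (\<Prod>i\<in>UNIV. (LINT y|lborel. unit_ind (y - s) * unit_ind (y - (t - v $ i))))"
      by (intro integral_prod_cart integrable_bounded_support[where C=1 and a=s and b="s+1"])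
         (auto simp: indicator_def split: if_splits)
    also have "\<dots> = (\<Prod>i\<in>UNIV. triangle (t - s - v $ i))"
      unfolding integral_unit_ind_mult_shift
      by (subst triangle_minus_commute) (simp add: algebra_simps)
    finally show ?thesis .
  qed
  have "(LINT y|lborel. (\<Prod>i\<in>UNIV. unit_ind (y $ i + v $ i - t)) * kuhn_hat y) =
      (LINT y|lborel. kuhn_hat y *\<^sub>R (\<Prod>i\<in>UNIV. unit_ind (y $ i + v $ i - t)))"
    by (simp add: mult.commute)
  also have "\<dots> = (LINT s|lborel. unit_ind s *\<^sub>R (LINT y|lborel.
      (\<Prod>i\<in>UNIV. unit_ind (y $ i - s)) *\<^sub>R (\<Prod>i\<in>UNIV. unit_ind (y $ i + v $ i - t))))"
    by (intro integral_kuhn_hat_scaleR[where C=1]) (auto simp: abs_prod intro!: prod_le_1)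
  also have "\<dots> = (LINT s|lborel. unit_ind s *\<^sub>R (\<Prod>i\<in>UNIV. triangle (t - s - v $ i)))"
    by (simp only: inner)
  finally show ?thesis by simp
qed

text \<open>
  The difference of two independent uniform variables on \<open>{0..1}\<close> has density \<open>triangle\<close>.
\<close>

lemma integral_unit_square_convolution:
  fixes F :: "real \<Rightarrow> real"
  assumes [measurable]: "F \<in> borel_measurable borel" and bound: "\<And>u. \<bar>F u\<bar> \<le> C"
  shows "(LINT t|lborel. unit_ind t * (LINT s|lborel. unit_ind s * F (t - s))) =
    (LINT u|lborel. triangle u * F u)"
proof -
  define g where "g t u = unit_ind t * unit_ind (t - u) * F u" for t u
  have meas: "case_prod g \<in> borel_measurable borel"
    unfolding g_def[abs_def] borel_prod[symmetric] by measurable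
  have "norm (case_prod g z) \<le> C" for z
  proof -
    have "norm (g t u) \<le> 1 * C" for t u
      unfolding g_def real_norm_def abs_mult
      by (intro mult_mono bound) (auto intro!: mult_le_one simp: indicator_def)
    then show ?thesis by (cases z) simp
  qed
  moreover have "z \<in> cbox (0, -1) (1, 1)" if "case_prod g z \<noteq> 0" for z
    using that by (cases z) (auto simp: g_def cbox_Pair_eq indicator_def split: if_splits)
  ultimately have int: "integrable (lborel \<Otimes>\<^sub>M lborel) (case_prod g)"
    unfolding lborel_prod using meas by (intro integrable_bounded_support)
  have inner: "(LINT t|lborel. g t u) = triangle u * F u" for u
  proof -
    have "(LINT t|lborel. g t u) = (LINT t|lborel. unit_ind (t - 0) * unit_ind (t - u)) * F u"
      unfolding g_def by (simp only: integral_mult_left_zero diff_zero)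
    then show ?thesis
      by (simp only: integral_unit_ind_mult_shift) simp
  qed
  have "unit_ind t * (LINT s|lborel. unit_ind s * F (t - s)) = (LINT u|lborel. g t u)" for t
  proof -
    have "(LINT s|lborel. unit_ind s * F (t - s)) = (LINT u|lborel. unit_ind (t - u) * F u)"
      by (subst lborel_integral_real_affine[where c="-1" and t=t]) simp_all
    then show ?thesis
      unfolding g_def mult.assoc by (simp only: integral_mult_right_zero)
  qed
  then have "(LINT t|lborel. unit_ind t * (LINT s|lborel. unit_ind s * F (t - s))) =
      (LINT t|lborel. (LINT u|lborel. g t u))"
    by simp
  also have "\<dots> = (LINT u|lborel. (LINT t|lborel. g t u))"
    by (rule lborel_pair.Fubini_integral[OF int, symmetric])
  also have "\<dots> = (LINT u|lborel. triangle u * F u)"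
    by (simp only: inner)
  finally show ?thesis .
qed

text \<open>
  Both factors are averages of unit cubes moved along the diagonal, by \<open>t\<close> and by \<open>s\<close>. The overlap of
  the two cubes is a product over the coordinates that depends only on \<open>u = t - s\<close>, so a
  \<open>d\<close>-dimensional integral becomes a one-dimensional one.
\<close>

lemma integral_kuhn_hat_mult_shift:
  fixes v :: "real^'n"
  shows "(LINT x|lborel. kuhn_hat x * kuhn_hat (x - v)) =
    (LINT u|lborel. triangle u * (\<Prod>i\<in>UNIV. triangle (u - v $ i)))"
proof -
  have inner: "(LINT x|lborel. (\<Prod>i\<in>UNIV. unit_ind (x $ i - t)) *\<^sub>R kuhn_hat (x - v)) =
      (LINT s|lborel. unit_ind s * (\<Prod>i\<in>UNIV. triangle (t - s - v $ i)))" for t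
  proof -
    have "(LINT x|lborel. (\<Prod>i\<in>UNIV. unit_ind (x $ i - t)) *\<^sub>R kuhn_hat (x - v)) =
        (LINT y|lborel. (\<Prod>i\<in>UNIV. unit_ind ((v + y) $ i - t)) *\<^sub>R kuhn_hat ((v + y) - v))"
      by (rule integral_translate) measurable
    also have "\<dots> = (LINT y|lborel. (\<Prod>i\<in>UNIV. unit_ind (y $ i + v $ i - t)) * kuhn_hat y)"
      by (simp add: add.commute)
    finally show ?thesis by (simp only: integral_kuhn_hat_mult_prod_unit_ind)
  qed
  have "(LINT x|lborel. kuhn_hat x * kuhn_hat (x - v)) = (LINT x|lborel. kuhn_hat x *\<^sub>R kuhn_hat (x - v))"
    by simp
  also have "\<dots> = (LINT t|lborel. unit_ind t *\<^sub>R
      (LINT x|lborel. (\<Prod>i\<in>UNIV. unit_ind (x $ i - t)) *\<^sub>R kuhn_hat (x - v)))"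
    by (rule integral_kuhn_hat_scaleR[where C=1]) (auto simp: kuhn_hat_bounds)
  also have "\<dots> = (LINT t|lborel. unit_ind t *\<^sub>R
      (LINT s|lborel. unit_ind s * (\<Prod>i\<in>UNIV. triangle (t - s - v $ i))))"
    by (simp only: inner)
  also have "\<dots> = (LINT u|lborel. triangle u * (\<Prod>i\<in>UNIV. triangle (u - v $ i)))"
    unfolding real_scaleR_def
    by (rule integral_unit_square_convolution[where C=1])
       (auto simp: abs_prod triangle_bounds intro!: prod_le_1)
  finally show ?thesis .
qed

lemma integral_unit_ind_Beta:
  "(LINT u|lborel. unit_ind u * (u ^ a * (1 - u) ^ b)) = fact a * fact b / fact (a + b + 1)"
proof -
  have "((\<lambda>u. u powr (real (a + 1) - 1) * (1 - u) powr (real (b + 1) - 1)) has_integral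
      Beta (real (a + 1)) (real (b + 1))) {0..1}"
    by (rule has_integral_Beta_real) auto
  then have "((\<lambda>u. u ^ a * (1 - u) ^ b) has_integral Beta (real (a + 1)) (real (b + 1))) {0..1::real}"
    by (rule has_integral_spike_finite[where S="{0,1}", rotated 2])
       (auto simp: powr_realpow)
  moreover have "((\<lambda>u. u ^ a * (1 - u) ^ b) has_integral
      (LINT u|lborel. unit_ind u * (u ^ a * (1 - u) ^ b))) {0..1::real}"
  proof -
    have int: "integrable lborel (\<lambda>u::real. indicator {0..1} u *\<^sub>R (u ^ a * (1 - u) ^ b))"
      by (intro borel_integrable_compact) (auto intro!: continuous_intros)
    have "set_integrable lborel {0..1} (\<lambda>u::real. u ^ a * (1 - u) ^ b)"
      using int by (simp add: set_integrable_def)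
    from set_borel_integral_eq_integral[OF this] show ?thesis
      by (simp add: set_lebesgue_integral_def has_integral_iff)
  qed
  ultimately have "(LINT u|lborel. unit_ind u * (u ^ a * (1 - u) ^ b)) = Beta (real (a + 1)) (real (b + 1))"
    using has_integral_unique by blast
  also have "\<dots> = fact a * fact b / fact (a + b + 1)"
    using Gamma_fact[of a, where 'a=real] Gamma_fact[of b, where 'a=real]
      Gamma_fact[of "a + b + 1", where 'a=real]
    by (simp add: Beta_def algebra_simps)
  finally show ?thesis .
qed

lemma integral_triangle_power: "(LINT u|lborel. triangle u ^ n) = 2 / (real n + 1)" if "n > 0"
proof -
  let ?g = "\<lambda>u. unit_ind u * (u ^ 0 * (1 - u) ^ n)"
  have g: "(LINT u|lborel. ?g u) = 1 / (real n + 1)"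
  proof -
    have "(fact (n + 1) :: real) = (real n + 1) * fact n" by simp
    then show ?thesis unfolding integral_unit_ind_Beta by simp
  qed
  have int: "integrable lborel ?g"
    by (rule integrable_bounded_support[where C=1 and a=0 and b=1])
       (auto simp: indicator_def abs_mult power_abs intro!: power_le_one split: if_splits)
  have int': "integrable lborel (\<lambda>u. ?g (0 + (-1) * u))"
    by (rule lborel_integrable_real_affine[OF int]) simp
  have "(LINT u|lborel. triangle u ^ n) = (LINT u|lborel. ?g u + ?g (0 + (-1) * u))"
  proof (rule integral_cong_AE)
    show "AE u in lborel. triangle u ^ n = ?g u + ?g (0 + (-1) * u)"
      using AE_lborel_singleton[of "0::real"]
    proof eventually_elim
      case (elim u)
      then show ?case
        using that by (auto simp: triangle_def indicator_def max_def abs_if zero_power)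
    qed
  qed measurable
  also have "\<dots> = (LINT u|lborel. ?g u) + (LINT u|lborel. ?g (0 + (-1) * u))"
    by (rule Bochner_Integration.integral_add[OF int int'])
  also have "(LINT u|lborel. ?g (0 + (-1) * u)) = (LINT u|lborel. ?g u)"
    using lborel_integral_real_affine[of "-1" ?g 0] by simp
  finally show ?thesis unfolding g by (simp add: field_simps)
qed

definition vec_of_int :: "int^'n \<Rightarrow> real^'n" where
  "vec_of_int k = (\<chi> i. real_of_int (k $ i))"

lemma vec_of_int_nth [simp]: "vec_of_int k $ i = real_of_int (k $ i)"
  by (simp add: vec_of_int_def)

lemma vec_of_int_simps:
  "vec_of_int (k - l) = vec_of_int k - vec_of_int l" "vec_of_int (- k) = - vec_of_int k"
  by (simp_all add: vec_eq_iff)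

definition indicator_vec :: "'n set \<Rightarrow> int^'n" where
  "indicator_vec J = (\<chi> i. if i \<in> J then 1 else 0)"

lemma indicator_vec_nth [simp]: "indicator_vec J $ i = (if i \<in> J then 1 else 0)"
  by (simp add: indicator_vec_def)

definition kuhn_autocorrelation :: "int^'n \<Rightarrow> real" where
  "kuhn_autocorrelation m = (LINT x|lborel. kuhn_hat x * kuhn_hat (x - vec_of_int m))"

lemma kuhn_autocorrelation_shift:
  "(LINT x|lborel. kuhn_hat (x - vec_of_int k) * kuhn_hat (x - vec_of_int l)) =
    kuhn_autocorrelation (l - k)"
  unfolding kuhn_autocorrelation_def
  by (subst integral_translate[where c="vec_of_int k"]) (auto simp: vec_of_int_simps algebra_simps)

lemma kuhn_autocorrelation_minus: "kuhn_autocorrelation (- m) = kuhn_autocorrelation m"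
  using kuhn_autocorrelation_shift[of 0 m] kuhn_autocorrelation_shift[of m 0]
  by (simp add: mult.commute)

lemma kuhn_autocorrelation_eq_integral:
  "kuhn_autocorrelation m = (LINT u|lborel. triangle u * (\<Prod>i\<in>UNIV. triangle (u - real_of_int (m $ i))))"
  unfolding kuhn_autocorrelation_def integral_kuhn_hat_mult_shift by simp

lemma kuhn_autocorrelation_0:
  "kuhn_autocorrelation (0 :: int^'n) = 2 / (real CARD('n) + 2)"
proof -
  have "kuhn_autocorrelation (0 :: int^'n) = (LINT u|lborel. triangle u ^ (CARD('n) + 1))"
    by (simp add: kuhn_autocorrelation_eq_integral)
  also have "\<dots> = 2 / (real CARD('n) + 2)"
    by (subst integral_triangle_power) auto
  finally show ?thesis .
qed

text \<open>
  A coordinate with shift 1 forces \<open>u \<ge> 0\<close>, after which the integrand is \<open>u ^ j * (1 - u) ^ (d + 1 - j)\<close>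
  on the unit interval, where \<open>j = card J\<close>, and the integral is a value of the Beta function.
\<close>

lemma kuhn_autocorrelation_indicator_vec:
  fixes J :: "'n::finite set"
  assumes "J \<noteq> {}"
  shows "(real CARD('n) + 2) * kuhn_autocorrelation (indicator_vec J) =
    1 / real ((CARD('n) + 1) choose card J)"
proof -
  let ?d = "CARD('n)" and ?j = "card J"
  have j: "?j \<le> ?d" by (rule card_mono) auto
  have integrand: "triangle u * (\<Prod>i\<in>UNIV. triangle (u - real_of_int (indicator_vec J $ i))) =
      unit_ind u * (u ^ ?j * (1 - u) ^ (?d + 1 - ?j))" for u
  proof -
    have "(\<Prod>i\<in>UNIV. triangle (u - real_of_int (indicator_vec J $ i))) =
        (\<Prod>i\<in>J. triangle (u - real_of_int (indicator_vec J $ i))) *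
        (\<Prod>i\<in>-J. triangle (u - real_of_int (indicator_vec J $ i)))"
      by (subst prod.union_disjoint[symmetric]) (auto simp: Compl_partition)
    also have "\<dots> = triangle (u - 1) ^ ?j * triangle u ^ (?d - ?j)"
      by (simp add: Compl_eq_Diff_UNIV card_Diff_subset)
    finally have eq: "triangle u * (\<Prod>i\<in>UNIV. triangle (u - real_of_int (indicator_vec J $ i))) =
        triangle (u - 1) ^ ?j * triangle u ^ (?d + 1 - ?j)"
      using j by (simp add: Suc_diff_le mult_ac)
    show ?thesis
    proof (cases "0 \<le> u \<and> u \<le> 1")
      case True
      then show ?thesis unfolding eq by (simp add: triangle_def)
    next
      case False
      then have "triangle (u - 1) = 0 \<or> triangle u = 0" by (auto simp: triangle_eq_0_iff)
      moreover have "?j > 0" using assms by (simp add: card_gt_0_iff)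
      ultimately show ?thesis unfolding eq using False j by (auto simp: zero_power)
    qed
  qed
  have "kuhn_autocorrelation (indicator_vec J) = fact ?j * fact (?d + 1 - ?j) / fact (?d + 2)"
    unfolding kuhn_autocorrelation_eq_integral integrand integral_unit_ind_Beta using j by simp
  moreover have "real ((?d + 1) choose ?j) = fact (?d + 1) / (fact ?j * fact (?d + 1 - ?j))"
    using j by (intro binomial_fact) simp
  moreover have "(fact (?d + 2) :: real) = (real ?d + 2) * fact (?d + 1)"
    by simp
  moreover have "real ?d + 2 \<noteq> 0" by simp
  ultimately show ?thesis by (simp only: times_divide_eq_right mult_divide_mult_cancel_left_if divide_divide_eq_right) simp
qed

text \<open>
  For \<open>0 \<le> u < 1\<close> the integrand is nonzero only if all shifts are 0 or 1, and for \<open>- 1 < u < 0\<close> only if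
  all are 0 or -1.
\<close>

lemma kuhn_autocorrelation_eq_0:
  assumes "\<And>J. m \<noteq> indicator_vec J" "\<And>J. m \<noteq> - indicator_vec J"
  shows "kuhn_autocorrelation m = 0"
proof -
  have "triangle u * (\<Prod>i\<in>UNIV. triangle (u - real_of_int (m $ i))) = 0" for u
  proof (rule ccontr)
    assume "triangle u * (\<Prod>i\<in>UNIV. triangle (u - real_of_int (m $ i))) \<noteq> 0"
    then have u: "\<bar>u\<bar> < 1" and "\<bar>u - real_of_int (m $ i)\<bar> < 1" for i
      by (auto simp: triangle_eq_0_iff not_le)
    then have m: "u - 1 < real_of_int (m $ i)" "real_of_int (m $ i) < u + 1" for i
      by (auto simp: abs_less_iff algebra_simps)
    show False
    proof (cases "u \<ge> 0")
      case True
      have "m $ i = 0 \<or> m $ i = 1" for i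
      proof -
        have "real_of_int (m $ i) > -1" "real_of_int (m $ i) < 2" using m[of i] u True by auto
        then show ?thesis by linarith
      qed
      then have "m = indicator_vec {i. m $ i = 1}" by (auto simp: vec_eq_iff)
      with assms show False by blast
    next
      case False
      have "m $ i = 0 \<or> m $ i = -1" for i
      proof -
        have "real_of_int (m $ i) > -2" "real_of_int (m $ i) < 1" using m[of i] u False by auto
        then show ?thesis by linarith
      qed
      then have "m = - indicator_vec {i. m $ i = -1}" by (auto simp: vec_eq_iff)
      with assms show False by blast
    qed
  qed
  then show ?thesis by (simp only: kuhn_autocorrelation_eq_integral) simp
qed

section \<open>Vertex pairs of Kuhn simplices\<close>

definition kuhn_orders :: "('n::finite \<Rightarrow> nat) set" where
  "kuhn_orders = {\<pi>. bij_betw \<pi> UNIV {..<CARD('n)}}"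

text \<open>
  A bijection \<open>\<pi>\<close> tells at which step of a monotone lattice path from 0 to \<open>(1,\<dots>,1)\<close> each coordinate is
  raised. The \<open>d + 1\<close> points of the path are the vertices of a Kuhn simplex.
\<close>

definition kuhn_chain :: "('n::finite \<Rightarrow> nat) \<Rightarrow> nat \<Rightarrow> int^'n" where
  "kuhn_chain \<pi> i = indicator_vec {a. \<pi> a < i}"

lemma finite_kuhn_orders: "finite (kuhn_orders :: ('n::finite \<Rightarrow> nat) set)"
proof (rule finite_subset)
  show "kuhn_orders \<subseteq> (UNIV :: 'n set) \<rightarrow>\<^sub>E {..<CARD('n)}"
    by (auto simp: kuhn_orders_def bij_betw_def PiE_def)
qed (auto intro: finite_PiE)

lemma card_kuhn_orders_pos: "card (kuhn_orders :: ('n::finite \<Rightarrow> nat) set) > 0"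
proof -
  have "\<exists>h. bij_betw h (UNIV :: 'n set) {0..<CARD('n)}"
    by (rule ex_bij_betw_finite_nat) simp
  then have "(kuhn_orders :: ('n \<Rightarrow> nat) set) \<noteq> {}"
    by (auto simp: kuhn_orders_def atLeast0LessThan)
  then show ?thesis by (simp add: card_gt_0_iff finite_kuhn_orders)
qed

lemma kuhn_ordersD:
  assumes "\<pi> \<in> (kuhn_orders :: ('n::finite \<Rightarrow> nat) set)"
  shows "inj \<pi>" "\<pi> a < CARD('n)" "j < CARD('n) \<Longrightarrow> \<exists>a. \<pi> a = j"
proof -
  have \<pi>: "inj \<pi>" "range \<pi> = {..<CARD('n)}"
    using assms by (auto simp: kuhn_orders_def bij_betw_def)
  then show "inj \<pi>" "\<pi> a < CARD('n)" by auto
  assume "j < CARD('n)"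
  then have "j \<in> range \<pi>" using \<pi> by simp
  then show "\<exists>a. \<pi> a = j" by auto
qed

lemma kuhn_chain_diff:
  assumes "i \<le> i'"
  shows "kuhn_chain \<pi> i' - kuhn_chain \<pi> i = indicator_vec {a. i \<le> \<pi> a \<and> \<pi> a < i'}"
  using assms by (auto simp: kuhn_chain_def vec_eq_iff)

lemma card_orders_image_swap:
  fixes J J' :: "'n::finite set"
  assumes "card J = card J'"
  shows "card {\<pi> \<in> kuhn_orders. \<pi> ` J = I} = card {\<pi> \<in> kuhn_orders. \<pi> ` J' = I}"
proof -
  obtain f where f: "bij_betw f J' J"
    using finite_same_card_bij[of J' J] assms by auto
  have "card (- J') = card (- J)"
    using assms by (simp add: Compl_eq_Diff_UNIV card_Diff_subset)
  then obtain g where g: "bij_betw g (- J') (- J)"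
    using finite_same_card_bij[of "- J'" "- J"] by auto
  define \<sigma> where "\<sigma> a = (if a \<in> J' then f a else g a)" for a
  have "bij_betw \<sigma> J' J" "bij_betw \<sigma> (- J') (- J)"
    by (rule bij_betw_cong[THEN iffD1, OF _ f], simp add: \<sigma>_def)
       (rule bij_betw_cong[THEN iffD1, OF _ g], simp add: \<sigma>_def)
  then have \<sigma>: "bij \<sigma>" "\<sigma> ` J' = J"
    using bij_betw_combine[of \<sigma> J' J "- J'" "- J"] by (auto simp: Compl_partition bij_betw_def)
  have "bij_betw (\<lambda>\<pi>. \<pi> \<circ> \<sigma>) {\<pi> \<in> kuhn_orders. \<pi> ` J = I} {\<pi> \<in> kuhn_orders. \<pi> ` J' = I}"
  proof (rule bij_betw_byWitness[where f'="\<lambda>\<pi>. \<pi> \<circ> inv \<sigma>"])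
    have "J' = inv \<sigma> ` J" using \<sigma> by (metis bij_is_inj image_inv_f_f)
    then have J: "\<pi> ` J' = \<pi> ` inv \<sigma> ` J" for \<pi> :: "'n \<Rightarrow> nat" by simp
    show "(\<lambda>\<pi>. \<pi> \<circ> \<sigma>) ` {\<pi> \<in> kuhn_orders. \<pi> ` J = I} \<subseteq> {\<pi> \<in> kuhn_orders. \<pi> ` J' = I}"
      using \<sigma> by (auto simp: kuhn_orders_def image_comp[symmetric] intro: bij_betw_trans)
    show "(\<lambda>\<pi>. \<pi> \<circ> inv \<sigma>) ` {\<pi> \<in> kuhn_orders. \<pi> ` J' = I} \<subseteq> {\<pi> \<in> kuhn_orders. \<pi> ` J = I}"
      using bij_imp_bij_inv[OF \<sigma>(1)]
      by (auto simp: kuhn_orders_def J image_comp[symmetric] intro: bij_betw_trans)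
  qed (use \<sigma>(1) in \<open>auto simp: o_assoc[symmetric] bij_is_inj bij_is_surj surj_iff[symmetric] inj_iff[symmetric] fun_eq_iff surj_f_inv_f\<close>)
  then show ?thesis by (rule bij_betw_same_card)
qed

text \<open>
  By symmetry under permutations of the coordinates, the number of orders that send \<open>J'\<close> onto \<open>I\<close> is the
  same for all \<open>J'\<close> of the size of \<open>I\<close>, and each order sends exactly one such set onto \<open>I\<close>.
\<close>

lemma card_orders_image:
  fixes J :: "'n::finite set"
  assumes I: "I \<subseteq> {..<CARD('n)}" "card I = card J"
  shows "(CARD('n) choose card J) * card {\<pi> \<in> kuhn_orders. \<pi> ` J = I} =
    card (kuhn_orders :: ('n \<Rightarrow> nat) set)"
proof -
  let ?S = "{J' :: 'n set. card J' = card J}"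
  have "kuhn_orders = (\<Union>J'\<in>?S. {\<pi> \<in> kuhn_orders. \<pi> ` J' = I})"
  proof (intro equalityI subsetI)
    fix \<pi> :: "'n \<Rightarrow> nat" assume \<pi>: "\<pi> \<in> kuhn_orders"
    then have "bij_betw \<pi> UNIV {..<CARD('n)}" by (simp add: kuhn_orders_def)
    then have inj: "inj \<pi>" and im: "\<pi> ` (\<pi> -` I) = I"
      using I by (auto simp: bij_betw_def image_vimage_eq)
    then have "card (\<pi> -` I) = card J"
      using card_image[OF inj_on_subset[OF inj subset_UNIV], of "\<pi> -` I"] I(2) by simp
    with im \<pi> show "\<pi> \<in> (\<Union>J'\<in>?S. {\<pi> \<in> kuhn_orders. \<pi> ` J' = I})" by blast
  qed auto
  then have "card (kuhn_orders :: ('n \<Rightarrow> nat) set) =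
      card (\<Union>J'\<in>?S. {\<pi> \<in> (kuhn_orders :: ('n \<Rightarrow> nat) set). \<pi> ` J' = I})"
    by (rule arg_cong)
  also have "\<dots> = (\<Sum>J'\<in>?S. card {\<pi> \<in> (kuhn_orders :: ('n \<Rightarrow> nat) set). \<pi> ` J' = I})"
  proof (rule card_UN_disjoint)
    show "\<forall>J'\<in>?S. \<forall>J''\<in>?S. J' \<noteq> J'' \<longrightarrow>
        {\<pi> \<in> (kuhn_orders :: ('n \<Rightarrow> nat) set). \<pi> ` J' = I} \<inter> {\<pi> \<in> kuhn_orders. \<pi> ` J'' = I} = {}"
    proof (intro ballI impI equals0I)
      fix J' J'' :: "'n set" and \<pi>
      assume "J' \<noteq> J''"
        "\<pi> \<in> {\<pi> \<in> kuhn_orders. \<pi> ` J' = I} \<inter> {\<pi> \<in> kuhn_orders. \<pi> ` J'' = I}"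
      then have "\<pi> \<in> kuhn_orders" "\<pi> ` J' = \<pi> ` J''" by auto
      then show False
        using inj_image_eq_iff[OF kuhn_ordersD(1)] \<open>J' \<noteq> J''\<close> by blast
    qed
  qed (auto intro: finite_subset[OF _ finite_kuhn_orders])
  also have "\<dots> = (\<Sum>J'\<in>?S. card {\<pi> \<in> (kuhn_orders :: ('n \<Rightarrow> nat) set). \<pi> ` J = I})"
    by (intro sum.cong refl card_orders_image_swap) auto
  also have "\<dots> = (CARD('n) choose card J) * card {\<pi> \<in> kuhn_orders. \<pi> ` J = I}"
    using n_subsets[of "UNIV :: 'n set" "card J"] by simp
  finally show ?thesis by simp
qed

definition chain_pairs :: "('n::finite \<Rightarrow> nat) \<Rightarrow> int^'n \<Rightarrow> (nat \<times> nat) set" where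
  "chain_pairs \<pi> m = {(i, i'). i \<le> CARD('n) \<and> i' \<le> CARD('n) \<and> kuhn_chain \<pi> i' - kuhn_chain \<pi> i = m}"

lemma finite_chain_pairs [simp]: "finite (chain_pairs (\<pi> :: 'n::finite \<Rightarrow> nat) m)"
  by (rule finite_subset[of _ "{..CARD('n)} \<times> {..CARD('n)}"]) (auto simp: chain_pairs_def)

lemma kuhn_chain_inj:
  fixes \<pi> :: "'n::finite \<Rightarrow> nat"
  assumes \<pi>: "\<pi> \<in> kuhn_orders" and "i \<le> CARD('n)" "i' \<le> CARD('n)"
    and eq: "kuhn_chain \<pi> i = kuhn_chain \<pi> i'"
  shows "i = i'"
proof -
  have "\<not> i < i'" if le: "i' \<le> CARD('n)" and "kuhn_chain \<pi> i = kuhn_chain \<pi> i'" for i i'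
  proof
    assume "i < i'"
    then obtain a where a: "\<pi> a = i" using kuhn_ordersD(3)[OF \<pi>, of i] le by auto
    have "kuhn_chain \<pi> i $ a = kuhn_chain \<pi> i' $ a" using that by simp
    then show False using a \<open>i < i'\<close> by (simp add: kuhn_chain_def)
  qed
  from this[of i' i] this[of i i'] show ?thesis using assms by auto
qed

lemma card_chain_pairs_0:
  fixes \<pi> :: "'n::finite \<Rightarrow> nat"
  assumes "\<pi> \<in> kuhn_orders"
  shows "card (chain_pairs \<pi> 0) = CARD('n) + 1"
proof -
  have "chain_pairs \<pi> 0 = (\<lambda>i. (i, i)) ` {..CARD('n)}"
    using kuhn_chain_inj[OF assms] by (auto simp: chain_pairs_def)
  then show ?thesis by (simp add: card_image inj_on_def)
qed

lemma card_chain_pairs_minus: "card (chain_pairs \<pi> (- m)) = card (chain_pairs \<pi> m)"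
proof -
  have "chain_pairs \<pi> (- m) = prod.swap ` chain_pairs \<pi> m"
    by (force simp: chain_pairs_def image_iff algebra_simps)
  then show ?thesis by (simp add: card_image)
qed

text \<open>
  A difference of two vertices of the path is \<open>indicator_vec J\<close> exactly if \<open>J\<close> is raised in consecutive
  steps, starting at the earlier vertex.
\<close>

lemma chain_pairs_indicator_vec:
  fixes \<pi> :: "'n::finite \<Rightarrow> nat"
  assumes \<pi>: "\<pi> \<in> kuhn_orders" and "J \<noteq> {}"
  shows "chain_pairs \<pi> (indicator_vec J) =
    (\<lambda>i. (i, i + card J)) ` {i. i \<le> CARD('n) - card J \<and> \<pi> ` J = {i..<i + card J}}"
proof (intro equalityI subsetI)
  fix z assume "z \<in> chain_pairs \<pi> (indicator_vec J)"
  then obtain i i' where z: "z = (i, i')" and le: "i \<le> CARD('n)" "i' \<le> CARD('n)"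
    and diff: "kuhn_chain \<pi> i' - kuhn_chain \<pi> i = indicator_vec J"
    by (auto simp: chain_pairs_def)
  have "i \<le> i'"
  proof (rule ccontr)
    assume "\<not> i \<le> i'"
    then have "kuhn_chain \<pi> i - kuhn_chain \<pi> i' = indicator_vec {a. i' \<le> \<pi> a \<and> \<pi> a < i}"
      by (intro kuhn_chain_diff) simp
    with diff have "indicator_vec J = - indicator_vec {a. i' \<le> \<pi> a \<and> \<pi> a < i}"
      by (metis minus_diff_eq)
    moreover obtain a where "a \<in> J" using \<open>J \<noteq> {}\<close> by auto
    ultimately have "(1::int) = - indicator_vec {a. i' \<le> \<pi> a \<and> \<pi> a < i} $ a"
      by (metis indicator_vec_nth vector_uminus_component)
    then show False by (auto split: if_splits)
  qed
  then have ind: "indicator_vec J = indicator_vec {a. i \<le> \<pi> a \<and> \<pi> a < i'}"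
    using diff kuhn_chain_diff by metis
  have J: "J = {a. i \<le> \<pi> a \<and> \<pi> a < i'}"
  proof (rule set_eqI)
    fix a
    have "indicator_vec J $ a = indicator_vec {a. i \<le> \<pi> a \<and> \<pi> a < i'} $ a" using ind by simp
    then show "a \<in> J \<longleftrightarrow> a \<in> {a. i \<le> \<pi> a \<and> \<pi> a < i'}" by (auto split: if_splits)
  qed
  have im: "\<pi> ` J = {i..<i'}"
  proof (intro equalityI subsetI)
    fix j assume "j \<in> {i..<i'}"
    moreover then obtain a where "\<pi> a = j" using kuhn_ordersD(3)[OF \<pi>, of j] le by auto
    ultimately show "j \<in> \<pi> ` J" by (auto simp: J)
  qed (auto simp: J)
  then have "card J = i' - i"
    using card_image[OF inj_on_subset[OF kuhn_ordersD(1)[OF \<pi>] subset_UNIV], of J] by simp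
  then have "i' = i + card J" using \<open>i \<le> i'\<close> by simp
  then show "z \<in> (\<lambda>i. (i, i + card J)) ` {i. i \<le> CARD('n) - card J \<and> \<pi> ` J = {i..<i + card J}}"
    using z im le by auto
next
  fix z assume "z \<in> (\<lambda>i. (i, i + card J)) ` {i. i \<le> CARD('n) - card J \<and> \<pi> ` J = {i..<i + card J}}"
  then obtain i where z: "z = (i, i + card J)" "i \<le> CARD('n) - card J" "\<pi> ` J = {i..<i + card J}"
    by auto
  have "card J \<le> CARD('n)" by (rule card_mono) auto
  have "J = {a. i \<le> \<pi> a \<and> \<pi> a < i + card J}"
  proof -
    have "J = \<pi> -` (\<pi> ` J)"
      using kuhn_ordersD(1)[OF \<pi>] by (rule inj_vimage_image_eq[symmetric])
    then show ?thesis unfolding z(3) by auto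
  qed
  then have "kuhn_chain \<pi> (i + card J) - kuhn_chain \<pi> i = indicator_vec J"
    using kuhn_chain_diff[of i "i + card J" \<pi>] by simp
  then show "z \<in> chain_pairs \<pi> (indicator_vec J)"
    using z \<open>card J \<le> CARD('n)\<close> by (auto simp: chain_pairs_def)
qed

lemma sum_card_chain_pairs_indicator_vec:
  fixes J :: "'n::finite set"
  assumes "J \<noteq> {}"
  shows "(CARD('n) choose card J) * (\<Sum>\<pi>\<in>kuhn_orders. card (chain_pairs \<pi> (indicator_vec J))) =
    (CARD('n) + 1 - card J) * card (kuhn_orders :: ('n \<Rightarrow> nat) set)"
proof -
  let ?d = "CARD('n)" and ?j = "card J" and ?O = "kuhn_orders :: ('n \<Rightarrow> nat) set"
  have j: "?j \<le> ?d" by (rule card_mono) auto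
  have "(\<Sum>\<pi>\<in>?O. card (chain_pairs \<pi> (indicator_vec J))) =
      (\<Sum>\<pi>\<in>?O. card {i \<in> {..?d - ?j}. \<pi> ` J = {i..<i + ?j}})"
    by (intro sum.cong refl) (simp add: chain_pairs_indicator_vec assms card_image inj_on_def)
  also have "\<dots> = (\<Sum>i\<le>?d - ?j. card {\<pi> \<in> ?O. \<pi> ` J = {i..<i + ?j}})"
    by (rule sum_multicount_gen) (auto simp: finite_kuhn_orders)
  finally have "(?d choose ?j) * (\<Sum>\<pi>\<in>?O. card (chain_pairs \<pi> (indicator_vec J))) =
      (\<Sum>i\<le>?d - ?j. (?d choose ?j) * card {\<pi> \<in> ?O. \<pi> ` J = {i..<i + ?j}})"
    by (simp add: sum_distrib_left)
  also have "\<dots> = (\<Sum>i\<le>?d - ?j. card ?O)"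
    using j by (intro sum.cong refl card_orders_image) auto
  also have "\<dots> = (?d + 1 - ?j) * card ?O" using j by (simp add: Suc_diff_le)
  finally show ?thesis .
qed

lemma chain_pairs_empty:
  assumes "\<And>J. m \<noteq> indicator_vec J" "\<And>J. m \<noteq> - indicator_vec J"
  shows "chain_pairs \<pi> m = {}"
proof -
  have "kuhn_chain \<pi> i' - kuhn_chain \<pi> i \<noteq> m" for i i'
  proof (cases "i \<le> i'")
    case True
    then show ?thesis using kuhn_chain_diff assms(1) by metis
  next
    case False
    then show ?thesis using kuhn_chain_diff[of i' i \<pi>] assms(2) by (metis minus_diff_eq nat_le_linear)
  qed
  then show ?thesis by (auto simp: chain_pairs_def)
qed

text \<open>
  For \<open>m = indicator_vec J\<close> with \<open>j = card J > 0\<close>, a random order raises \<open>J\<close> in consecutive steps with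
  probability \<open>(d + 1 - j) / (d choose j)\<close>. Divided by \<open>d + 1\<close> this is \<open>1 / ((d + 1) choose j)\<close>, the same
  as the Beta integral. At \<open>m = 0\<close> the \<open>d + 1\<close> trivial pairs of each path contribute 1, and the term
  \<open>of_bool (m = 0)\<close> accounts for the other 1.
\<close>

lemma kuhn_autocorrelation_eq_chain_pairs:
  fixes m :: "int^'n"
  shows "(real CARD('n) + 2) * kuhn_autocorrelation m = of_bool (m = 0) +
    (\<Sum>\<pi>\<in>kuhn_orders. real (card (chain_pairs \<pi> m))) /
      ((real CARD('n) + 1) * real (card (kuhn_orders :: ('n \<Rightarrow> nat) set)))"
    (is "?L m = ?R m")
proof -
  let ?d = "CARD('n)" and ?O = "kuhn_orders :: ('n \<Rightarrow> nat) set"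
  have O: "real (card ?O) > 0" using card_kuhn_orders_pos by simp
  have ind: "?L (indicator_vec J) = ?R (indicator_vec J)" if "J \<noteq> {}" for J :: "'n set"
  proof -
    let ?j = "card J"
    have j: "?j \<le> ?d" by (rule card_mono) auto
    have nz: "indicator_vec J \<noteq> 0"
      using that by (auto simp: vec_eq_iff)
    have 1: "real (?d choose ?j) * (\<Sum>\<pi>\<in>?O. real (card (chain_pairs \<pi> (indicator_vec J)))) =
        real (?d + 1 - ?j) * real (card ?O)"
      using arg_cong[OF sum_card_chain_pairs_indicator_vec[OF that], of real] by simp
    have 2: "real (?d + 1 - ?j) * real ((?d + 1) choose ?j) = (real ?d + 1) * real (?d choose ?j)"
    proof -
      have "(?d + 1 - ?j) * ((?d + 1) choose ?j) = (?d + 1) * (?d choose ?j)"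
        using binomial_absorb_comp[of "?d + 1" ?j] by simp
      from arg_cong[OF this, of real] show ?thesis
        by (simp only: of_nat_mult of_nat_add of_nat_1)
    qed
    have pos: "real (?d choose ?j) > 0" "real ((?d + 1) choose ?j) > 0"
      using j by (auto simp: zero_less_binomial_iff)
    have "(\<Sum>\<pi>\<in>?O. real (card (chain_pairs \<pi> (indicator_vec J)))) / ((real ?d + 1) * real (card ?O)) =
        real (?d + 1 - ?j) / (real (?d choose ?j) * (real ?d + 1))"
    proof -
      let ?N = "\<Sum>\<pi>\<in>?O. real (card (chain_pairs \<pi> (indicator_vec J)))"
      have "?N / ((real ?d + 1) * real (card ?O)) =
          (real (?d choose ?j) * ?N) / (real (?d choose ?j) * ((real ?d + 1) * real (card ?O)))"
        using pos by (intro mult_divide_mult_cancel_left[symmetric]) simp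
      also have "\<dots> = (real (?d + 1 - ?j) * real (card ?O)) /
          ((real (?d choose ?j) * (real ?d + 1)) * real (card ?O))"
        by (simp only: 1 mult.assoc)
      also have "\<dots> = real (?d + 1 - ?j) / (real (?d choose ?j) * (real ?d + 1))"
        using O by (intro mult_divide_mult_cancel_right) simp
      finally show ?thesis .
    qed
    also have "\<dots> = 1 / real ((?d + 1) choose ?j)"
      using 2 pos by (simp add: divide_simps)
    finally show ?thesis
      unfolding kuhn_autocorrelation_indicator_vec[OF that] using nz by simp
  qed
  consider "m = 0" | J where "J \<noteq> {}" "m = indicator_vec J" | J where "J \<noteq> {}" "m = - indicator_vec J"
    | "\<And>J. m \<noteq> indicator_vec J" "\<And>J. m \<noteq> - indicator_vec J"
  proof -
    have "indicator_vec ({} :: 'n set) = 0" by (simp add: vec_eq_iff)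
    then show ?thesis using that by (metis neg_equal_zero minus_zero)
  qed
  then show ?thesis
  proof cases
    case 1
    have "(\<Sum>\<pi>\<in>?O. real (card (chain_pairs \<pi> 0))) = real (card ?O) * (real ?d + 1)"
      by (simp add: card_chain_pairs_0)
    moreover have "?L 0 = 2"
      using nonzero_mult_div_cancel_left[of "real ?d + 2" 2] by (simp add: kuhn_autocorrelation_0)
    ultimately show ?thesis using O by (simp add: 1)
  next
    case 2
    then show ?thesis using ind by simp
  next
    case 3
    then show ?thesis using ind[of J]
      by (simp add: kuhn_autocorrelation_minus card_chain_pairs_minus)
  next
    case 4
    have "m \<noteq> 0" using 4(1)[of "{}"] by (auto simp: vec_eq_iff)
    then show ?thesis using 4 by (simp add: kuhn_autocorrelation_eq_0 chain_pairs_empty)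
  qed
qed

section \<open>The energy of combinations of integer translates\<close>

lemma sum_swap_last:
  "(\<Sum>k\<in>A. \<Sum>l\<in>B. \<Sum>p\<in>C. g k l p) = (\<Sum>p\<in>C. \<Sum>k\<in>A. \<Sum>l\<in>B. g k l p)"
proof -
  have "(\<Sum>k\<in>A. \<Sum>l\<in>B. \<Sum>p\<in>C. g k l p) = (\<Sum>k\<in>A. \<Sum>p\<in>C. \<Sum>l\<in>B. g k l p)"
    by (intro sum.cong refl sum.swap)
  also have "\<dots> = (\<Sum>p\<in>C. \<Sum>k\<in>A. \<Sum>l\<in>B. g k l p)"
    by (rule sum.swap)
  finally show ?thesis .
qed

lemma cmod_sum_power2:
  fixes a :: "'k \<Rightarrow> real"
  shows "complex_of_real ((cmod (\<Sum>k\<in>F. c k * complex_of_real (a k)))\<^sup>2) =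
    (\<Sum>k\<in>F. \<Sum>l\<in>F. c k * cnj (c l) * complex_of_real (a k * a l))"
  unfolding complex_norm_square
  by (simp add: sum_product mult_ac)

text \<open>
  The points \<open>p - kuhn_chain \<pi> i\<close> are the vertices of a Kuhn simplex with largest vertex \<open>p\<close>, and each Kuhn
  simplex arises from exactly one pair of \<open>\<pi> \<in> kuhn_orders\<close> and \<open>p\<close>.
\<close>

definition chain_sum :: "(int^'n \<Rightarrow> complex) \<Rightarrow> ('n::finite \<Rightarrow> nat) \<Rightarrow> int^'n \<Rightarrow> complex" where
  "chain_sum c \<pi> p = (\<Sum>i\<le>CARD('n). c (p - kuhn_chain \<pi> i))"

text \<open>
  After expanding the squares, the term \<open>c k * cnj (c l)\<close> occurs once for each pair of vertices with
  difference \<open>k - l\<close>. The set \<open>P\<close> only has to be large enough to contain the top \<open>p\<close> of each simplex that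
  meets \<open>F\<close>.
\<close>

lemma sum_chain_sum_power2:
  fixes c :: "int^'n \<Rightarrow> complex"
  assumes "finite F" "finite P" and c: "\<And>k. k \<notin> F \<Longrightarrow> c k = 0"
    and P: "\<And>k J. k \<in> F \<Longrightarrow> k + indicator_vec J \<in> P"
  shows "complex_of_real (\<Sum>p\<in>P. (cmod (chain_sum c \<pi> p))\<^sup>2) =
    (\<Sum>k\<in>F. \<Sum>l\<in>F. c k * cnj (c l) * complex_of_real (real (card (chain_pairs \<pi> (k - l)))))"
proof -
  let ?I = "{..CARD('n)}" and ?v = "kuhn_chain \<pi>"
  define n where "n p k = (\<Sum>i\<in>?I. of_bool (p = k + ?v i) :: real)" for p k
  have "chain_sum c \<pi> p = (\<Sum>k\<in>F. c k * complex_of_real (n p k))" for p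
  proof -
    have "c (p - ?v i) = (\<Sum>k\<in>F. c k * of_bool (p = k + ?v i))" for i
    proof (cases "p - ?v i \<in> F")
      case True
      have "(\<Sum>k\<in>F. c k * of_bool (p = k + ?v i)) = (\<Sum>k\<in>F. if p - ?v i = k then c k else 0)"
        by (intro sum.cong) (auto simp: algebra_simps)
      then show ?thesis using True \<open>finite F\<close> by simp
    next
      case False
      then have "(\<Sum>k\<in>F. c k * of_bool (p = k + ?v i)) = 0"
        by (intro sum.neutral) auto
      then show ?thesis using False c by simp
    qed
    then have "chain_sum c \<pi> p = (\<Sum>i\<in>?I. \<Sum>k\<in>F. c k * of_bool (p = k + ?v i))"
      unfolding chain_sum_def by (intro sum.cong) auto
    also have "\<dots> = (\<Sum>k\<in>F. c k * complex_of_real (n p k))"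
      unfolding n_def by (subst sum.swap) (simp add: sum_distrib_left mult.commute)
    finally show ?thesis .
  qed
  then have "complex_of_real (\<Sum>p\<in>P. (cmod (chain_sum c \<pi> p))\<^sup>2) =
      (\<Sum>p\<in>P. \<Sum>k\<in>F. \<Sum>l\<in>F. c k * cnj (c l) * complex_of_real (n p k * n p l))"
    by (simp only: of_real_sum cmod_sum_power2)
  also have "\<dots> = (\<Sum>k\<in>F. \<Sum>l\<in>F. c k * cnj (c l) * complex_of_real (\<Sum>p\<in>P. n p k * n p l))"
    by (subst sum_swap_last[symmetric]) (simp only: of_real_sum sum_distrib_left)
  also have "\<dots> = (\<Sum>k\<in>F. \<Sum>l\<in>F. c k * cnj (c l) * complex_of_real (real (card (chain_pairs \<pi> (k - l)))))"
  proof (intro sum.cong refl arg_cong2[where f="(*)"] arg_cong[where f=complex_of_real])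
    fix k l assume "k \<in> F" "l \<in> F"
    have "(\<Sum>p\<in>P. n p k * n p l) =
        (\<Sum>p\<in>P. \<Sum>i\<in>?I. \<Sum>i'\<in>?I. of_bool (p = k + ?v i) * of_bool (p = l + ?v i'))"
      unfolding n_def by (simp only: sum_product)
    also have "\<dots> = (\<Sum>i\<in>?I. \<Sum>i'\<in>?I. \<Sum>p\<in>P. of_bool (p = k + ?v i) * of_bool (p = l + ?v i'))"
      by (subst sum.swap) (intro sum.cong refl sum.swap)
    also have "\<dots> = (\<Sum>i\<in>?I. \<Sum>i'\<in>?I. of_bool (?v i' - ?v i = k - l))"
    proof (intro sum.cong refl)
      fix i i'
      have "k + ?v i \<in> P" using P[OF \<open>k \<in> F\<close>] by (simp add: kuhn_chain_def)
      have "(\<Sum>p\<in>P. of_bool (p = k + ?v i) * of_bool (p = l + ?v i') :: real) =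
          (\<Sum>p\<in>P. if k + ?v i = p then of_bool (k + ?v i = l + ?v i') else 0)"
        by (intro sum.cong) auto
      also have "\<dots> = of_bool (k + ?v i = l + ?v i')"
        using \<open>k + ?v i \<in> P\<close> \<open>finite P\<close> by simp
      also have "(k + ?v i = l + ?v i') = (?v i' - ?v i = k - l)"
        by (auto simp: algebra_simps)
      finally show "(\<Sum>p\<in>P. of_bool (p = k + ?v i) * of_bool (p = l + ?v i') :: real) =
          of_bool (?v i' - ?v i = k - l)" .
    qed
    also have "\<dots> = (\<Sum>z\<in>?I \<times> ?I. of_bool (z \<in> chain_pairs \<pi> (k - l)))"
      by (subst sum.cartesian_product) (intro sum.cong, auto simp: chain_pairs_def)
    also have "\<dots> = real (card (chain_pairs \<pi> (k - l)))"
    proof -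
      have "chain_pairs \<pi> (k - l) \<subseteq> ?I \<times> ?I" by (auto simp: chain_pairs_def)
      then show ?thesis by (simp add: Int_absorb1 sum_of_bool_eq Collect_mem_eq)
    qed
    finally show "(\<Sum>p\<in>P. n p k * n p l) = real (card (chain_pairs \<pi> (k - l)))" .
  qed
  finally show ?thesis .
qed

lemma integrable_kuhn_hat_mult:
  "integrable lborel (\<lambda>x. kuhn_hat (x - v) * kuhn_hat (x - w))"
proof (rule integrable_bounded_support[where C=1 and a=v and b="v + (\<chi> i. 2)"])
  fix x
  show "norm (kuhn_hat (x - v) * kuhn_hat (x - w)) \<le> 1"
    by (auto simp: abs_mult kuhn_hat_bounds intro!: mult_le_one)
  assume "kuhn_hat (x - v) * kuhn_hat (x - w) \<noteq> 0"
  then have "kuhn_hat (x - v) \<noteq> 0" by simp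
  from kuhn_hat_support[OF this] show "x \<in> cbox v (v + (\<chi> i. 2))"
    by (auto simp: mem_box_cart less_imp_le algebra_simps)
qed measurable

definition kuhn_energy :: "(int^'n) set \<Rightarrow> (int^'n \<Rightarrow> complex) \<Rightarrow> real" where
  "kuhn_energy F c = (LINT x|lborel. (cmod (\<Sum>k\<in>F. c k * complex_of_real (kuhn_hat (x - vec_of_int k))))\<^sup>2)"

lemma kuhn_energy_eq_autocorrelation:
  fixes F :: "(int^'n) set"
  shows "complex_of_real (kuhn_energy F c) =
    (\<Sum>k\<in>F. \<Sum>l\<in>F. c k * cnj (c l) * complex_of_real (kuhn_autocorrelation (k - l)))"
proof -
  have int: "integrable lborel (\<lambda>x. complex_of_real (kuhn_hat (x - vec_of_int k) * kuhn_hat (x - vec_of_int l)))"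
    for k l :: "int^'n"
    by (rule integrable_of_real[OF integrable_kuhn_hat_mult])
  have "complex_of_real (kuhn_energy F c) =
      (LINT x|lborel. (\<Sum>k\<in>F. \<Sum>l\<in>F. c k * cnj (c l) *
        complex_of_real (kuhn_hat (x - vec_of_int k) * kuhn_hat (x - vec_of_int l))))"
    unfolding kuhn_energy_def cmod_sum_power2[symmetric]
    by (rule integral_complex_of_real[symmetric])
  also have "\<dots> = (\<Sum>k\<in>F. \<Sum>l\<in>F. c k * cnj (c l) *
      (LINT x|lborel. complex_of_real (kuhn_hat (x - vec_of_int k) * kuhn_hat (x - vec_of_int l))))"
    by (simp only: Bochner_Integration.integral_sum Bochner_Integration.integrable_sum
        integrable_mult_right int integral_mult_right_zero)
  also have "\<dots> = (\<Sum>k\<in>F. \<Sum>l\<in>F. c k * cnj (c l) * complex_of_real (kuhn_autocorrelation (k - l)))"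
  proof -
    have "kuhn_autocorrelation (l - k) = kuhn_autocorrelation (k - l)" for k l :: "int^'n"
      using kuhn_autocorrelation_minus[of "k - l"] by simp
    then show ?thesis by (simp only: integral_complex_of_real kuhn_autocorrelation_shift)
  qed
  finally show ?thesis .
qed

text \<open>
  The integral of the squared modulus of a linear function over a simplex is its volume times
  \<open>(\<Sum>i. \<bar>v i\<bar>\<^sup>2 + \<bar>\<Sum>i. v i\<bar>\<^sup>2) / ((d + 1) * (d + 2))\<close>, where the \<open>v i\<close> are the values at its vertices. Summed over
  all Kuhn simplices this becomes the identity below. Both sides are Hermitian forms in \<open>c\<close> whose
  coefficients depend only on \<open>k - l\<close>, so it suffices that these coefficients agree.
\<close>

theorem kuhn_energy_decomposition:
  fixes c :: "int^'n \<Rightarrow> complex"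
  assumes "finite F" "finite P" and c: "\<And>k. k \<notin> F \<Longrightarrow> c k = 0"
    and P: "\<And>k J. k \<in> F \<Longrightarrow> k + indicator_vec J \<in> P"
  shows "(real CARD('n) + 2) * kuhn_energy F c = (\<Sum>k\<in>F. (cmod (c k))\<^sup>2) +
    (\<Sum>\<pi>\<in>kuhn_orders. \<Sum>p\<in>P. (cmod (chain_sum c \<pi> p))\<^sup>2) /
      ((real CARD('n) + 1) * real (card (kuhn_orders :: ('n \<Rightarrow> nat) set)))"
proof -
  let ?O = "kuhn_orders :: ('n \<Rightarrow> nat) set"
  let ?D = "(real CARD('n) + 1) * real (card ?O)"
  have "complex_of_real ((real CARD('n) + 2) * kuhn_energy F c) =
      (\<Sum>k\<in>F. \<Sum>l\<in>F. c k * cnj (c l) *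
        complex_of_real ((real CARD('n) + 2) * kuhn_autocorrelation (k - l)))"
    by (simp only: of_real_mult kuhn_energy_eq_autocorrelation sum_distrib_left mult_ac)
  also have "\<dots> = (\<Sum>k\<in>F. \<Sum>l\<in>F. c k * cnj (c l) * complex_of_real (of_bool (k = l))) +
      (\<Sum>k\<in>F. \<Sum>l\<in>F. \<Sum>\<pi>\<in>?O. c k * cnj (c l) *
         complex_of_real (real (card (chain_pairs \<pi> (k - l)))) / complex_of_real ?D)"
    unfolding kuhn_autocorrelation_eq_chain_pairs
    by (simp add: distrib_left sum.distrib sum_distrib_left sum_divide_distrib)
  also have "(\<Sum>k\<in>F. \<Sum>l\<in>F. c k * cnj (c l) * complex_of_real (of_bool (k = l))) = complex_of_real (\<Sum>k\<in>F. (cmod (c k))\<^sup>2)"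
    using \<open>finite F\<close>
    by (simp add: complex_norm_square of_bool_def if_distrib del: of_real_power cong: if_cong)
  also have "(\<Sum>k\<in>F. \<Sum>l\<in>F. \<Sum>\<pi>\<in>?O. c k * cnj (c l) *
         complex_of_real (real (card (chain_pairs \<pi> (k - l)))) / complex_of_real ?D) =
      (\<Sum>\<pi>\<in>?O. complex_of_real (\<Sum>p\<in>P. (cmod (chain_sum c \<pi> p))\<^sup>2) / complex_of_real ?D)"
  proof (subst sum_swap_last, intro sum.cong refl)
    fix \<pi> :: "'n \<Rightarrow> nat"
    show "(\<Sum>k\<in>F. \<Sum>l\<in>F. c k * cnj (c l) *
         complex_of_real (real (card (chain_pairs \<pi> (k - l)))) / complex_of_real ?D) =
        complex_of_real (\<Sum>p\<in>P. (cmod (chain_sum c \<pi> p))\<^sup>2) / complex_of_real ?D"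
      using c P by (subst sum_chain_sum_power2[OF assms(1,2)]) (simp_all add: sum_divide_distrib)
  qed
  finally have "complex_of_real ((real CARD('n) + 2) * kuhn_energy F c) =
      complex_of_real ((\<Sum>k\<in>F. (cmod (c k))\<^sup>2) + (\<Sum>\<pi>\<in>?O. \<Sum>p\<in>P. (cmod (chain_sum c \<pi> p))\<^sup>2) / ?D)"
    by (simp only: of_real_add of_real_divide of_real_sum sum_divide_distrib)
  then show ?thesis by (simp only: of_real_eq_iff)
qed

lemma chain_sum_bound:
  "(cmod (chain_sum c \<pi> p))\<^sup>2 \<le>
     (real CARD('n) + 1) * (\<Sum>i\<le>CARD('n). (cmod (c (p - kuhn_chain (\<pi> :: 'n::finite \<Rightarrow> nat) i)))\<^sup>2)"
proof -
  have "(cmod (chain_sum c \<pi> p))\<^sup>2 \<le> (\<Sum>i\<le>CARD('n). cmod (c (p - kuhn_chain \<pi> i)))\<^sup>2"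
    unfolding chain_sum_def by (intro power_mono norm_sum) auto
  also have "\<dots> \<le> (\<Sum>i\<le>CARD('n). (cmod (c (p - kuhn_chain \<pi> i)))\<^sup>2) * real (card {..CARD('n)})"
    by (rule sum_squared_le_sum_of_squares)
  finally show ?thesis by (simp add: mult.commute add.commute)
qed

lemma sum_shift_le:
  fixes c :: "int^'n \<Rightarrow> complex"
  assumes "finite F" "finite P" and c: "\<And>k. k \<notin> F \<Longrightarrow> c k = 0"
  shows "(\<Sum>p\<in>P. (cmod (c (p - v)))\<^sup>2) \<le> (\<Sum>k\<in>F. (cmod (c k))\<^sup>2)"
proof -
  have "(\<Sum>p\<in>P. (cmod (c (p - v)))\<^sup>2) = (\<Sum>k\<in>(\<lambda>p. p - v) ` P. (cmod (c k))\<^sup>2)"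
    by (subst sum.reindex) (auto simp: inj_on_def)
  also have "\<dots> = (\<Sum>k\<in>(\<lambda>p. p - v) ` P \<inter> F. (cmod (c k))\<^sup>2)"
    using assms by (intro sum.mono_neutral_right) auto
  also have "\<dots> \<le> (\<Sum>k\<in>F. (cmod (c k))\<^sup>2)"
    using assms by (intro sum_mono2) auto
  finally show ?thesis .
qed

text \<open>
  In the decomposition of the energy the contribution of the vertex sums is nonnegative, and by the
  Cauchy--Schwarz inequality it is at most \<open>d + 1\<close> times the squared norm of the coefficients.
\<close>

lemma kuhn_energy_bounds:
  fixes F :: "(int^'n) set"
  assumes F: "finite F"
  shows "(\<Sum>k\<in>F. (cmod (c k))\<^sup>2) \<le> (real CARD('n) + 2) * kuhn_energy F c"
    and "kuhn_energy F c \<le> (\<Sum>k\<in>F. (cmod (c k))\<^sup>2)"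
proof -
  let ?d = "real CARD('n)" and ?O = "kuhn_orders :: ('n \<Rightarrow> nat) set"
  define c' where "c' k = (if k \<in> F then c k else 0)" for k
  define P where "P = (\<lambda>(k, J). k + indicator_vec J) ` (F \<times> UNIV)"
  have P: "finite P" using F by (simp add: P_def)
  let ?s = "\<Sum>k\<in>F. (cmod (c k))\<^sup>2"
  let ?T = "\<Sum>\<pi>\<in>?O. \<Sum>p\<in>P. (cmod (chain_sum c' \<pi> p))\<^sup>2"
  have s: "(\<Sum>k\<in>F. (cmod (c' k))\<^sup>2) = ?s" by (simp add: c'_def)
  have "kuhn_energy F c = kuhn_energy F c'"
    by (simp add: kuhn_energy_def c'_def)
  moreover have "(?d + 2) * kuhn_energy F c' = (\<Sum>k\<in>F. (cmod (c' k))\<^sup>2) + ?T / ((?d + 1) * real (card ?O))"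
    by (rule kuhn_energy_decomposition[OF F P]) (auto simp: c'_def P_def)
  ultimately have E: "(?d + 2) * kuhn_energy F c = ?s + ?T / ((?d + 1) * real (card ?O))"
    by (simp only: s)
  have O: "real (card ?O) > 0" using card_kuhn_orders_pos by simp
  show "?s \<le> (?d + 2) * kuhn_energy F c"
    unfolding E by (simp add: sum_nonneg)
  have "?T \<le> (\<Sum>\<pi>\<in>?O. \<Sum>p\<in>P. (?d + 1) * (\<Sum>i\<le>CARD('n). (cmod (c' (p - kuhn_chain \<pi> i)))\<^sup>2))"
    by (intro sum_mono chain_sum_bound)
  also have "\<dots> = (\<Sum>\<pi>\<in>?O. (?d + 1) * (\<Sum>i\<le>CARD('n). \<Sum>p\<in>P. (cmod (c' (p - kuhn_chain \<pi> i)))\<^sup>2))"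
    by (intro sum.cong refl) (simp only: sum_distrib_left[symmetric] sum.swap[of _ _ P])
  also have "\<dots> \<le> (\<Sum>\<pi>\<in>?O. (?d + 1) * (\<Sum>i\<le>CARD('n). ?s))"
    unfolding s[symmetric] using F P
    by (intro sum_mono mult_left_mono sum_shift_le) (auto simp: c'_def)
  also have "\<dots> = (?d + 1) * ?s * ((?d + 1) * real (card ?O))"
    by simp
  finally have "?T / ((?d + 1) * real (card ?O)) \<le> (?d + 1) * ?s"
    using O by (subst pos_divide_le_eq) auto
  then have "(?d + 2) * kuhn_energy F c \<le> (?d + 2) * ?s"
    unfolding E by (simp add: distrib_right)
  then show "kuhn_energy F c \<le> ?s" by (subst (asm) mult_le_cancel_left_pos) auto
qed

section \<open>Plane waves on large cubes\<close>

lemma vec_set_eq_image_PiE: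
  "{k :: 'a^'n. \<forall>i. k $ i \<in> S i} = vec_lambda ` (Pi\<^sub>E UNIV S)"
proof (intro equalityI subsetI)
  fix k :: "'a^'n" assume "k \<in> {k. \<forall>i. k $ i \<in> S i}"
  then have "k = vec_lambda (($) k)" "($) k \<in> Pi\<^sub>E UNIV S" by auto
  then show "k \<in> vec_lambda ` (Pi\<^sub>E UNIV S)" by blast
qed auto

lemma finite_vec_set: "(\<And>i. finite (S i)) \<Longrightarrow> finite {k :: 'a^'n. \<forall>i. k $ i \<in> S i}"
  unfolding vec_set_eq_image_PiE by (intro finite_imageI finite_PiE) auto

lemma card_vec_set:
  assumes "finite S"
  shows "card {k :: 'a^'n. \<forall>i. k $ i \<in> S} = card S ^ CARD('n)"
proof -
  have "card (vec_lambda ` ((UNIV :: 'n set) \<rightarrow>\<^sub>E S)) = card ((UNIV :: 'n set) \<rightarrow>\<^sub>E S)"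
    by (rule card_image) (auto simp: inj_on_def vec_eq_iff fun_eq_iff)
  then show ?thesis by (simp add: vec_set_eq_image_PiE card_PiE)
qed

definition int_cube :: "int \<Rightarrow> int \<Rightarrow> (int^'n) set" where
  "int_cube a b = {k. \<forall>i. k $ i \<in> {a..<b}}"

lemma finite_int_cube [simp]: "finite (int_cube a b)"
  unfolding int_cube_def by (rule finite_vec_set) simp

lemma card_int_cube:
  "a \<le> b \<Longrightarrow> real (card (int_cube a b :: (int^'n) set)) = real_of_int (b - a) ^ CARD('n)"
  unfolding int_cube_def by (subst card_vec_set) auto

definition plane_wave :: "real \<Rightarrow> int^'n \<Rightarrow> complex" where
  "plane_wave \<theta> k = cis (\<theta> * real_of_int (\<Sum>i\<in>UNIV. k $ i))"

lemma cmod_plane_wave [simp]: "cmod (plane_wave \<theta> k) = 1"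
  by (simp add: plane_wave_def)

lemma sum_kuhn_chain:
  fixes \<pi> :: "'n::finite \<Rightarrow> nat"
  assumes "\<pi> \<in> kuhn_orders" "i \<le> CARD('n)"
  shows "(\<Sum>a\<in>UNIV. kuhn_chain \<pi> i $ a) = int i"
proof -
  have "(\<Sum>a\<in>UNIV. kuhn_chain \<pi> i $ a) = int (card {a. \<pi> a < i})"
    by (simp add: kuhn_chain_def sum.If_cases)
  also have "card {a. \<pi> a < i} = card (\<pi> ` {a. \<pi> a < i})"
    using kuhn_ordersD(1)[OF assms(1)] by (intro card_image[symmetric]) (rule inj_on_subset[OF _ subset_UNIV])
  also have "\<pi> ` {a. \<pi> a < i} = {..<i}"
  proof (intro equalityI subsetI)
    fix j assume "j \<in> {..<i}"
    moreover then obtain a where "\<pi> a = j"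
      using kuhn_ordersD(3)[OF assms(1), of j] assms(2) by auto
    ultimately show "j \<in> \<pi> ` {a. \<pi> a < i}" by auto
  qed auto
  finally show ?thesis by simp
qed

lemma chain_sum_plane_wave:
  fixes \<pi> :: "'n::finite \<Rightarrow> nat"
  assumes \<pi>: "\<pi> \<in> kuhn_orders"
  shows "cmod (chain_sum (plane_wave \<theta>) \<pi> p) = cmod (\<Sum>i\<le>CARD('n). cis (- \<theta>) ^ i)"
proof -
  have "plane_wave \<theta> (p - kuhn_chain \<pi> i) = plane_wave \<theta> p * cis (- \<theta>) ^ i" if "i \<le> CARD('n)" for i
  proof -
    have "(\<Sum>a\<in>UNIV. (p - kuhn_chain \<pi> i) $ a) = (\<Sum>a\<in>UNIV. p $ a) - int i"
      using sum_kuhn_chain[OF \<pi> that] by (simp add: sum_subtractf)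
    then show ?thesis
      unfolding plane_wave_def Complex.DeMoivre cis_mult
      by (simp only: of_int_diff of_int_of_nat_eq) (simp add: algebra_simps)
  qed
  then have "chain_sum (plane_wave \<theta>) \<pi> p = plane_wave \<theta> p * (\<Sum>i\<le>CARD('n). cis (- \<theta>) ^ i)"
    by (simp add: chain_sum_def sum_distrib_left)
  then show ?thesis by (simp add: norm_mult)
qed

text \<open>
  The vertices below \<open>p\<close> have consecutive coordinate sums, so all vertex sums of a plane wave have the
  same modulus \<open>\<gamma>\<close>. Truncating the wave to a cube changes only the vertex sums near the boundary,
  which are at most \<open>d + 1\<close> in modulus.
\<close>

lemma kuhn_energy_plane_wave:
  fixes N :: nat and \<theta> :: real
  defines "\<gamma> \<equiv> cmod (\<Sum>i\<le>CARD('n). cis (- \<theta>) ^ i)"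
  assumes "N > 0"
  shows "real N ^ CARD('n) + \<gamma>\<^sup>2 / (real CARD('n) + 1) * (real N - 1) ^ CARD('n) \<le>
      (real CARD('n) + 2) * kuhn_energy (int_cube 0 (int N) :: (int^'n) set) (plane_wave \<theta>)" (is ?lower)
    and "(real CARD('n) + 2) * kuhn_energy (int_cube 0 (int N) :: (int^'n) set) (plane_wave \<theta>) \<le>
      real N ^ CARD('n) + \<gamma>\<^sup>2 / (real CARD('n) + 1) * (real N - 1) ^ CARD('n) +
      (real CARD('n) + 1) * ((real N + 1) ^ CARD('n) - (real N - 1) ^ CARD('n))" (is ?upper)
proof -
  let ?d = "real CARD('n)" and ?O = "kuhn_orders :: ('n \<Rightarrow> nat) set"
  let ?F = "int_cube 0 (int N) :: (int^'n) set" and ?P = "int_cube 0 (int N + 1) :: (int^'n) set"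
    and ?Q = "int_cube 1 (int N) :: (int^'n) set"
  have cards: "real (card ?F) = real N ^ CARD('n)" "real (card ?P) = (real N + 1) ^ CARD('n)"
    "real (card ?Q) = (real N - 1) ^ CARD('n)"
    using \<open>N > 0\<close> by (simp_all add: card_int_cube)
  have "?Q \<subseteq> ?P"
  proof
    fix p :: "int^'n" assume "p \<in> ?Q"
    then have "1 \<le> p $ i \<and> p $ i < int N" for i by (simp add: int_cube_def)
    then have "0 \<le> p $ i \<and> p $ i < int N + 1" for i by (smt (verit))
    then show "p \<in> ?P" by (simp add: int_cube_def)
  qed
  define c where "c k = (if k \<in> ?F then plane_wave \<theta> k else 0)" for k :: "int^'n"
  have O: "real (card ?O) > 0" using card_kuhn_orders_pos by simp
  have "kuhn_energy ?F (plane_wave \<theta>) = kuhn_energy ?F c"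
    by (simp add: kuhn_energy_def c_def)
  moreover have "(?d + 2) * kuhn_energy ?F c = (\<Sum>k\<in>?F. (cmod (c k))\<^sup>2) +
      (\<Sum>\<pi>\<in>?O. \<Sum>p\<in>?P. (cmod (chain_sum c \<pi> p))\<^sup>2) / ((?d + 1) * real (card ?O))"
  proof (rule kuhn_energy_decomposition)
    fix k :: "int^'n" and J assume "k \<in> ?F"
    then have k: "0 \<le> k $ i \<and> k $ i < int N" for i by (simp add: int_cube_def)
    have "0 \<le> (k + indicator_vec J) $ i \<and> (k + indicator_vec J) $ i < int N + 1" for i
      using k[of i] by auto
    then show "k + indicator_vec J \<in> ?P" by (simp add: int_cube_def)
  qed (simp_all add: c_def)
  moreover have "(\<Sum>k\<in>?F. (cmod (c k))\<^sup>2) = real N ^ CARD('n)"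
    by (simp add: c_def cards)
  ultimately have E: "(?d + 2) * kuhn_energy ?F (plane_wave \<theta>) = real N ^ CARD('n) +
      (\<Sum>\<pi>\<in>?O. \<Sum>p\<in>?P. (cmod (chain_sum c \<pi> p))\<^sup>2) / ((?d + 1) * real (card ?O))"
    by (simp only:)
  define T where "T \<pi> = (\<Sum>p\<in>?P. (cmod (chain_sum c \<pi> p))\<^sup>2)" for \<pi> :: "'n \<Rightarrow> nat"
  have T_eq: "T \<pi> = \<gamma>\<^sup>2 * (real N - 1) ^ CARD('n) + (\<Sum>p\<in>?P - ?Q. (cmod (chain_sum c \<pi> p))\<^sup>2)"
    if \<pi>: "\<pi> \<in> ?O" for \<pi>
  proof -
    have "cmod (chain_sum c \<pi> p) = \<gamma>" if "p \<in> ?Q" for p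
    proof -
      have "p - kuhn_chain \<pi> i \<in> ?F" for i
      proof -
        have "0 \<le> p $ a - kuhn_chain \<pi> i $ a \<and> p $ a - kuhn_chain \<pi> i $ a < int N" for a
        proof -
          have "1 \<le> p $ a \<and> p $ a < int N" using that by (simp add: int_cube_def)
          then show ?thesis by (auto simp: kuhn_chain_def)
        qed
        then show ?thesis by (simp add: int_cube_def)
      qed
      then have "chain_sum c \<pi> p = chain_sum (plane_wave \<theta>) \<pi> p"
        by (simp add: chain_sum_def c_def)
      then show ?thesis by (simp add: chain_sum_plane_wave[OF \<pi>] \<gamma>_def)
    qed
    then have "(\<Sum>p\<in>?Q. (cmod (chain_sum c \<pi> p))\<^sup>2) = \<gamma>\<^sup>2 * (real N - 1) ^ CARD('n)"
      by (simp add: cards)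
    then show ?thesis
      unfolding T_def using sum.subset_diff[OF \<open>?Q \<subseteq> ?P\<close>, of "\<lambda>p. (cmod (chain_sum c \<pi> p))\<^sup>2"] by simp
  qed
  have boundary: "(\<Sum>p\<in>?P - ?Q. (cmod (chain_sum c \<pi> p))\<^sup>2) \<le>
      (?d + 1)\<^sup>2 * ((real N + 1) ^ CARD('n) - (real N - 1) ^ CARD('n))" for \<pi> :: "'n \<Rightarrow> nat"
  proof -
    have "(cmod (chain_sum c \<pi> p))\<^sup>2 \<le> (?d + 1)\<^sup>2" for p
    proof -
      have "cmod (chain_sum c \<pi> p) \<le> (\<Sum>i\<le>CARD('n). 1)"
        unfolding chain_sum_def by (rule order_trans[OF norm_sum sum_mono]) (simp add: c_def)
      then show ?thesis by (intro power_mono) auto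
    qed
    then have "(\<Sum>p\<in>?P - ?Q. (cmod (chain_sum c \<pi> p))\<^sup>2) \<le> (\<Sum>p\<in>?P - ?Q. (?d + 1)\<^sup>2)"
      by (intro sum_mono)
    also have "\<dots> = (?d + 1)\<^sup>2 * (real (card ?P) - real (card ?Q))"
      using card_mono[OF finite_int_cube \<open>?Q \<subseteq> ?P\<close>] \<open>?Q \<subseteq> ?P\<close>
      by (simp add: card_Diff_subset of_nat_diff)
    finally show ?thesis by (simp only: cards)
  qed
  have "real (card ?O) * (\<gamma>\<^sup>2 * (real N - 1) ^ CARD('n)) \<le> (\<Sum>\<pi>\<in>?O. T \<pi>)"
    using T_eq by (intro order_trans[OF _ sum_bounded_below]) (auto simp: sum_nonneg)
  then have "(real (card ?O) * (\<gamma>\<^sup>2 * (real N - 1) ^ CARD('n))) / ((?d + 1) * real (card ?O)) \<le>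
      (\<Sum>\<pi>\<in>?O. T \<pi>) / ((?d + 1) * real (card ?O))"
    by (intro divide_right_mono) auto
  then show ?lower
    unfolding E T_def using O by simp
  have "(\<Sum>\<pi>\<in>?O. T \<pi>) \<le> real (card ?O) * (\<gamma>\<^sup>2 * (real N - 1) ^ CARD('n) +
      (?d + 1)\<^sup>2 * ((real N + 1) ^ CARD('n) - (real N - 1) ^ CARD('n)))"
    using T_eq boundary by (intro sum_bounded_above) auto
  then have "(\<Sum>\<pi>\<in>?O. T \<pi>) / ((?d + 1) * real (card ?O)) \<le>
      (real (card ?O) * (\<gamma>\<^sup>2 * (real N - 1) ^ CARD('n) +
      (?d + 1)\<^sup>2 * ((real N + 1) ^ CARD('n) - (real N - 1) ^ CARD('n)))) / ((?d + 1) * real (card ?O))"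
    by (intro divide_right_mono) auto
  also have "\<dots> = (\<gamma>\<^sup>2 * (real N - 1) ^ CARD('n) +
      (?d + 1)\<^sup>2 * ((real N + 1) ^ CARD('n) - (real N - 1) ^ CARD('n))) / (?d + 1)"
    using O by simp
  also have "\<dots> = \<gamma>\<^sup>2 / (?d + 1) * (real N - 1) ^ CARD('n) +
      (?d + 1) * ((real N + 1) ^ CARD('n) - (real N - 1) ^ CARD('n))"
    by (simp add: add_divide_distrib power2_eq_square)
  finally show ?upper
    unfolding E T_def by simp
qed

lemma sum_roots_of_unity_eq_0:
  assumes "n > 0"
  shows "(\<Sum>i\<le>n. cis (- (2 * pi / (real n + 1))) ^ i) = 0"
proof -
  let ?\<theta> = "2 * pi / (real n + 1)"
  have "cis (- ?\<theta>) ^ Suc n = cis (real (Suc n) * (- ?\<theta>))"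
    by (rule Complex.DeMoivre)
  also have "real (Suc n) * (- ?\<theta>) = - (2 * pi)"
    by (simp add: field_simps)
  finally have "cis (- ?\<theta>) ^ Suc n = cis (- (2 * pi))" .
  then have pow: "cis (- ?\<theta>) ^ Suc n = 1" by (simp add: cis_cnj[symmetric])
  have "cis (- ?\<theta>) \<noteq> 1"
  proof
    assume "cis (- ?\<theta>) = 1"
    then have "cos ?\<theta> = cos 0" by (simp add: complex_eq_iff)
    moreover have "cos ?\<theta> < cos 0"
    proof (rule cos_monotone_0_pi)
      have "2 * pi \<le> pi * (real n + 1)" using assms by (simp add: mult.commute)
      then show "?\<theta> \<le> pi" by (simp add: divide_le_eq)
    qed auto
    ultimately show False by simp
  qed
  then show ?thesis
    using pow sum_gp0[of "cis (- ?\<theta>)" n] by simp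
qed

text \<open>
  The boundary of the cube is negligible as the cube grows. The phase \<open>\<theta> = 0\<close>, for which \<open>\<gamma> = d + 1\<close>, will
  show that the upper Riesz bound is sharp; a primitive root of unity of order \<open>d + 1\<close>, for which
  \<open>\<gamma> = 0\<close>, will do so for the lower one.
\<close>

lemma kuhn_energy_plane_wave_limits:
  fixes \<theta> :: real
  defines "\<gamma> \<equiv> cmod (\<Sum>i\<le>CARD('n::finite). cis (- \<theta>) ^ i)"
  shows "(\<lambda>N. (real CARD('n) + 2) * kuhn_energy (int_cube 0 (int N) :: (int^'n) set) (plane_wave \<theta>) /
      real N ^ CARD('n)) \<longlonglongrightarrow> 1 + \<gamma>\<^sup>2 / (real CARD('n) + 1)"
proof -
  let ?d = "CARD('n)"
  let ?e = "\<lambda>N. (real ?d + 2) * kuhn_energy (int_cube 0 (int N) :: (int^'n) set) (plane_wave \<theta>)"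
  have ratio: "(1 - 1 / real N) ^ ?d = (real N - 1) ^ ?d / real N ^ ?d"
    "(1 + 1 / real N) ^ ?d = (real N + 1) ^ ?d / real N ^ ?d" if "N > 0" for N
    using that by (simp_all add: power_divide[symmetric] diff_divide_distrib add_divide_distrib)
  show ?thesis
  proof (rule tendsto_sandwich)
    show "\<forall>\<^sub>F N in sequentially. 1 + \<gamma>\<^sup>2 / (real ?d + 1) * (1 - 1 / real N) ^ ?d \<le> ?e N / real N ^ ?d"
    proof (rule eventually_sequentiallyI[of 1])
      fix N :: nat assume "1 \<le> N"
      then have N: "N > 0" by simp
      have "(real N ^ ?d + \<gamma>\<^sup>2 / (real ?d + 1) * (real N - 1) ^ ?d) / real N ^ ?d \<le> ?e N / real N ^ ?d"
        unfolding \<gamma>_def using kuhn_energy_plane_wave(1)[OF N, where 'n='n and \<theta>=\<theta>]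
        by (intro divide_right_mono) auto
      then show "1 + \<gamma>\<^sup>2 / (real ?d + 1) * (1 - 1 / real N) ^ ?d \<le> ?e N / real N ^ ?d"
        using N by (simp add: add_divide_distrib ratio)
    qed
    show "\<forall>\<^sub>F N in sequentially. ?e N / real N ^ ?d \<le> 1 + \<gamma>\<^sup>2 / (real ?d + 1) * (1 - 1 / real N) ^ ?d +
        (real ?d + 1) * ((1 + 1 / real N) ^ ?d - (1 - 1 / real N) ^ ?d)"
    proof (rule eventually_sequentiallyI[of 1])
      fix N :: nat assume "1 \<le> N"
      then have N: "N > 0" by simp
      have "?e N / real N ^ ?d \<le> (real N ^ ?d + \<gamma>\<^sup>2 / (real ?d + 1) * (real N - 1) ^ ?d +
          (real ?d + 1) * ((real N + 1) ^ ?d - (real N - 1) ^ ?d)) / real N ^ ?d"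
        unfolding \<gamma>_def using kuhn_energy_plane_wave(2)[OF N, where 'n='n and \<theta>=\<theta>]
        by (intro divide_right_mono) auto
      then show "?e N / real N ^ ?d \<le> 1 + \<gamma>\<^sup>2 / (real ?d + 1) * (1 - 1 / real N) ^ ?d +
          (real ?d + 1) * ((1 + 1 / real N) ^ ?d - (1 - 1 / real N) ^ ?d)"
        using N by (simp add: add_divide_distrib diff_divide_distrib ratio right_diff_distrib)
    qed
    have "(\<lambda>N. 1 + \<gamma>\<^sup>2 / (real ?d + 1) * (1 - 1 / real N) ^ ?d) \<longlonglongrightarrow> 1 + \<gamma>\<^sup>2 / (real ?d + 1) * (1 - 0) ^ ?d"
      by (intro tendsto_intros lim_1_over_n)
    then show "(\<lambda>N. 1 + \<gamma>\<^sup>2 / (real ?d + 1) * (1 - 1 / real N) ^ ?d) \<longlonglongrightarrow> 1 + \<gamma>\<^sup>2 / (real ?d + 1)"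
      by simp
    have "(\<lambda>N. 1 + \<gamma>\<^sup>2 / (real ?d + 1) * (1 - 1 / real N) ^ ?d +
        (real ?d + 1) * ((1 + 1 / real N) ^ ?d - (1 - 1 / real N) ^ ?d)) \<longlonglongrightarrow>
        1 + \<gamma>\<^sup>2 / (real ?d + 1) * (1 - 0) ^ ?d + (real ?d + 1) * ((1 + 0) ^ ?d - (1 - 0) ^ ?d)"
      by (intro tendsto_intros lim_1_over_n)
    then show "(\<lambda>N. 1 + \<gamma>\<^sup>2 / (real ?d + 1) * (1 - 1 / real N) ^ ?d +
        (real ?d + 1) * ((1 + 1 / real N) ^ ?d - (1 - 1 / real N) ^ ?d)) \<longlonglongrightarrow> 1 + \<gamma>\<^sup>2 / (real ?d + 1)"
      by simp
  qed
qed

section \<open>Riesz bounds of linear box splines\<close>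

lemma box_spline_translate_eq:
  fixes \<xi> :: "'n::finite \<Rightarrow> real^'n"
  assumes "inj \<xi>" "independent (range \<xi>)"
  shows "box_spline_translate \<xi> k x =
    complex_of_real (kuhn_hat (matrix_inv (column_matrix \<xi>) *v x - vec_of_int k))"
  using det_column_matrix_nonzero[OF assms]
  by (simp add: box_spline_translate_def linear_box_spline_eq_kuhn_hat[OF assms]
      matrix_vector_mult_diff_distrib vec_of_int_def[symmetric] matrix_inv_mult_vector)

lemma continuous_box_spline_translate:
  fixes \<xi> :: "'n::finite \<Rightarrow> real^'n"
  assumes "inj \<xi>" "independent (range \<xi>)"
  shows "continuous_on UNIV (box_spline_translate \<xi> k)"
  unfolding box_spline_translate_eq[OF assms, abs_def]
  by (intro continuous_on_of_real continuous_on_compose2[OF continuous_on_kuhn_hat[of UNIV]]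
      continuous_on_diff matrix_vector_mult_linear_continuous_on continuous_on_const) auto

text \<open>
  The change of variables \<open>x = column_matrix \<xi> *v y\<close> reduces all directions \<open>\<xi>\<close> to the unit vectors.
\<close>

lemma L2_norm_box_spline_sum:
  fixes \<xi> :: "'n::finite \<Rightarrow> real^'n"
  assumes "inj \<xi>" "independent (range \<xi>)"
  shows "L2_norm (\<lambda>x. \<Sum>k\<in>F. c k * box_spline_translate \<xi> k x) =
    sqrt (\<bar>det (column_matrix \<xi>)\<bar> * kuhn_energy F c)"
proof -
  note [measurable] = borel_measurable_continuous_onI[OF continuous_box_spline_translate[OF assms]]
  let ?f = "\<lambda>x. (cmod (\<Sum>k\<in>F. c k * box_spline_translate \<xi> k x))\<^sup>2"
  have det: "det (column_matrix \<xi>) \<noteq> 0" by (rule det_column_matrix_nonzero[OF assms])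
  have "(LINT x|lborel. ?f x) = \<bar>det (column_matrix \<xi>)\<bar> *\<^sub>R (LINT y|lborel. ?f (column_matrix \<xi> *v y))"
    by (rule integral_matrix_image[OF det]) measurable
  also have "(LINT y|lborel. ?f (column_matrix \<xi> *v y)) = kuhn_energy F c"
    unfolding kuhn_energy_def box_spline_translate_eq[OF assms] matrix_inv_mult_vector(1)[OF det] ..
  finally show ?thesis by (simp add: L2_norm_def)
qed

lemma box_spline_translate_in_L2_space:
  fixes \<xi> :: "'n::finite \<Rightarrow> real^'n"
  assumes "inj \<xi>" "independent (range \<xi>)"
  shows "box_spline_translate \<xi> k \<in> L2_space"
proof -
  note [measurable] = borel_measurable_continuous_onI[OF continuous_box_spline_translate[OF assms, of k]]
  let ?A = "column_matrix \<xi>"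
  have det: "det ?A \<noteq> 0" by (rule det_column_matrix_nonzero[OF assms])
  let ?C = "cbox (vec_of_int k) (vec_of_int k + (\<chi> i. 2))"
  have "bounded ((*v) ?A ` ?C)"
    by (intro compact_imp_bounded compact_continuous_image matrix_vector_mult_linear_continuous_on compact_cbox)
  then obtain a where a: "(*v) ?A ` ?C \<subseteq> cbox (- a) a"
    using bounded_subset_cbox_symmetric by blast
  have "integrable lborel (\<lambda>x. (cmod (box_spline_translate \<xi> k x))\<^sup>2)"
  proof (rule integrable_bounded_support[where C=1 and a="-a" and b=a])
    fix x
    show "norm ((cmod (box_spline_translate \<xi> k x))\<^sup>2) \<le> 1"
      by (simp add: box_spline_translate_eq[OF assms] kuhn_hat_bounds power_le_one)
    assume "(cmod (box_spline_translate \<xi> k x))\<^sup>2 \<noteq> 0"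
    then have "kuhn_hat (matrix_inv ?A *v x - vec_of_int k) \<noteq> 0"
      by (simp add: box_spline_translate_eq[OF assms])
    from kuhn_hat_support[OF this] have "matrix_inv ?A *v x \<in> ?C"
      by (auto simp: mem_box_cart less_imp_le algebra_simps)
    then have "?A *v (matrix_inv ?A *v x) \<in> (*v) ?A ` ?C" by (rule imageI)
    then show "x \<in> cbox (- a) a" using a matrix_inv_mult_vector(2)[OF det] by auto
  qed measurable
  then show ?thesis by (simp add: L2_space_def)
qed

lemma box_spline_translates_locally_finite:
  fixes \<xi> :: "'n::finite \<Rightarrow> real^'n"
  assumes "inj \<xi>" "independent (range \<xi>)"
  shows "finite {k. box_spline_translate \<xi> k x \<noteq> 0}"
proof (rule finite_subset)
  let ?y = "matrix_inv (column_matrix \<xi>) *v x"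
  show "{k. box_spline_translate \<xi> k x \<noteq> 0} \<subseteq> {k. \<forall>i. k $ i \<in> {\<lfloor>?y $ i\<rfloor> - 2..\<lceil>?y $ i\<rceil>}}"
  proof
    fix k assume "k \<in> {k. box_spline_translate \<xi> k x \<noteq> 0}"
    then have "kuhn_hat (?y - vec_of_int k) \<noteq> 0"
      by (simp add: box_spline_translate_eq[OF assms])
    note support = kuhn_hat_support[OF this]
    have "k $ i \<in> {\<lfloor>?y $ i\<rfloor> - 2..\<lceil>?y $ i\<rceil>}" for i
    proof -
      have "real_of_int (k $ i) < ?y $ i" "?y $ i < real_of_int (k $ i) + 2"
        using support[of i] by (simp_all add: algebra_simps)
      then have "k $ i \<le> \<lceil>?y $ i\<rceil>" "\<lfloor>?y $ i\<rfloor> \<le> k $ i + 2"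
        by (simp_all add: le_ceiling_iff floor_le_iff)
      then show ?thesis by simp
    qed
    then show "k \<in> {k. \<forall>i. k $ i \<in> {\<lfloor>?y $ i\<rfloor> - 2..\<lceil>?y $ i\<rceil>}}" by blast
  qed
qed (rule finite_vec_set, simp)

theorem theorem3:
  fixes \<xi> :: "'n::finite \<Rightarrow> real^'n"
  assumes "inj \<xi>" and "independent (range \<xi>)"
  shows "riesz_basis (box_spline_translate \<xi>)
           (L2_closure (linear_span (box_spline_translate \<xi>))) \<and>
         lower_riesz_bound (box_spline_translate \<xi>) =
           sqrt (\<bar>det (column_matrix \<xi>)\<bar> / (real CARD('n) + 2)) \<and>
         upper_riesz_bound (box_spline_translate \<xi>) = sqrt \<bar>det (column_matrix \<xi>)\<bar> \<and>
         riesz_condition_number (box_spline_translate \<xi>) = sqrt (real CARD('n) + 2)"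
proof -
  let ?\<phi> = "box_spline_translate \<xi>" and ?d = "real CARD('n)"
  define D where "D = \<bar>det (column_matrix \<xi>)\<bar>"
  have D: "D > 0" using det_column_matrix_nonzero[OF assms] by (simp add: D_def)
  note L2 = box_spline_translate_in_L2_space[OF assms]
  note norm_eq = L2_norm_box_spline_sum[OF assms, folded D_def]
  have iff: "riesz_constants ?\<phi> A B \<longleftrightarrow> 0 < A \<and> A \<le> B \<and>
    (\<forall>(F :: (int^'n) set) c. finite F \<longrightarrow>
       A * sqrt (\<Sum>k\<in>F. (cmod (c k))\<^sup>2) \<le> sqrt (D * kuhn_energy F c) \<and>
       sqrt (D * kuhn_energy F c) \<le> B * sqrt (\<Sum>k\<in>F. (cmod (c k))\<^sup>2))" for A B
    using riesz_constants_iff_finite[OF _ L2 box_spline_translates_locally_finite[OF assms], of A B]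
    by (simp add: norm_eq)
  have R: "riesz_constants ?\<phi> (sqrt (D / (?d + 2))) (sqrt D)"
    unfolding iff
  proof (intro conjI allI impI)
    show "0 < sqrt (D / (?d + 2))" using D by (simp add: add_nonneg_pos)
    show "sqrt (D / (?d + 2)) \<le> sqrt D" using D by (simp add: divide_le_eq)
    fix F :: "(int^'n) set" and c assume F: "finite F"
    let ?s = "\<Sum>k\<in>F. (cmod (c k))\<^sup>2"
    have "D / (?d + 2) * ?s = D * (?s / (?d + 2))" by simp
    also have "\<dots> \<le> D * kuhn_energy F c"
      using D kuhn_energy_bounds(1)[OF F, of c]
      by (intro mult_left_mono) (auto simp: pos_divide_le_eq add_nonneg_pos mult.commute)
    finally show "sqrt (D / (?d + 2)) * sqrt ?s \<le> sqrt (D * kuhn_energy F c)"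
      by (simp only: real_sqrt_mult[symmetric] real_sqrt_le_iff)
    have "D * kuhn_energy F c \<le> D * ?s"
      using D kuhn_energy_bounds(2)[OF F, of c] by (intro mult_left_mono) auto
    then show "sqrt (D * kuhn_energy F c) \<le> sqrt D * sqrt ?s"
      by (simp only: real_sqrt_mult[symmetric] real_sqrt_le_iff)
  qed
  have sum_wave: "(\<Sum>k\<in>int_cube 0 (int N). (cmod (plane_wave \<theta> (k :: int^'n)))\<^sup>2) = real N ^ CARD('n)" for N \<theta>
    using card_int_cube[of 0 "int N", where 'n='n] by simp
  have A_le: "A \<le> sqrt (D / (?d + 2))" if "riesz_constants ?\<phi> A B" for A B
  proof -
    let ?\<theta> = "2 * pi / (?d + 1)"
    let ?e = "\<lambda>N. (?d + 2) * kuhn_energy (int_cube 0 (int N) :: (int^'n) set) (plane_wave ?\<theta>) / real N ^ CARD('n)"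
    have "A\<^sup>2 * (?d + 2) \<le> D * ?e N" if "N \<ge> 1" for N
    proof -
      have "A * sqrt (real N ^ CARD('n)) \<le> sqrt (D * kuhn_energy (int_cube 0 (int N) :: (int^'n) set) (plane_wave ?\<theta>))"
      proof -
        let ?F = "int_cube 0 (int N) :: (int^'n) set"
        have "A * sqrt (\<Sum>k\<in>?F. (cmod (plane_wave ?\<theta> k))\<^sup>2) \<le> sqrt (D * kuhn_energy ?F (plane_wave ?\<theta>))"
          using \<open>riesz_constants ?\<phi> A B\<close> finite_int_cube[of 0 "int N"] unfolding iff by blast
        then show ?thesis by (simp only: sum_wave)
      qed
      then have "(A * sqrt (real N ^ CARD('n)))\<^sup>2 \<le>
          (sqrt (D * kuhn_energy (int_cube 0 (int N) :: (int^'n) set) (plane_wave ?\<theta>)))\<^sup>2"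
        using \<open>riesz_constants ?\<phi> A B\<close> by (intro power_mono) (auto simp: riesz_constants_def)
      then have "A\<^sup>2 * real N ^ CARD('n) \<le> D * kuhn_energy (int_cube 0 (int N) :: (int^'n) set) (plane_wave ?\<theta>)"
        using D by (simp add: power_mult_distrib kuhn_energy_def)
      then have "A\<^sup>2 * real N ^ CARD('n) * (?d + 2) \<le>
          D * kuhn_energy (int_cube 0 (int N) :: (int^'n) set) (plane_wave ?\<theta>) * (?d + 2)"
        by (rule mult_right_mono) simp
      then show ?thesis using \<open>N \<ge> 1\<close> by (simp add: pos_le_divide_eq mult_ac)
    qed
    moreover have "?e \<longlonglongrightarrow> 1"
      using kuhn_energy_plane_wave_limits[where 'n='n and \<theta>="?\<theta>"]
      by (simp add: sum_roots_of_unity_eq_0)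
    ultimately have "A\<^sup>2 * (?d + 2) \<le> D * 1"
      by (intro tendsto_lowerbound[OF tendsto_mult_left[of ?e 1] eventually_sequentiallyI[of 1]]) auto
    then have "A\<^sup>2 \<le> D / (?d + 2)" by (subst pos_le_divide_eq) auto
    then show ?thesis by (rule real_le_rsqrt)
  qed
  have B_ge: "sqrt D \<le> B" if "riesz_constants ?\<phi> A B" for A B
  proof -
    let ?e = "\<lambda>N. (?d + 2) * kuhn_energy (int_cube 0 (int N) :: (int^'n) set) (plane_wave 0) / real N ^ CARD('n)"
    have "D * ?e N \<le> B\<^sup>2 * (?d + 2)" if "N \<ge> 1" for N
    proof -
      have "sqrt (D * kuhn_energy (int_cube 0 (int N) :: (int^'n) set) (plane_wave 0)) \<le> B * sqrt (real N ^ CARD('n))"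
      proof -
        let ?F = "int_cube 0 (int N) :: (int^'n) set"
        have "sqrt (D * kuhn_energy ?F (plane_wave 0)) \<le> B * sqrt (\<Sum>k\<in>?F. (cmod (plane_wave 0 k))\<^sup>2)"
          using \<open>riesz_constants ?\<phi> A B\<close> finite_int_cube[of 0 "int N"] unfolding iff by blast
        then show ?thesis by (simp only: sum_wave)
      qed
      then have "(sqrt (D * kuhn_energy (int_cube 0 (int N) :: (int^'n) set) (plane_wave 0)))\<^sup>2 \<le>
          (B * sqrt (real N ^ CARD('n)))\<^sup>2"
        using D by (intro power_mono) (auto simp: kuhn_energy_def)
      then have "D * kuhn_energy (int_cube 0 (int N) :: (int^'n) set) (plane_wave 0) \<le> B\<^sup>2 * real N ^ CARD('n)"
        using D by (simp add: power_mult_distrib kuhn_energy_def)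
      then have "D * kuhn_energy (int_cube 0 (int N) :: (int^'n) set) (plane_wave 0) * (?d + 2) \<le>
          B\<^sup>2 * real N ^ CARD('n) * (?d + 2)"
        by (rule mult_right_mono) simp
      then show ?thesis using \<open>N \<ge> 1\<close> by (simp add: pos_divide_le_eq mult_ac)
    qed
    moreover have "?e \<longlonglongrightarrow> ?d + 2"
    proof -
      have "(\<Sum>i\<le>CARD('n). cis (- 0) ^ i) = complex_of_real (?d + 1)" by simp
      then have "cmod (\<Sum>i\<le>CARD('n). cis (- 0) ^ i) = ?d + 1"
        by (simp only: norm_of_real)
      moreover have "1 + (?d + 1)\<^sup>2 / (?d + 1) = ?d + 2" by (simp add: power2_eq_square)
      ultimately show ?thesis
        using kuhn_energy_plane_wave_limits[where 'n='n and \<theta>=0] by (simp add: add.commute)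
    qed
    ultimately have "D * (?d + 2) \<le> B\<^sup>2 * (?d + 2)"
      by (intro tendsto_upperbound[OF tendsto_mult_left[of ?e "?d + 2"] eventually_sequentiallyI[of 1]]) auto
    then have "D \<le> B\<^sup>2" by (subst (asm) mult_le_cancel_right_pos) auto
    then show ?thesis
      using \<open>riesz_constants ?\<phi> A B\<close> by (intro real_le_lsqrt) (auto simp: riesz_constants_def)
  qed
  have bounds: "lower_riesz_bound ?\<phi> = sqrt (D / (?d + 2))" "upper_riesz_bound ?\<phi> = sqrt D"
    by (rule riesz_bounds_eqI[OF R]; (erule A_le | erule B_ge))+
  have "riesz_basis ?\<phi> (L2_closure (linear_span ?\<phi>))"
    unfolding riesz_basis_def
  proof (intro conjI)
    show "range ?\<phi> \<subseteq> L2_closure (linear_span ?\<phi>)"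
      by (rule order_trans[OF range_subset_linear_span
            subset_L2_closure[OF linear_span_subset_L2_space[OF L2]]])
    show "closed_L2_subspace (L2_closure (linear_span ?\<phi>))"
      by (rule closed_L2_subspace_closure_span[OF L2])
    show "\<exists>A B. riesz_constants ?\<phi> A B" using R by blast
  qed simp_all
  moreover have "riesz_condition_number ?\<phi> = sqrt (?d + 2)"
    unfolding riesz_condition_number_def bounds using D by (simp add: real_sqrt_divide)
  ultimately show ?thesis
    using bounds unfolding D_def by (intro conjI)
qed

end
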